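(* Suppose that assumptions (FS1), (FS2), (FS3), (SS1), (PI1) and (PI2) (written out in the context) hold. Then $$E\left(\left[(\hat\theta-\theta)-\{\mathbf g'(\boldsymbol\tau_{\boldsymbol\rho})\}^{\top}\{\hat{\boldsymbol\tau}_{\boldsymbol\rho}-\boldsymbol\tau_{\boldsymbol\rho}\}\right]^2\right)=O(n_I^{-2}),$$ $$E\left[n_I\left|\hat V_{HT}(\hat\theta)-V(\hat\tau_l)\right|\right]=O(n_I^{-1/2}),$$ $$E\left[n_I\left|\hat V_{YG}(\hat\theta)-V(\hat\tau_l)\right|\right]=O(n_I^{-1/2}),$$ where $\hat\tau_l$ is the Horvitz–Thompson estimator obtained with the linearized variable $l(x)=\{\mathbf g'(\boldsymbol\tau_{\boldsymbol\rho})\}^{\top}\boldsymbol\rho(x)$ in place of $\rho(x)$, and $V(\hat\tau_l)$ is its variance under the two-stage sampling design.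
   Context: Setting. $\mathcal F\subset\mathbb R^d$ is a fixed bounded measurable set of Lebesgue measure $A>0$. We consider a sequence (index suppressed) of partitions of $\mathcal F$ into $N_I$ disjoint measurable sub-regions (primary sampling units, PSUs) forming $U_I=\{u_1,\dots,u_{N_I}\}$; $A_i$ is the measure of $u_i$. Asymptotics: $A$ is fixed, $N_I\to\infty$, the partition becomes increasingly fine (PSU diameters shrink to $0$), and $n_I\to\infty$. Constants in the assumptions do not depend on the position in the sequence; $O(\cdot)$ is along this sequence. Sampling. First stage: a random sample $S_I\subset U_I$ of size $n_I$ is selected (fixed size, as needed for use of the Yates–Grundy estimator); $I_{Ii}$ is the indicator of $u_i\in S_I$, $\pi_{Ii}=E(I_{Ii})$, $\pi_{Iij}=E(I_{Ii}I_{Ij})$ (so $\pi_{Iii}=\pi_{Ii}$), $\Delta_{Iij}=\pi_{Iij}-\pi_{Ii}\pi_{Ij}$. Second stage: conditionally on $S_I$, for each $u_i\in S_I$ a sample $S_{IIi}$ of $n_{IIi}$ points is drawn independently from a probability density $f_{IIi}$ supported on $u_i$; the second-stage mechanism does not depend on the realization of $S_I$, and the samples $S_{IIi}$ are conditionally independent across PSUs given $S_I$. Put $\pi_{IIi}(x)=n_{IIi}f_{IIi}(x)$ and $n_{II0}=N_I^{-1}\sum_{i=1}^{N_I}n_{IIi}$. Estimators for a scalar function $\rho:\mathcal F\to\mathbb R$. $\tau_\rho=\int_{\mathcal F}\rho(x)\,dx$, $\hat\tau_{\rho i}=\sum_{x\in S_{IIi}}\rho(x)/\pi_{IIi}(x)$,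 $\hat\tau_\rho=\sum_{u_i\in S_I}\hat\tau_{\rho i}/\pi_{Ii}$ (Horvitz–Thompson estimator), and $$\hat V_{HT}(\hat\tau_\rho)=\sum_{u_i\in S_I}\sum_{u_j\in S_I}\frac{\Delta_{Iij}}{\pi_{Iij}}\frac{\hat\tau_{\rho i}}{\pi_{Ii}}\frac{\hat\tau_{\rho j}}{\pi_{Ij}}+\sum_{u_i\in S_I}\frac{\hat V_i}{\pi_{Ii}},\quad \hat V_{YG}(\hat\tau_\rho)=-\frac12\sum_{u_i\ne u_j\in S_I}\frac{\Delta_{Iij}}{\pi_{Iij}}\left(\frac{\hat\tau_{\rho i}}{\pi_{Ii}}-\frac{\hat\tau_{\rho j}}{\pi_{Ij}}\right)^2+\sum_{u_i\in S_I}\frac{\hat V_i}{\pi_{Ii}},$$ $$\hat V_i=\frac{n_{IIi}}{n_{IIi}-1}\sum_{x\in S_{IIi}}\left\{\frac{\rho(x)}{\pi_{IIi}(x)}-\frac{\hat\tau_{\rho i}}{n_{IIi}}\right\}^2.$$ Plug-in. $\boldsymbol\rho:\mathcal F\to\mathbb R^Q$ is a measurable vector function, $g:\mathbb R^Q\to\mathbb R$, $\boldsymbol\tau_{\boldsymbol\rho}=\int_{\mathcal F}\boldsymbol\rho(x)\,dx$, $\hat{\boldsymbol\tau}_{\boldsymbol\rho}$ is the vector of Horvitz–Thompson estimators of the components, $\theta=g(\boldsymbol\tau_{\boldsymbol\rho})$, $\hat\theta=g(\hat{\boldsymbol\tau}_{\boldsymbol\rho})$; $\mathbf g'$ denotes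 the gradient of $g$. The estimators $\hat V_{HT}(\hat\theta)$ and $\hat V_{YG}(\hat\theta)$ are obtained by replacing $\rho(x)$ by $\hat l(x)=\{\mathbf g'(\hat{\boldsymbol\tau}_{\boldsymbol\rho})\}^{\top}\boldsymbol\rho(x)$ in $\hat V_{HT}(\hat\tau_\rho)$ and $\hat V_{YG}(\hat\tau_\rho)$. Assumptions. (FS1) There exist constants $f_{I0}<1$ and $0<c_{I1}\le C_{I1}<\infty$ with $n_I/N_I\le f_{I0}$ and $c_{I1}\le (N_I/n_I)\pi_{Ii}\le C_{I1}$ for all $i$. (FS2) There exist constants $C_{I2},C_{I3},C_{I4}>0$ such that, the maxima being over distinct indices in $\{1,\dots,N_I\}$, $\Delta_{I2}=\max|E\{(I_{Ii}-\pi_{Ii})(I_{Ij}-\pi_{Ij})\}|\le C_{I2}N_I^{-2}n_I$, $\Delta_{I3}=\max|E\{(I_{Ii}-\pi_{Ii})(I_{Ij}-\pi_{Ij})(I_{Ii'}-\pi_{Ii'})\}|\le C_{I3}N_I^{-3}n_I^2$, $\Delta_{I4}=\max|E\{(I_{Ii}-\pi_{Ii})(I_{Ij}-\pi_{Ij})(I_{Ii'}-\pi_{Ii'})(I_{Ij'}-\pi_{Ij'})\}|\le C_{I4}N_I^{-4}n_I^2$. (FS3) There exists $c_{I2}>0$ such that $c_{I2}N_I^{-2}n_I^2\le\pi_{Iij}$ for all $i\ne j$. (SS1) There exist constants $0<\lambda_1\le\Lambda_1<\infty$, $0<\phi_1\le\Phi_1<\infty$, $0<c_1\le C_1<\infty$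 such that for every PSU $u_i$: $\lambda_1n_{II0}\le n_{IIi}\le\Lambda_1n_{II0}$; $\phi_1A/N_I\le A_i\le\Phi_1A/N_I$; $c_1/A_i\le f_{IIi}(x)\le C_1/A_i$ for all $x\in u_i$; and $n_{IIi}\ge2$. (PI1) $g$ is homogeneous of degree $0$: $g(r\mathbf a)=g(\mathbf a)$ for every real $r>0$ and $\mathbf a\in\mathbb R^Q$. (PI2) $\boldsymbol\rho$ takes values in a convex compact set $\mathcal C\subset\mathbb R^Q$, and $\boldsymbol\mu_{\boldsymbol\rho}=A^{-1}\boldsymbol\tau_{\boldsymbol\rho}$ is an interior point of $\mathcal C$. The function $g$ is differentiable on $\mathcal C$ (at every point of $\mathcal C$), and there exists $K_g>0$ such that $\|\mathbf g'(\mathbf b)-\mathbf g'(\mathbf a)\|\le K_g\|\mathbf b-\mathbf a\|$ for all $\mathbf a,\mathbf b\in\mathcal C$ (Euclidean norm). *)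

theory Defs
  imports "HOL-Probability.Probability"
begin

text \<open>
  One two-stage design. The PSUs are \<open>psu D i\<close> for \<open>i < N\<^sub>I D\<close>; \<open>fst_sample D \<omega>\<close> is the set of
  indices of the sampled PSUs, and \<open>point D i k \<omega>\<close>, for \<open>k < n_II D i\<close>, are the points of the
  second-stage sample in \<open>psu D i\<close>. The latter are meaningful only when \<open>i \<in> fst_sample D \<omega>\<close>.
\<close>

record ('w, 'a) two_stage_design =
  N_I :: nat
  n_I :: nat
  psu :: "nat \<Rightarrow> 'a set"
  n_II :: "nat \<Rightarrow> nat"
  dens :: "nat \<Rightarrow> 'a \<Rightarrow> real"
  pspace :: "'w measure"
  fst_sample :: "'w \<Rightarrow> nat set"
  point :: "nat \<Rightarrow> nat \<Rightarrow> 'w \<Rightarrow> 'a"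

definition partition_of :: "'a::euclidean_space set \<Rightarrow> ('w, 'a) two_stage_design \<Rightarrow> bool" where
  "partition_of F D \<longleftrightarrow>
     (\<forall>i<N_I D. psu D i \<in> sets lebesgue) \<and>
     disjoint_family_on (psu D) {..<N_I D} \<and>
     (\<Union>i<N_I D. psu D i) = F"

definition first_stage :: "('w, 'a) two_stage_design \<Rightarrow> bool" where
  "first_stage D \<longleftrightarrow>
     prob_space (pspace D) \<and>
     fst_sample D \<in> measurable (pspace D) (count_space {s. s \<subseteq> {..<N_I D} \<and> card s = n_I D})"

definition fst_event :: "('w, 'a) two_stage_design \<Rightarrow> nat set \<Rightarrow> 'w set" where
  "fst_event D s = {\<omega> \<in> space (pspace D). fst_sample D \<omega> = s}"

text \<open>
  \<open>uniform_measure (pspace D) (fst_event D s)\<close> is the conditional law given that the first-stage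
  sample is \<open>s\<close>. That the second-stage mechanism does not depend on the first-stage sample is
  expressed by \<open>dens D i\<close> and \<open>n_II D i\<close> not depending on \<open>s\<close>.
\<close>

definition second_stage :: "('w, 'a::euclidean_space) two_stage_design \<Rightarrow> bool" where
  "second_stage D \<longleftrightarrow>
     (\<forall>i<N_I D.
        dens D i \<in> borel_measurable lebesgue \<and>
        (\<forall>x. 0 \<le> dens D i x) \<and>
        (\<forall>x. x \<notin> psu D i \<longrightarrow> dens D i x = 0) \<and>
        (\<integral>\<^sup>+x. ennreal (dens D i x) \<partial>lebesgue) = 1 \<and>
        (\<forall>k<n_II D i. point D i k \<in> measurable (pspace D) lebesgue)) \<and>
     (\<forall>s. emeasure (pspace D) (fst_event D s) > 0 \<longrightarrow>
        prob_space.indep_vars (uniform_measure (pspace D) (fst_event D s))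
          (\<lambda>_. lebesgue) (\<lambda>(i, k). point D i k) (SIGMA i:s. {..<n_II D i}) \<and>
        (\<forall>i\<in>s. \<forall>k<n_II D i.
           distributed (uniform_measure (pspace D) (fst_event D s)) lebesgue
             (point D i k) (\<lambda>x. ennreal (dens D i x))))"

definition two_stage_sampling ::
  "'a::euclidean_space set \<Rightarrow> ('w, 'a) two_stage_design \<Rightarrow> bool" where
  "two_stage_sampling F D \<longleftrightarrow> partition_of F D \<and> first_stage D \<and> second_stage D"

definition incl :: "('w, 'a) two_stage_design \<Rightarrow> nat \<Rightarrow> 'w \<Rightarrow> real" where
  "incl D i \<omega> = indicator (fst_sample D \<omega>) i"

definition pi_I :: "('w, 'a) two_stage_design \<Rightarrow> nat \<Rightarrow> real" where
  "pi_I D i = (LINT \<omega>|pspace D. incl D i \<omega>)"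

definition pi_I2 :: "('w, 'a) two_stage_design \<Rightarrow> nat \<Rightarrow> nat \<Rightarrow> real" where
  "pi_I2 D i j = (LINT \<omega>|pspace D. incl D i \<omega> * incl D j \<omega>)"

definition Delta_I :: "('w, 'a) two_stage_design \<Rightarrow> nat \<Rightarrow> nat \<Rightarrow> real" where
  "Delta_I D i j = pi_I2 D i j - pi_I D i * pi_I D j"

definition pi_II :: "('w, 'a) two_stage_design \<Rightarrow> nat \<Rightarrow> 'a \<Rightarrow> real" where
  "pi_II D i x = real (n_II D i) * dens D i x"

definition n_II0 :: "('w, 'a) two_stage_design \<Rightarrow> real" where
  "n_II0 D = (\<Sum>i<N_I D. real (n_II D i)) / real (N_I D)"

definition total :: "'a::euclidean_space set \<Rightarrow> ('a \<Rightarrow> 'b::{banach, second_countable_topology}) \<Rightarrow> 'b"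
  where "total F \<rho> = (LINT x:F|lebesgue. \<rho> x)"

text \<open>
  The Horvitz--Thompson estimators are defined for vector-valued \<open>\<rho>\<close> by scalar division; this is the
  scalar estimator for real \<open>\<rho>\<close> and the vector of the estimators of the components in general.
\<close>

definition HT_psu ::
  "('w, 'a) two_stage_design \<Rightarrow> ('a \<Rightarrow> 'b::real_vector) \<Rightarrow> nat \<Rightarrow> 'w \<Rightarrow> 'b" where
  "HT_psu D \<rho> i \<omega> = (\<Sum>k<n_II D i. \<rho> (point D i k \<omega>) /\<^sub>R pi_II D i (point D i k \<omega>))"

definition HT :: "('w, 'a) two_stage_design \<Rightarrow> ('a \<Rightarrow> 'b::real_vector) \<Rightarrow> 'w \<Rightarrow> 'b" where
  "HT D \<rho> \<omega> = (\<Sum>i\<in>fst_sample D \<omega>. HT_psu D \<rho> i \<omega> /\<^sub>R pi_I D i)"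

definition V_psu :: "('w, 'a) two_stage_design \<Rightarrow> ('a \<Rightarrow> real) \<Rightarrow> nat \<Rightarrow> 'w \<Rightarrow> real" where
  "V_psu D \<rho> i \<omega> =
     real (n_II D i) / (real (n_II D i) - 1) *
     (\<Sum>k<n_II D i. (\<rho> (point D i k \<omega>) / pi_II D i (point D i k \<omega>)
                      - HT_psu D \<rho> i \<omega> / real (n_II D i))\<^sup>2)"

definition V_HT :: "('w, 'a) two_stage_design \<Rightarrow> ('a \<Rightarrow> real) \<Rightarrow> 'w \<Rightarrow> real" where
  "V_HT D \<rho> \<omega> =
     (\<Sum>i\<in>fst_sample D \<omega>. \<Sum>j\<in>fst_sample D \<omega>.
        Delta_I D i j / pi_I2 D i j *
        (HT_psu D \<rho> i \<omega> / pi_I D i) * (HT_psu D \<rho> j \<omega> / pi_I D j)) +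
     (\<Sum>i\<in>fst_sample D \<omega>. V_psu D \<rho> i \<omega> / pi_I D i)"

definition V_YG :: "('w, 'a) two_stage_design \<Rightarrow> ('a \<Rightarrow> real) \<Rightarrow> 'w \<Rightarrow> real" where
  "V_YG D \<rho> \<omega> =
     - (1 / 2) * (\<Sum>i\<in>fst_sample D \<omega>. \<Sum>j\<in>fst_sample D \<omega> - {i}.
        Delta_I D i j / pi_I2 D i j *
        (HT_psu D \<rho> i \<omega> / pi_I D i - HT_psu D \<rho> j \<omega> / pi_I D j)\<^sup>2) +
     (\<Sum>i\<in>fst_sample D \<omega>. V_psu D \<rho> i \<omega> / pi_I D i)"

text \<open>Unspecified at points where \<open>g\<close> is not differentiable.\<close>

definition gradient :: "('b::euclidean_space \<Rightarrow> real) \<Rightarrow> 'b \<Rightarrow> 'b" where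
  "gradient g x = (THE v. GDERIV g x :> v)"

definition theta_hat ::
  "('w, 'a) two_stage_design \<Rightarrow> ('a \<Rightarrow> 'b::euclidean_space) \<Rightarrow> ('b \<Rightarrow> real) \<Rightarrow> 'w \<Rightarrow> real" where
  "theta_hat D \<rho> g \<omega> = g (HT D \<rho> \<omega>)"

definition l_hat ::
  "('w, 'a) two_stage_design \<Rightarrow> ('a \<Rightarrow> 'b::euclidean_space) \<Rightarrow> ('b \<Rightarrow> real) \<Rightarrow> 'w \<Rightarrow> 'a \<Rightarrow> real" where
  "l_hat D \<rho> g \<omega> x = gradient g (HT D \<rho> \<omega>) \<bullet> \<rho> x"

definition V_HT_plugin ::
  "('w, 'a) two_stage_design \<Rightarrow> ('a \<Rightarrow> 'b::euclidean_space) \<Rightarrow> ('b \<Rightarrow> real) \<Rightarrow> 'w \<Rightarrow> real" where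
  "V_HT_plugin D \<rho> g \<omega> = V_HT D (l_hat D \<rho> g \<omega>) \<omega>"

definition V_YG_plugin ::
  "('w, 'a) two_stage_design \<Rightarrow> ('a \<Rightarrow> 'b::euclidean_space) \<Rightarrow> ('b \<Rightarrow> real) \<Rightarrow> 'w \<Rightarrow> real" where
  "V_YG_plugin D \<rho> g \<omega> = V_YG D (l_hat D \<rho> g \<omega>) \<omega>"

definition lin_var ::
  "'a::euclidean_space set \<Rightarrow> ('a \<Rightarrow> 'b::euclidean_space) \<Rightarrow> ('b \<Rightarrow> real) \<Rightarrow> 'a \<Rightarrow> real" where
  "lin_var F \<rho> g x = gradient g (total F \<rho>) \<bullet> \<rho> x"

definition lin_error ::
  "'a::euclidean_space set \<Rightarrow> ('w, 'a) two_stage_design \<Rightarrow> ('a \<Rightarrow> 'b::euclidean_space) \<Rightarrow>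
     ('b \<Rightarrow> real) \<Rightarrow> 'w \<Rightarrow> real" where
  "lin_error F D \<rho> g \<omega> =
     (theta_hat D \<rho> g \<omega> - g (total F \<rho>))
     - gradient g (total F \<rho>) \<bullet> (HT D \<rho> \<omega> - total F \<rho>)"

definition V_lin ::
  "'a::euclidean_space set \<Rightarrow> ('w, 'a) two_stage_design \<Rightarrow> ('a \<Rightarrow> 'b::euclidean_space) \<Rightarrow>
     ('b \<Rightarrow> real) \<Rightarrow> real" where
  "V_lin F D \<rho> g = prob_space.variance (pspace D) (HT D (lin_var F \<rho> g))"

definition FS1 :: "(nat \<Rightarrow> ('w, 'a) two_stage_design) \<Rightarrow> bool" where
  "FS1 D \<longleftrightarrow> (\<exists>f\<^sub>0 c C. f\<^sub>0 < 1 \<and> 0 < c \<and> c \<le> C \<and>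
     (\<forall>t. real (n_I (D t)) / real (N_I (D t)) \<le> f\<^sub>0 \<and>
       (\<forall>i<N_I (D t).
          c \<le> real (N_I (D t)) / real (n_I (D t)) * pi_I (D t) i \<and>
          real (N_I (D t)) / real (n_I (D t)) * pi_I (D t) i \<le> C)))"

definition central_moment :: "('w, 'a) two_stage_design \<Rightarrow> nat set \<Rightarrow> real" where
  "central_moment D J = (LINT \<omega>|pspace D. (\<Prod>i\<in>J. incl D i \<omega> - pi_I D i))"

text \<open>
  A maximum over \<open>m\<close> distinct indices is bounded by bounding the moment of every index set of
  cardinality \<open>m\<close>; this is void if there are fewer than \<open>m\<close> PSUs.
\<close>

definition FS2 :: "(nat \<Rightarrow> ('w, 'a) two_stage_design) \<Rightarrow> bool" where
  "FS2 D \<longleftrightarrow> (\<exists>C\<^sub>2 C\<^sub>3 C\<^sub>4. 0 < C\<^sub>2 \<and> 0 < C\<^sub>3 \<and> 0 < C\<^sub>4 \<and>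
     (\<forall>t. \<forall>J \<subseteq> {..<N_I (D t)}.
       (card J = 2 \<longrightarrow>
          \<bar>central_moment (D t) J\<bar> \<le> C\<^sub>2 * real (n_I (D t)) / real (N_I (D t)) ^ 2) \<and>
       (card J = 3 \<longrightarrow>
          \<bar>central_moment (D t) J\<bar> \<le> C\<^sub>3 * real (n_I (D t)) ^ 2 / real (N_I (D t)) ^ 3) \<and>
       (card J = 4 \<longrightarrow>
          \<bar>central_moment (D t) J\<bar> \<le> C\<^sub>4 * real (n_I (D t)) ^ 2 / real (N_I (D t)) ^ 4)))"

definition FS3 :: "(nat \<Rightarrow> ('w, 'a) two_stage_design) \<Rightarrow> bool" where
  "FS3 D \<longleftrightarrow> (\<exists>c. 0 < c \<and>
     (\<forall>t. \<forall>i<N_I (D t). \<forall>j<N_I (D t). i \<noteq> j \<longrightarrow>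
        c * real (n_I (D t)) ^ 2 / real (N_I (D t)) ^ 2 \<le> pi_I2 (D t) i j))"

definition SS1 ::
  "'a::euclidean_space set \<Rightarrow> (nat \<Rightarrow> ('w, 'a) two_stage_design) \<Rightarrow> bool" where
  "SS1 F D \<longleftrightarrow> (\<exists>l\<^sub>1 L\<^sub>1 p\<^sub>1 P\<^sub>1 c\<^sub>1 C\<^sub>1.
     0 < l\<^sub>1 \<and> l\<^sub>1 \<le> L\<^sub>1 \<and> 0 < p\<^sub>1 \<and> p\<^sub>1 \<le> P\<^sub>1 \<and> 0 < c\<^sub>1 \<and> c\<^sub>1 \<le> C\<^sub>1 \<and>
     (\<forall>t. \<forall>i<N_I (D t).
        l\<^sub>1 * n_II0 (D t) \<le> real (n_II (D t) i) \<and> real (n_II (D t) i) \<le> L\<^sub>1 * n_II0 (D t) \<and>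
        p\<^sub>1 * measure lebesgue F / real (N_I (D t)) \<le> measure lebesgue (psu (D t) i) \<and>
        measure lebesgue (psu (D t) i) \<le> P\<^sub>1 * measure lebesgue F / real (N_I (D t)) \<and>
        (\<forall>x\<in>psu (D t) i.
           c\<^sub>1 / measure lebesgue (psu (D t) i) \<le> dens (D t) i x \<and>
           dens (D t) i x \<le> C\<^sub>1 / measure lebesgue (psu (D t) i)) \<and>
        2 \<le> n_II (D t) i))"

definition PI1 :: "('b::euclidean_space \<Rightarrow> real) \<Rightarrow> bool" where
  "PI1 g \<longleftrightarrow> (\<forall>r>0. \<forall>a. g (r *\<^sub>R a) = g a)"

text \<open>
  Differentiability at the points of \<open>K\<close>, boundary points included, is that of \<open>g\<close> as a function on
  the whole space, so that the gradient is defined there.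
\<close>

definition PI2 ::
  "'a::euclidean_space set \<Rightarrow> ('a \<Rightarrow> 'b::euclidean_space) \<Rightarrow> ('b \<Rightarrow> real) \<Rightarrow> bool" where
  "PI2 F \<rho> g \<longleftrightarrow> (\<exists>K. convex K \<and> compact K \<and> \<rho> ` F \<subseteq> K \<and>
     total F \<rho> /\<^sub>R measure lebesgue F \<in> interior K \<and>
     (\<forall>a\<in>K. g differentiable (at a)) \<and>
     (\<exists>K\<^sub>g>0. \<forall>a\<in>K. \<forall>b\<in>K. norm (gradient g b - gradient g a) \<le> K\<^sub>g * norm (b - a)))"

end

(* Multiplying by the inverse of the estimated area W = HT 1 moves the Horvitz--Thompson estimator of the
   total into the convex set K, where g is differentiable with a Lipschitz gradient. As g is homogeneous
   of degree 0, g' is homogeneous of degree -1 and g'(a) . a = 0, so the linearization error is quadratic in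
   the errors of HT rho and of W, and the plug-in variance estimators, quadratic forms in the gradient,
   differ from those of the linearized variable by O(1/n) times these errors. It remains to show, for
   bounded scalar variables, that the fourth moment of the error of the Horvitz--Thompson estimator is
   O(n^-2), and that both variance estimators are unbiased with variance O(n^-3). In the first stage this
   is a matter of counting coincidences of indices in moments of the centred inclusion indicators; in the
   second stage, of counting pairs of terms that share a PSU, all others being uncorrelated. *)

theory Submission
  imports Defs
begin

text \<open>The plug-in variable depends on the very sample on which it is evaluated, so moments of
  quadratic forms with deterministic coefficients say nothing about it directly. The comparison with
  the linearized variable is therefore made sample by sample, and expectations are taken only of the
  resulting scalar error. Dividing by \<open>W\<close> costs nothing: the bounds on inclusion
  probabilities and densities keep \<open>W\<close> above a fixed positive constant almost surely,
  so no event of small probability has to be split off. The rates come from a count. The weighted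
  total of one PSU is of order 1/n, and the weights of pairs of distinct PSUs are of order 1/n as
  well; a variance estimator thus has n terms of order n^-2 that involve one PSU and n^2 terms of
  order n^-3 that involve two. The former fluctuate with variance n * n^-4, the latter with variance
  n^3 * n^-6, since n^3 pairs of pairs share a PSU; both are n^-3. All bounds are explicit in one
  constant, which makes them uniform along the sequence of designs.\<close>

section \<open>Elementary inequalities and sums over coinciding indices\<close>

lemma power2_add_le:
  fixes u v :: real
  shows "(u + v)\<^sup>2 \<le> 2 * u\<^sup>2 + 2 * v\<^sup>2"
  using sum_squares_bound[of u v] by (simp add: power2_sum)

lemma power4_add_le:
  fixes u v :: real
  shows "(u + v) ^ 4 \<le> 8 * u ^ 4 + 8 * v ^ 4"
proof -
  have "((u + v)\<^sup>2)\<^sup>2 \<le> (2 * u\<^sup>2 + 2 * v\<^sup>2)\<^sup>2" by (intro power_mono power2_add_le) auto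
  also have "\<dots> \<le> 2 * (2 * u\<^sup>2)\<^sup>2 + 2 * (2 * v\<^sup>2)\<^sup>2" by (rule power2_add_le)
  finally show ?thesis by (simp add: power_mult_distrib)
qed

lemma sq_le_of_abs_le:
  fixes a c :: real assumes "\<bar>a\<bar> \<le> c" shows "a\<^sup>2 \<le> c\<^sup>2"
  using power_mono[OF assms, of 2] by simp

lemma sum_power4:
  fixes f :: "'i \<Rightarrow> real"
  shows "(\<Sum>i\<in>A. f i) ^ 4 = (\<Sum>i\<in>A. \<Sum>j\<in>A. \<Sum>k\<in>A. \<Sum>l\<in>A. f i * f j * f k * f l)"
  by (simp only: sum_distrib_left[symmetric] sum_distrib_right[symmetric] power4_eq_xxxx)

lemma double_sum_power2:
  fixes f :: "'i \<Rightarrow> 'i \<Rightarrow> real"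
  shows "(\<Sum>i\<in>A. \<Sum>j\<in>A. f i j)\<^sup>2 = (\<Sum>i\<in>A. \<Sum>j\<in>A. \<Sum>k\<in>A. \<Sum>l\<in>A. f i j * f k l)"
  by (simp only: sum_distrib_left[symmetric] sum_distrib_right[symmetric] power2_eq_square)

lemma sum_power2:
  fixes f :: "'i \<Rightarrow> real"
  shows "(\<Sum>i\<in>A. f i)\<^sup>2 = (\<Sum>i\<in>A. \<Sum>j\<in>A. f i * f j)"
  by (simp only: sum_product power2_eq_square)

text \<open>A further index either lies in \<open>S\<close>, which leaves the cardinality unchanged
  and happens \<open>card S\<close> times, or is new, which costs a factor 1/N and happens at most N
  times.\<close>

lemma sum_inverse_power_card_insert:
  fixes N :: real
  assumes "finite S" "real m \<le> N" "0 < N"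
  shows "(\<Sum>l<m. 1 / N ^ card (insert l S)) \<le> (card S + 1) * (1 / N ^ card S)"
proof -
  have "(\<Sum>l<m. 1 / N ^ card (insert l S)) \<le> (\<Sum>l<m. indicat_real S l * (1 / N ^ card S) + 1 / N ^ Suc (card S))"
    using assms by (intro sum_mono) (auto simp: indicator_def insert_absorb)
  also have "\<dots> = card ({..<m} \<inter> S) * (1 / N ^ card S) + m * (1 / N ^ Suc (card S))"
    unfolding sum.distrib sum_distrib_right[symmetric] by (simp add: indicator_def sum.If_cases of_bool_def)
  also have "\<dots> \<le> card S * (1 / N ^ card S) + N * (1 / N ^ Suc (card S))"
    using assms by (intro add_mono mult_right_mono) (auto intro: card_mono)
  also have "\<dots> = (card S + 1) * (1 / N ^ card S)"
    using assms by (simp add: field_simps)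
  finally show ?thesis .
qed

text \<open>Summing out the four indices one at a time, innermost first, contributes the factors 4,
  3, 2 and 1, whence 24.\<close>

lemma sum_inverse_power_card4:
  fixes N :: nat
  assumes "0 < N"
  shows "(\<Sum>i<N. \<Sum>j<N. \<Sum>k<N. \<Sum>l<N. 1 / real N ^ card {l, k, j, i}) \<le> 24"
proof -
  \<comment> \<open>The remaining indices may coincide, so only an upper bound \<open>c\<close> for
    their number is available.\<close>
  have step: "(\<Sum>l<N. 1 / real N ^ card (insert l S)) \<le> (real c + 1) * (1 / real N ^ card S)"
    if "finite S" "card S \<le> c" for S c
  proof -
    have "(\<Sum>l<N. 1 / real N ^ card (insert l S)) \<le> (card S + 1) * (1 / real N ^ card S)"
      using sum_inverse_power_card_insert[OF that(1), of N N] assms by simp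
    also have "\<dots> \<le> (real c + 1) * (1 / real N ^ card S)"
      using that(2) by (intro mult_right_mono) auto
    finally show ?thesis .
  qed
  have 4: "(\<Sum>l<N. 1 / real N ^ card {l, k, j, i}) \<le> 4 * (1 / real N ^ card {k, j, i})" for i j k
    using step[of "{k, j, i}" 3] by (simp add: card_insert_le_m1)
  have 3: "(\<Sum>k<N. 1 / real N ^ card {k, j, i}) \<le> 3 * (1 / real N ^ card {j, i})" for i j
    using step[of "{j, i}" 2] by (simp add: card_insert_le_m1)
  have 2: "(\<Sum>j<N. 1 / real N ^ card {j, i}) \<le> 2 * (1 / real N ^ card {i})" for i
    using step[of "{i}" 1] by simp
  have "(\<Sum>i<N. \<Sum>j<N. \<Sum>k<N. \<Sum>l<N. 1 / real N ^ card {l, k, j, i})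
      \<le> (\<Sum>i<N. \<Sum>j<N. 4 * (\<Sum>k<N. 1 / real N ^ card {k, j, i}))"
    unfolding sum_distrib_left by (intro sum_mono 4)
  also have "\<dots> \<le> (\<Sum>i<N. 4 * (3 * (\<Sum>j<N. 1 / real N ^ card {j, i})))"
    unfolding sum_distrib_left[symmetric] by (intro sum_mono mult_left_mono)
      (auto simp only: sum_distrib_left intro!: sum_mono 3)
  also have "\<dots> \<le> (\<Sum>i<N. 4 * (3 * (2 * (1 / real N ^ card {i}))))"
    by (intro sum_mono mult_left_mono 2) auto
  also have "\<dots> = 24" using assms by simp
  finally show ?thesis .
qed

section \<open>First-stage moments\<close>

text \<open>A fixed-size design as a weight on the finitely many index sets of that size:
  first-stage means become finite sums, free of measurability and integrability conditions.\<close>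

locale finite_design =
  fixes N n :: nat and p :: "nat set \<Rightarrow> real"
  assumes p_nonneg: "0 \<le> p s"
    and sum_p: "(\<Sum>s | s \<subseteq> {..<N} \<and> card s = n. p s) = 1"
begin

abbreviation samples :: "nat set set" where
  "samples \<equiv> {s. s \<subseteq> {..<N} \<and> card s = n}"

lemma finite_sample: "s \<in> samples \<Longrightarrow> finite s"
  by (auto intro: finite_subset)

definition dmean :: "(nat set \<Rightarrow> real) \<Rightarrow> real" where
  "dmean h = (\<Sum>s\<in>samples. p s * h s)"

definition \<pi> :: "nat \<Rightarrow> real" where
  "\<pi> i = dmean (\<lambda>s. indicat_real s i)"

definition \<pi>2 :: "nat \<Rightarrow> nat \<Rightarrow> real" where
  "\<pi>2 i j = dmean (\<lambda>s. indicat_real s i * indicat_real s j)"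

definition \<Delta> :: "nat \<Rightarrow> nat \<Rightarrow> real" where
  "\<Delta> i j = \<pi>2 i j - \<pi> i * \<pi> j"

definition ci :: "nat set \<Rightarrow> nat \<Rightarrow> real" where
  "ci s i = indicat_real s i - \<pi> i"

lemma dmean_const [simp]: "dmean (\<lambda>_. c) = c"
  unfolding dmean_def by (simp add: sum_p flip: sum_distrib_right)

lemma dmean_add: "dmean (\<lambda>s. f s + h s) = dmean f + dmean h"
  by (simp add: dmean_def sum.distrib algebra_simps)

lemma dmean_diff: "dmean (\<lambda>s. f s - h s) = dmean f - dmean h"
  by (simp add: dmean_def sum_subtractf right_diff_distrib)

lemma dmean_cmult: "dmean (\<lambda>s. c * f s) = c * dmean f"
  unfolding dmean_def by (simp add: mult.left_commute flip: sum_distrib_left)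

lemma dmean_multc: "dmean (\<lambda>s. f s * c) = dmean f * c"
  unfolding dmean_def by (simp add: mult.assoc[symmetric] flip: sum_distrib_right)

lemma dmean_sum: "dmean (\<lambda>s. \<Sum>i\<in>I. f i s) = (\<Sum>i\<in>I. dmean (f i))"
  unfolding dmean_def sum_distrib_left by (rule sum.swap)

lemma dmean_mono: "(\<And>s. s \<in> samples \<Longrightarrow> f s \<le> h s) \<Longrightarrow> dmean f \<le> dmean h"
  unfolding dmean_def by (intro sum_mono mult_left_mono p_nonneg) auto

lemma dmean_cong: "(\<And>s. s \<in> samples \<Longrightarrow> f s = h s) \<Longrightarrow> dmean f = dmean h"
  unfolding dmean_def by (intro sum.cong) auto

lemma dmean_abs: "\<bar>dmean f\<bar> \<le> dmean (\<lambda>s. \<bar>f s\<bar>)"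
  unfolding dmean_def by (rule order_trans[OF sum_abs]) (simp add: abs_mult p_nonneg)

lemma dmean_nonneg: "(\<And>s. s \<in> samples \<Longrightarrow> 0 \<le> f s) \<Longrightarrow> 0 \<le> dmean f"
  using dmean_mono[of "\<lambda>_. 0" f] by simp

lemma pi_bounds: "0 \<le> \<pi> i" "\<pi> i \<le> 1"
  unfolding \<pi>_def using dmean_nonneg[of "\<lambda>s. indicat_real s i"]
    dmean_mono[of "\<lambda>s. indicat_real s i" "\<lambda>_. 1"] by (auto simp: indicator_def)

lemma abs_ci_le_1: "\<bar>ci s i\<bar> \<le> 1"
  using pi_bounds[of i] by (auto simp: ci_def indicator_def)

lemma abs_ci_le: "\<bar>ci s i\<bar> \<le> indicat_real s i + \<pi> i"
  using pi_bounds[of i] by (auto simp: ci_def indicator_def)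

text \<open>An indicator is idempotent, so the square of the centred one is affine in it. This
  lowers the degree of a moment in which an index is repeated.\<close>

lemma ci_power2: "ci s i * ci s i = (1 - 2 * \<pi> i) * ci s i + \<pi> i * (1 - \<pi> i)"
  by (auto simp: ci_def indicator_def algebra_simps)

lemma dmean_ci_ci: "dmean (\<lambda>s. ci s i * ci s j) = \<Delta> i j"
  unfolding ci_def \<Delta>_def \<pi>2_def
  by (simp add: left_diff_distrib right_diff_distrib dmean_diff dmean_cmult dmean_multc flip: \<pi>_def)

lemma pi2_same: "\<pi>2 i i = \<pi> i"
  unfolding \<pi>2_def \<pi>_def by (rule dmean_cong) (auto simp: indicator_def)

lemma Delta_same: "\<Delta> i i = \<pi> i * (1 - \<pi> i)"
  by (simp add: \<Delta>_def pi2_same algebra_simps)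

lemma \<pi>2_commute: "\<pi>2 i j = \<pi>2 j i"
  by (simp add: \<pi>2_def mult.commute)

lemma \<Delta>_commute: "\<Delta> i j = \<Delta> j i"
  by (simp add: \<Delta>_def \<pi>2_commute[of i j] mult.commute)

lemma sum_indicator_sample: "s \<in> samples \<Longrightarrow> (\<Sum>i<N. indicat_real s i * f i) = sum f s"
  by (auto simp: indicator_def if_distrib[of "\<lambda>x. x * _"] sum.If_cases Int_absorb1 Int_absorb2
      cong: if_cong)

lemma card_sample: "s \<in> samples \<Longrightarrow> (\<Sum>i<N. indicat_real s i) = n"
  using sum_indicator_sample[of s "\<lambda>_. 1"] by simp

text \<open>The sample size is constant, and the covariance of an indicator with a constant is zero.
  Unbiasedness of the Yates-Grundy estimator rests on this.\<close>

lemma sum_Delta: "(\<Sum>j<N. \<Delta> i j) = 0"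
proof -
  have "(\<Sum>j<N. \<pi>2 i j) = dmean (\<lambda>s. indicat_real s i * (\<Sum>j<N. indicat_real s j))"
    unfolding \<pi>2_def dmean_sum[symmetric] by (simp add: sum_distrib_left)
  also have "\<dots> = dmean (\<lambda>s. indicat_real s i * n)"
    by (rule dmean_cong) (use card_sample in simp)
  also have "\<dots> = \<pi> i * n" by (simp add: dmean_multc \<pi>_def)
  finally have 1: "(\<Sum>j<N. \<pi>2 i j) = \<pi> i * n" .
  have "(\<Sum>j<N. \<pi> j) = dmean (\<lambda>s. n)"
    unfolding \<pi>_def dmean_sum[symmetric] by (rule dmean_cong) (use card_sample in simp)
  then show ?thesis
    using 1 by (simp add: \<Delta>_def sum_subtractf flip: sum_distrib_left)
qed

end

text \<open>A single constant \<open>\<kappa>\<close> dominates all the constants of the assumptions.\<close>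

locale regular_finite_design = finite_design +
  fixes \<kappa> :: real
  assumes \<kappa>: "1 \<le> \<kappa>"
    and N_pos: "0 < N" and n_pos: "0 < n"
    and pi_le: "\<And>i. i < N \<Longrightarrow> \<pi> i \<le> \<kappa> * n / N"
    and pi_ge: "\<And>i. i < N \<Longrightarrow> n / N \<le> \<kappa> * \<pi> i"
    and pi2_ge: "\<And>i j. i < N \<Longrightarrow> j < N \<Longrightarrow> i \<noteq> j \<Longrightarrow> n\<^sup>2 / N\<^sup>2 \<le> \<kappa> * \<pi>2 i j"
    and cm2: "\<And>J. J \<subseteq> {..<N} \<Longrightarrow> card J = 2 \<Longrightarrow> \<bar>dmean (\<lambda>s. \<Prod>i\<in>J. ci s i)\<bar> \<le> \<kappa> * n / N ^ 2"
    and cm3: "\<And>J. J \<subseteq> {..<N} \<Longrightarrow> card J = 3 \<Longrightarrow> \<bar>dmean (\<lambda>s. \<Prod>i\<in>J. ci s i)\<bar> \<le> \<kappa> * n ^ 2 / N ^ 3"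
    and cm4: "\<And>J. J \<subseteq> {..<N} \<Longrightarrow> card J = 4 \<Longrightarrow> \<bar>dmean (\<lambda>s. \<Prod>i\<in>J. ci s i)\<bar> \<le> \<kappa> * n ^ 2 / N ^ 4"
begin

lemma n_le_N: "n \<le> N"
proof -
  have "samples \<noteq> {}" using sum_p by (metis sum.empty zero_neq_one)
  then obtain s where "s \<subseteq> {..<N}" "card s = n" by auto
  then show ?thesis by (metis card_lessThan card_mono finite_lessThan)
qed

lemma pi_pos: "i < N \<Longrightarrow> 0 < \<pi> i"
  using pi_ge[of i] \<kappa> N_pos n_pos
  by (smt (verit) divide_pos_pos mult_nonneg_nonpos of_nat_0_less_iff)

lemma pi2_pos: "i < N \<Longrightarrow> j < N \<Longrightarrow> i \<noteq> j \<Longrightarrow> 0 < \<pi>2 i j"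
  using pi2_ge[of i j] \<kappa> N_pos n_pos
  by (smt (verit) divide_pos_pos mult_nonneg_nonpos of_nat_0_less_iff zero_less_power of_nat_power)

lemma abs_Delta_le: "i < N \<Longrightarrow> j < N \<Longrightarrow> i \<noteq> j \<Longrightarrow> \<bar>\<Delta> i j\<bar> \<le> \<kappa> * n / N ^ 2"
  using cm2[of "{i, j}"] by (simp add: dmean_ci_ci)

lemma kappa_powers: "\<kappa> \<le> \<kappa> ^ 2" "1 \<le> \<kappa> ^ 2"
  using self_le_power[OF \<kappa>, of 2] \<kappa> by auto

lemma moment_card_le_2:
  assumes "i < N" "j < N"
    and le: "\<And>s. s \<in> samples \<Longrightarrow> \<bar>f s\<bar> \<le> (\<Prod>k\<in>{i, j}. \<bar>ci s k\<bar>)"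
  shows "\<bar>dmean f\<bar> \<le> 5 * \<kappa>^2 * n^2 / N ^ card {i, j}"
proof (cases "i = j")
  case True
  have "\<bar>dmean f\<bar> \<le> dmean (\<lambda>s. indicat_real s i + \<pi> i)"
  proof (rule order_trans[OF dmean_abs], rule dmean_mono)
    fix s assume "s \<in> samples"
    then have "\<bar>f s\<bar> \<le> \<bar>ci s i\<bar>" using le[of s] True by simp
    then show "\<bar>f s\<bar> \<le> indicat_real s i + \<pi> i" using abs_ci_le[of s i] by linarith
  qed
  also have "\<dots> = 2 * \<pi> i" by (simp add: dmean_add flip: \<pi>_def)
  also have "\<dots> \<le> 2 * (\<kappa> * n / N)" using pi_le[OF assms(1)] by simp
  also have "\<dots> \<le> 5 * \<kappa>^2 * n^2 / N"
  proof -
    have "\<kappa> * n \<le> \<kappa>^2 * n^2" using kappa_powers \<kappa> n_pos by (intro mult_mono) (auto simp: power2_eq_square)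
    moreover have "0 \<le> \<kappa>^2 * real (n^2)" by simp
    ultimately have "2 * (\<kappa> * n) \<le> 5 * (\<kappa>^2 * n^2)" by linarith
    then have "2 * (\<kappa> * n) \<le> 5 * \<kappa>^2 * n^2" by (simp add: mult.assoc)
    then show ?thesis using N_pos by (simp add: divide_right_mono)
  qed
  finally show ?thesis using True by simp
next
  case False
  have "\<bar>dmean f\<bar> \<le> dmean (\<lambda>s. (indicat_real s i + \<pi> i) * (indicat_real s j + \<pi> j))"
  proof (rule order_trans[OF dmean_abs], rule dmean_mono)
    fix s assume "s \<in> samples"
    then have "\<bar>f s\<bar> \<le> \<bar>ci s i\<bar> * \<bar>ci s j\<bar>" using le[of s] False by simp
    also have "\<dots> \<le> (indicat_real s i + \<pi> i) * (indicat_real s j + \<pi> j)"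
      using abs_ci_le pi_bounds by (intro mult_mono) (auto simp: indicator_def)
    finally show "\<bar>f s\<bar> \<le> (indicat_real s i + \<pi> i) * (indicat_real s j + \<pi> j)" .
  qed
  \<comment> \<open>Expansion gives \<open>\<pi>2 i j\<close> and three copies of
    \<open>\<pi> i * \<pi> j\<close>; a fourth appears when \<open>\<pi>2\<close> is replaced by
    \<open>\<Delta>\<close>.\<close>
  also have "\<dots> = \<Delta> i j + 4 * (\<pi> i * \<pi> j)"
    by (simp add: \<Delta>_def \<pi>2_def distrib_left distrib_right dmean_add dmean_cmult dmean_multc flip: \<pi>_def)
  also have "\<dots> \<le> \<kappa> * n / N ^ 2 + 4 * ((\<kappa> * n / N) * (\<kappa> * n / N))"
    using abs_Delta_le[OF assms(1,2) False] pi_le assms pi_bounds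
    by (intro add_mono mult_left_mono mult_mono) (auto intro: order_trans)
  also have "\<dots> = (\<kappa> * n + 4 * \<kappa>^2 * n^2) / N^2"
    using N_pos by (simp add: field_simps power2_eq_square)
  also have "\<dots> \<le> 5 * \<kappa>^2 * n^2 / N^2"
  proof -
    have "\<kappa> * n \<le> \<kappa>^2 * n^2" using kappa_powers \<kappa> n_pos by (intro mult_mono) (auto simp: power2_eq_square)
    then show ?thesis by (intro divide_right_mono) auto
  qed
  finally show ?thesis using False by (simp add: power2_eq_square)
qed

text \<open>Reducing the square by \<open>ci_power2\<close> leaves a third moment with distinct
  indices and a covariance multiplied by \<open>\<pi> i\<close>. Both are of order n^2 /
  N^3.\<close>

lemma moment_card_3:
  assumes "i < N" "j < N" "k < N" "i \<noteq> j" "i \<noteq> k" "j \<noteq> k"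
  shows "\<bar>dmean (\<lambda>s. ci s i * ci s i * ci s j * ci s k)\<bar> \<le> 5 * \<kappa>^2 * n^2 / N ^ 3"
proof -
  have eq: "ci s i * ci s i * ci s j * ci s k =
      (1 - 2 * \<pi> i) * (\<Prod>l\<in>{i,j,k}. ci s l) + \<pi> i * (1 - \<pi> i) * (ci s j * ci s k)" for s
    unfolding ci_power2 using assms by (simp add: algebra_simps)
  have "\<bar>dmean (\<lambda>s. ci s i * ci s i * ci s j * ci s k)\<bar>
      = \<bar>(1 - 2 * \<pi> i) * dmean (\<lambda>s. \<Prod>l\<in>{i,j,k}. ci s l) + \<pi> i * (1 - \<pi> i) * \<Delta> j k\<bar>"
    unfolding eq dmean_add dmean_cmult dmean_ci_ci ..
  also have "\<dots> \<le> \<bar>1 - 2 * \<pi> i\<bar> * \<bar>dmean (\<lambda>s. \<Prod>l\<in>{i,j,k}. ci s l)\<bar> + \<bar>\<pi> i * (1 - \<pi> i)\<bar> * \<bar>\<Delta> j k\<bar>"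
    by (simp only: abs_mult[symmetric] abs_triangle_ineq)
  also have "\<dots> \<le> 1 * (\<kappa> * n^2 / N^3) + (\<kappa> * n / N * 1) * (\<kappa> * n / N^2)"
    using pi_bounds[of i] pi_le[of i] cm3[of "{i,j,k}"] abs_Delta_le[of j k] assms
    unfolding abs_mult by (intro add_mono mult_mono) auto
  also have "\<dots> = (\<kappa> + \<kappa>^2) * n^2 / N^3"
    using N_pos by (simp add: field_simps power2_eq_square power3_eq_cube)
  also have "\<dots> \<le> 5 * \<kappa>^2 * n^2 / N^3"
    using kappa_powers by (intro divide_right_mono mult_right_mono) auto
  finally show ?thesis .
qed

text \<open>The bound has the same form for all coincidence patterns of the indices; it is summable because the
  sum of \<open>N ^ (- card {l, k, j, i})\<close> over all quadruples is at most \<open>24\<close>.\<close>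

lemma moment4:
  assumes "i < N" "j < N" "k < N" "l < N"
  shows "\<bar>dmean (\<lambda>s. ci s i * ci s j * ci s k * ci s l)\<bar> \<le> 5 * \<kappa>^2 * n^2 * (1 / N ^ card {l, k, j, i})"
proof -
  consider "card {l,k,j,i} = 4" | "card {l,k,j,i} = 3" |
    u v where "{l,k,j,i} = {u, v}" "u < N" "v < N"
  proof -
    have "card {l,k,j,i} \<le> 4" "card {l,k,j,i} \<noteq> 0" by (auto simp: card_insert_if)
    then consider "card {l,k,j,i} = 4" | "card {l,k,j,i} = 3" | "card {l,k,j,i} = 2" | "card {l,k,j,i} = 1"
      by linarith
    then show ?thesis
    proof cases
      case 3
      then obtain u v where uv: "{l,k,j,i} = {u, v}" by (auto simp: card_2_iff)
      then have "{u, v} \<subseteq> {..<N}" using assms by (metis empty_subsetI insert_subset lessThan_iff)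
      then show ?thesis using that uv by auto
    next
      case 4
      then obtain u where u: "{l,k,j,i} = {u}" by (rule card_1_singletonE)
      then have "u = i" by blast
      then show ?thesis using that(3)[of u u] u assms by simp
    qed (use that in blast)+
  qed
  then show ?thesis
  proof cases
    case 1
    then have d: "i \<noteq> j" "i \<noteq> k" "i \<noteq> l" "j \<noteq> k" "j \<noteq> l" "k \<noteq> l" by (auto simp: card_insert_if split: if_splits)
    have "\<bar>dmean (\<lambda>s. ci s i * ci s j * ci s k * ci s l)\<bar> = \<bar>dmean (\<lambda>s. \<Prod>i\<in>{l,k,j,i}. ci s i)\<bar>"
      using d by (simp add: mult_ac)
    also have "\<dots> \<le> \<kappa> * n ^ 2 / N ^ 4" using 1 assms by (intro cm4) auto
    also have "\<dots> \<le> 5 * \<kappa>^2 * n ^ 2 / N ^ 4"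
      using kappa_powers by (intro divide_right_mono mult_right_mono) auto
    finally show ?thesis using 1 by simp
  next
    case 2
    \<comment> \<open>Three distinct values among four indices mean exactly one coinciding pair, in
      one of six positions.\<close>
    then consider "i = j" "i \<noteq> k" "i \<noteq> l" "k \<noteq> l" | "i = k" "i \<noteq> j" "i \<noteq> l" "j \<noteq> l"
      | "i = l" "i \<noteq> j" "i \<noteq> k" "j \<noteq> k" | "j = k" "j \<noteq> i" "j \<noteq> l" "i \<noteq> l"
      | "j = l" "j \<noteq> i" "j \<noteq> k" "i \<noteq> k" | "k = l" "k \<noteq> i" "k \<noteq> j" "i \<noteq> j"
      by (auto simp: card_insert_if split: if_splits)
    then have "\<bar>dmean (\<lambda>s. ci s i * ci s j * ci s k * ci s l)\<bar> \<le> 5 * \<kappa>^2 * n^2 / N ^ 3"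
    proof cases
      case 1 then show ?thesis using moment_card_3[of i k l] assms by (simp add: mult_ac)
    next case 2 then show ?thesis using moment_card_3[of i j l] assms by (simp add: mult_ac)
    next case 3 then show ?thesis using moment_card_3[of i j k] assms by (simp add: mult_ac)
    next case 4 then show ?thesis using moment_card_3[of j i l] assms by (simp add: mult_ac)
    next case 5 then show ?thesis using moment_card_3[of j i k] assms by (simp add: mult_ac)
    next case 6 then show ?thesis using moment_card_3[of k i j] assms by (simp add: mult_ac)
    qed
    then show ?thesis using 2 by simp
  next
    case 3
    have "\<bar>dmean (\<lambda>s. ci s i * ci s j * ci s k * ci s l)\<bar> \<le> 5 * \<kappa>^2 * n^2 / N ^ card {u, v}"
    proof (rule moment_card_le_2[OF 3(2,3)])
      fix s
      let ?b = "\<lambda>i. \<bar>ci s i\<bar>"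
      \<comment> \<open>Passing from a product of factors to a product over a set drops repeated
        factors, which are at most 1.\<close>
      have *: "?b x * prod ?b A \<le> prod ?b (insert x A)" if "finite A" for A x
      proof (cases "x \<in> A")
        case True
        have "0 \<le> prod ?b A" by (intro prod_nonneg) auto
        then show ?thesis using True abs_ci_le_1[of s x] by (simp add: insert_absorb mult_left_le_one_le)
      qed (simp add: that)
      have "\<bar>ci s i * ci s j * ci s k * ci s l\<bar> = ?b l * (?b k * (?b j * (\<Prod>x\<in>{i}. ?b x)))"
        by (simp add: abs_mult mult_ac)
      also have "\<dots> \<le> ?b l * (?b k * (\<Prod>x\<in>{j,i}. ?b x))"
        by (intro mult_left_mono *) auto
      also have "\<dots> \<le> ?b l * (\<Prod>x\<in>{k,j,i}. ?b x)"
        by (intro mult_left_mono *) auto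
      also have "\<dots> \<le> (\<Prod>x\<in>{l,k,j,i}. ?b x)"
        by (intro *) auto
      finally show "\<bar>ci s i * ci s j * ci s k * ci s l\<bar> \<le> (\<Prod>x\<in>{u,v}. ?b x)" unfolding 3(1) .
    qed
    then show ?thesis using 3(1) by simp
  qed
qed

text \<open>General coefficients serve both the fourth power of a linear form and the square of a
  quadratic form. The constant 120 is 5 from \<open>moment4\<close> times 24 from
  \<open>sum_inverse_power_card4\<close>.\<close>

lemma sum_moment4:
  assumes X: "\<And>i j k l. i < N \<Longrightarrow> j < N \<Longrightarrow> k < N \<Longrightarrow> l < N \<Longrightarrow> \<bar>x i j k l\<bar> \<le> X"
  shows "(\<Sum>i<N. \<Sum>j<N. \<Sum>k<N. \<Sum>l<N. x i j k l * dmean (\<lambda>s. ci s i * ci s j * ci s k * ci s l))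
    \<le> 120 * \<kappa>^2 * n^2 * X"
proof -
  have X0: "0 \<le> X" using X[of 0 0 0 0] N_pos by auto
  have "(\<Sum>i<N. \<Sum>j<N. \<Sum>k<N. \<Sum>l<N. x i j k l * dmean (\<lambda>s. ci s i * ci s j * ci s k * ci s l))
    \<le> (\<Sum>i<N. \<Sum>j<N. \<Sum>k<N. \<Sum>l<N. X * (5 * \<kappa>^2 * n^2 * (1 / N ^ card {l, k, j, i})))"
  proof (intro sum_mono)
    fix i j k l assume *: "i \<in> {..<N}" "j \<in> {..<N}" "k \<in> {..<N}" "l \<in> {..<N}"
    have "x i j k l * dmean (\<lambda>s. ci s i * ci s j * ci s k * ci s l)
      \<le> \<bar>x i j k l\<bar> * \<bar>dmean (\<lambda>s. ci s i * ci s j * ci s k * ci s l)\<bar>"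
      by (simp only: abs_mult[symmetric] abs_ge_self)
    also have "\<dots> \<le> X * (5 * \<kappa>^2 * n^2 * (1 / N ^ card {l, k, j, i}))"
      using * by (intro mult_mono X moment4 X0) auto
    finally show "x i j k l * dmean (\<lambda>s. ci s i * ci s j * ci s k * ci s l)
      \<le> X * (5 * \<kappa>^2 * n^2 * (1 / N ^ card {l, k, j, i}))" .
  qed
  also have "\<dots> = X * (5 * \<kappa>^2 * n^2) * (\<Sum>i<N. \<Sum>j<N. \<Sum>k<N. \<Sum>l<N. 1 / real N ^ card {l, k, j, i})"
    by (simp only: sum_distrib_left[symmetric] mult.assoc of_nat_power)
  also have "\<dots> \<le> X * (5 * \<kappa>^2 * n^2) * 24"
    using sum_inverse_power_card4[OF N_pos] X0 by (intro mult_left_mono) auto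
  finally show ?thesis by (simp only: mult_ac)
qed

lemma linear_fourth_moment:
  assumes "\<And>i. i < N \<Longrightarrow> \<bar>x i\<bar> \<le> X"
  shows "dmean (\<lambda>s. (\<Sum>i<N. ci s i * x i) ^ 4) \<le> 120 * \<kappa>^2 * n^2 * X ^ 4"
proof -
  have X: "0 \<le> X" using assms[of 0] N_pos by auto
  have "(\<Sum>i<N. ci s i * x i) ^ 4 = (\<Sum>i<N. \<Sum>j<N. \<Sum>k<N. \<Sum>l<N.
    (x i * x j * x k * x l) * (ci s i * ci s j * ci s k * ci s l))" for s
    unfolding sum_power4 by (intro sum.cong refl) (simp only: mult_ac)
  then have "dmean (\<lambda>s. (\<Sum>i<N. ci s i * x i) ^ 4) = (\<Sum>i<N. \<Sum>j<N. \<Sum>k<N. \<Sum>l<N.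
    (x i * x j * x k * x l) * dmean (\<lambda>s. ci s i * ci s j * ci s k * ci s l))"
    by (simp only: dmean_sum dmean_cmult)
  also have "\<dots> \<le> 120 * \<kappa>^2 * n^2 * X ^ 4"
    using assms X by (intro sum_moment4) (auto simp: abs_mult power4_eq_xxxx intro!: mult_mono)
  finally show ?thesis .
qed

text \<open>The N diagonal terms of order n/N and the N^2 covariances of order n/N^2 contribute
  equally, whence the factor 2.\<close>

lemma linear_second_moment:
  assumes "\<And>i. i < N \<Longrightarrow> \<bar>x i\<bar> \<le> X"
  shows "dmean (\<lambda>s. (\<Sum>i<N. ci s i * x i)\<^sup>2) \<le> 2 * \<kappa> * n * X\<^sup>2"
proof -
  have X: "0 \<le> X" using assms[of 0] N_pos by auto
  have "(\<Sum>i<N. ci s i * x i)\<^sup>2 = (\<Sum>i<N. \<Sum>j<N. (x i * x j) * (ci s i * ci s j))" for s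
    unfolding sum_power2 by (intro sum.cong refl) (simp only: mult_ac)
  then have "dmean (\<lambda>s. (\<Sum>i<N. ci s i * x i)\<^sup>2) = (\<Sum>i<N. \<Sum>j<N. (x i * x j) * \<Delta> i j)"
    by (simp only: dmean_sum dmean_cmult dmean_ci_ci)
  also have "\<dots> \<le> (\<Sum>i<N. \<Sum>j<N. X\<^sup>2 * (\<kappa> * n / N^2 + (if j = i then \<kappa> * n / N else 0)))"
  proof (intro sum_mono)
    fix i j assume *: "i \<in> {..<N}" "j \<in> {..<N}"
    have D: "\<bar>\<Delta> i j\<bar> \<le> \<kappa> * n / N^2 + (if j = i then \<kappa> * n / N else 0)"
    proof (cases "i = j")
      case True
      have "\<bar>\<Delta> i i\<bar> \<le> \<kappa> * n / N"
        using pi_bounds[of i] pi_le[of i] mult_left_le[of "1 - \<pi> i" "\<pi> i"] *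
        by (auto simp: Delta_same abs_mult)
      moreover have "0 \<le> \<kappa> * n / N^2" using \<kappa> by auto
      ultimately show ?thesis using True by simp
    qed (use abs_Delta_le * in auto)
    have "x i * x j * \<Delta> i j \<le> \<bar>x i\<bar> * \<bar>x j\<bar> * \<bar>\<Delta> i j\<bar>" by (simp only: abs_mult[symmetric] abs_ge_self)
    also have "\<dots> \<le> X * X * (\<kappa> * n / N^2 + (if j = i then \<kappa> * n / N else 0))"
      using assms X D * by (intro mult_mono) auto
    finally show "x i * x j * \<Delta> i j \<le> X\<^sup>2 * (\<kappa> * n / N^2 + (if j = i then \<kappa> * n / N else 0))"
      by (simp add: power2_eq_square)
  qed
  also have "\<dots> = X\<^sup>2 * (N * (N * (\<kappa> * n / N^2) + \<kappa> * n / N))"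
    unfolding sum_distrib_left[symmetric] by (simp add: sum.distrib)
  also have "\<dots> = 2 * \<kappa> * n * X\<^sup>2" using N_pos by (simp add: field_simps power2_eq_square)
  finally show ?thesis .
qed

text \<open>Inserting indicator = \<open>ci\<close> + \<open>\<pi>\<close> in both factors splits
  the centred double sum into a quadratic form and a linear form in the centred indicators. These
  are left to \<open>sum_moment4\<close> and \<open>linear_second_moment\<close>.\<close>

lemma quadratic_second_moment:
  assumes d: "\<And>i j. i < N \<Longrightarrow> j < N \<Longrightarrow> \<bar>d i j\<bar> \<le> c" and d0: "\<And>i. d i i = 0"
  shows "dmean (\<lambda>s. ((\<Sum>i\<in>s. \<Sum>j\<in>s. d i j) - (\<Sum>i<N. \<Sum>j<N. \<pi>2 i j * d i j))\<^sup>2)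
      \<le> 256 * \<kappa>^3 * c\<^sup>2 * n^3"
proof -
  have c: "0 \<le> c" using d[of 0 0] N_pos by auto
  define P where "P s = (\<Sum>i<N. \<Sum>j<N. d i j * (ci s i * ci s j))" for s
  have dP: "dmean P = (\<Sum>i<N. \<Sum>j<N. d i j * \<Delta> i j)"
    unfolding P_def by (simp only: dmean_sum dmean_cmult dmean_ci_ci)
  \<comment> \<open>The coefficient of \<open>ci s j\<close> after the expansion: the index may
    stand in either place of the pair.\<close>
  define x where "x j = (\<Sum>i<N. \<pi> i * (d i j + d j i))" for j
  have eq: "(\<Sum>i\<in>s. \<Sum>j\<in>s. d i j) - (\<Sum>i<N. \<Sum>j<N. \<pi>2 i j * d i j)
      = (P s - dmean P) + (\<Sum>j<N. ci s j * x j)" if s: "s \<in> samples" for s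
  proof -
    have 1: "(\<Sum>i\<in>s. \<Sum>j\<in>s. d i j) = (\<Sum>i<N. \<Sum>j<N. indicat_real s i * indicat_real s j * d i j)"
      unfolding sum_indicator_sample[OF s, symmetric] by (simp only: sum_distrib_left mult.assoc)
    have 2: "(\<Sum>j<N. ci s j * x j)
      = (\<Sum>i<N. \<Sum>j<N. ci s j * (\<pi> i * d i j)) + (\<Sum>i<N. \<Sum>j<N. ci s i * (\<pi> j * d i j))"
      unfolding sum.swap[of "\<lambda>i j. ci s j * (\<pi> i * d i j)"] x_def sum.distrib[symmetric] sum_distrib_left
      by (intro sum.cong refl) (simp only: distrib_left)
    show ?thesis
      unfolding 1 2 dP P_def sum.distrib[symmetric] sum_subtractf[symmetric]
      by (intro sum.cong refl) (simp only: ci_def \<Delta>_def, algebra)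
  qed
  have "dmean (\<lambda>s. (P s)\<^sup>2) \<le> 120 * \<kappa>^2 * n^2 * c\<^sup>2"
  proof -
    have "(P s)\<^sup>2 = (\<Sum>i<N. \<Sum>j<N. \<Sum>k<N. \<Sum>l<N. (d i j * d k l) * (ci s i * ci s j * ci s k * ci s l))" for s
      unfolding P_def double_sum_power2 by (intro sum.cong refl) (simp only: mult_ac)
    then have "dmean (\<lambda>s. (P s)\<^sup>2) = (\<Sum>i<N. \<Sum>j<N. \<Sum>k<N. \<Sum>l<N.
      (d i j * d k l) * dmean (\<lambda>s. ci s i * ci s j * ci s k * ci s l))"
      by (simp only: dmean_sum dmean_cmult)
    also have "\<dots> \<le> 120 * \<kappa>^2 * n^2 * c\<^sup>2"
      using d c by (intro sum_moment4) (auto simp: abs_mult power2_eq_square intro!: mult_mono)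
    finally show ?thesis .
  qed
  moreover have "dmean (\<lambda>s. (P s - dmean P)\<^sup>2) \<le> dmean (\<lambda>s. (P s)\<^sup>2)"
  proof -
    have "dmean (\<lambda>s. (P s - dmean P)\<^sup>2) = dmean (\<lambda>s. (P s)\<^sup>2) - (dmean P)\<^sup>2"
      by (simp add: power2_diff dmean_add dmean_diff dmean_cmult dmean_multc) (simp add: power2_eq_square)
    then show ?thesis by simp
  qed
  moreover have "dmean (\<lambda>s. (\<Sum>j<N. ci s j * x j)\<^sup>2) \<le> 2 * \<kappa> * n * (2 * \<kappa> * n * c)\<^sup>2"
  proof (rule linear_second_moment)
    fix j assume j: "j < N"
    have "\<bar>x j\<bar> \<le> (\<Sum>i<N. (\<kappa> * n / N) * (2 * c))"
      unfolding x_def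
    proof (rule order_trans[OF sum_abs], rule sum_mono)
      fix i assume i: "i \<in> {..<N}"
      have "\<bar>d i j + d j i\<bar> \<le> 2 * c" using d[of i j] d[of j i] i j by auto
      then show "\<bar>\<pi> i * (d i j + d j i)\<bar> \<le> (\<kappa> * n / N) * (2 * c)"
        unfolding abs_mult using pi_bounds[of i] pi_le[of i] i by (intro mult_mono) auto
    qed
    also have "\<dots> = 2 * \<kappa> * n * c" using N_pos by simp
    finally show "\<bar>x j\<bar> \<le> 2 * \<kappa> * n * c" .
  qed
  ultimately have L: "2 * dmean (\<lambda>s. (P s - dmean P)\<^sup>2) + 2 * dmean (\<lambda>s. (\<Sum>j<N. ci s j * x j)\<^sup>2)
    \<le> 2 * (120 * \<kappa>^2 * n^2 * c\<^sup>2) + 2 * (2 * \<kappa> * n * (2 * \<kappa> * n * c)\<^sup>2)"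
    by linarith
  have "dmean (\<lambda>s. ((\<Sum>i\<in>s. \<Sum>j\<in>s. d i j) - (\<Sum>i<N. \<Sum>j<N. \<pi>2 i j * d i j))\<^sup>2)
    \<le> dmean (\<lambda>s. 2 * (P s - dmean P)\<^sup>2 + 2 * (\<Sum>j<N. ci s j * x j)\<^sup>2)"
  proof (rule dmean_mono)
    fix s assume "s \<in> samples"
    show "((\<Sum>i\<in>s. \<Sum>j\<in>s. d i j) - (\<Sum>i<N. \<Sum>j<N. \<pi>2 i j * d i j))\<^sup>2
      \<le> 2 * (P s - dmean P)\<^sup>2 + 2 * (\<Sum>j<N. ci s j * x j)\<^sup>2"
      unfolding eq[OF \<open>s \<in> samples\<close>] by (rule power2_add_le)
  qed
  also have "\<dots> = 2 * dmean (\<lambda>s. (P s - dmean P)\<^sup>2) + 2 * dmean (\<lambda>s. (\<Sum>j<N. ci s j * x j)\<^sup>2)"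
    by (simp add: dmean_add dmean_cmult)
  also have "\<dots> \<le> 2 * (120 * \<kappa>^2 * n^2 * c\<^sup>2) + 2 * (2 * \<kappa> * n * (2 * \<kappa> * n * c)\<^sup>2)" by (rule L)
  \<comment> \<open>The term with 240 = 2 * 120 comes from the quadratic part, of order n^2; the one
    with 16 comes from the linear part, of order n^3, which dominates because its coefficients are
    of order n * c.\<close>
  also have "\<dots> = 240 * (\<kappa>^2 * n^2) * c\<^sup>2 + 16 * (\<kappa>^3 * n^3) * c\<^sup>2"
    by (simp add: power2_eq_square power3_eq_cube)
  also have "\<dots> \<le> 240 * (\<kappa>^3 * n^3) * c\<^sup>2 + 16 * (\<kappa>^3 * n^3) * c\<^sup>2"
  proof -
    have "\<kappa>^2 * real n^2 \<le> \<kappa>^3 * real n^3"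
      using \<kappa> n_pos by (intro mult_mono power_increasing) auto
    then show ?thesis by (intro add_mono mult_right_mono mult_left_mono) auto
  qed
  also have "\<dots> = 256 * \<kappa>^3 * c\<^sup>2 * n^3" by (simp add: algebra_simps)
  finally show "dmean (\<lambda>s. ((\<Sum>i\<in>s. \<Sum>j\<in>s. d i j) - (\<Sum>i<N. \<Sum>j<N. \<pi>2 i j * d i j))\<^sup>2)
      \<le> 256 * \<kappa>^3 * c\<^sup>2 * n^3" .
qed

end

section \<open>Second-stage moments\<close>

text \<open>\<open>\<mu> i\<close> is the law of one draw in PSU \<open>i\<close>. All these laws
  live on the sigma-algebra of \<open>B\<close>, so measurability can be stated without reference to
  the individual law.\<close>

locale two_stage = regular_finite_design +
  fixes m :: "nat \<Rightarrow> nat" and \<mu> :: "nat \<Rightarrow> 'a measure" and B :: "'a measure"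
  assumes prob_\<mu>: "prob_space (\<mu> i)" and sets_\<mu>: "sets (\<mu> i) = sets B"
    and m_ge_2: "i < N \<Longrightarrow> 2 \<le> m i"
begin

definition idx :: "nat set \<Rightarrow> (nat \<times> nat) set" where
  "idx J = (SIGMA i:J. {..<m i})"

text \<open>Statistics of a two-stage sample depend on the points of the selected PSUs only, so the points of all
  PSUs may be taken independent of each other and of the first-stage sample. An expectation is then
  \<open>dmean (\<lambda>s. integral\<^sup>L R (f s))\<close>.\<close>

definition R :: "(nat \<times> nat \<Rightarrow> 'a) measure" where
  "R = PiM (idx {..<N}) (\<lambda>q. \<mu> (fst q))"

sublocale points: product_prob_space "\<lambda>q :: nat \<times> nat. \<mu> (fst q)" "idx {..<N}"
  by (simp add: product_prob_spaceI prob_\<mu>)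

sublocale R: prob_space R
  unfolding R_def by (intro prob_space_PiM prob_\<mu>)

declare R.prob_space [simp]

lemma finite_idx: "finite J \<Longrightarrow> finite (idx J)"
  by (auto simp: idx_def)

lemma idx_mono: "J \<subseteq> K \<Longrightarrow> idx J \<subseteq> idx K"
  by (auto simp: idx_def)

lemma sets_PiM_\<mu>: "sets (PiM I (\<lambda>q. \<mu> (fst q))) = sets (PiM I (\<lambda>_. B))"
  by (intro sets_PiM_cong sets_\<mu> refl)

lemma measurable_R_restrict:
  assumes "J \<subseteq> {..<N}"
  shows "(\<lambda>x. restrict x (idx J)) \<in> measurable R (PiM (idx J) (\<lambda>_. B))"
  unfolding R_def measurable_cong_sets[OF sets_PiM_\<mu> refl]
  by (intro measurable_restrict_subset idx_mono assms)

lemma measurable_R_component: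
  assumes "q \<in> idx {..<N}"
  shows "(\<lambda>x. x q) \<in> measurable R B"
  unfolding R_def measurable_cong_sets[OF sets_PiM_\<mu> refl]
  by (rule measurable_component_singleton) fact

text \<open>Bounded statistics of the points sampled in the PSUs with index in \<open>J\<close>.\<close>

definition dep :: "nat set \<Rightarrow> ((nat \<times> nat \<Rightarrow> 'a) \<Rightarrow> real) \<Rightarrow> bool" where
  "dep J f \<longleftrightarrow> f \<in> borel_measurable (PiM (idx J) (\<lambda>_. B)) \<and>
     (\<forall>x. f (restrict x (idx J)) = f x) \<and> (\<exists>b. \<forall>x. \<bar>f x\<bar> \<le> b)"

lemma dep_mono:
  assumes "dep J f" "J \<subseteq> K"
  shows "dep K f"
proof -
  have "(\<lambda>x. f (restrict x (idx J))) \<in> borel_measurable (PiM (idx K) (\<lambda>_. B))"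
    using assms by (intro measurable_compose[OF measurable_restrict_subset[OF idx_mono]]) (auto simp: dep_def)
  moreover have "f (restrict x (idx K)) = f x" for x
  proof -
    have f: "f (restrict y (idx J)) = f y" for y
      using assms by (simp add: dep_def)
    have "f (restrict x (idx K)) = f (restrict (restrict x (idx K)) (idx J))"
      by (rule f[symmetric])
    also have "restrict (restrict x (idx K)) (idx J) = restrict x (idx J)"
      using idx_mono[OF assms(2)] by (simp add: Int_absorb1)
    finally show ?thesis unfolding f .
  qed
  ultimately show ?thesis using assms unfolding dep_def by simp
qed

lemma dep_measurable: "dep J f \<Longrightarrow> J \<subseteq> {..<N} \<Longrightarrow> f \<in> borel_measurable R"
  using measurable_compose[OF measurable_R_restrict, of J f borel] by (simp add: dep_def)

lemma dep_integrable:
  assumes "dep J f" "J \<subseteq> {..<N}"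
  shows "integrable R f"
proof -
  obtain b where b: "\<And>x. \<bar>f x\<bar> \<le> b" using assms(1) by (auto simp: dep_def)
  show ?thesis
    by (rule R.integrable_const_bound[where B = b, OF _ dep_measurable[OF assms]]) (use b in simp)
qed

lemma dep_const: "dep J (\<lambda>_. c)"
  by (auto simp: dep_def)

lemma dep_add: assumes "dep J f" "dep J h" shows "dep J (\<lambda>x. f x + h x)"
proof -
  from assms obtain a b where ab: "\<And>x. \<bar>f x\<bar> \<le> a" "\<And>x. \<bar>h x\<bar> \<le> b" by (auto simp: dep_def)
  have "\<bar>f x + h x\<bar> \<le> a + b" for x using ab(1)[of x] ab(2)[of x] by linarith
  then show ?thesis using assms by (auto simp: dep_def)
qed

lemma dep_mult: assumes "dep J f" "dep J h" shows "dep J (\<lambda>x. f x * h x)"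
proof -
  from assms obtain a b where ab: "\<And>x. \<bar>f x\<bar> \<le> a" "\<And>x. \<bar>h x\<bar> \<le> b" by (auto simp: dep_def)
  have "0 \<le> a" using ab(1)[of undefined] by linarith
  then have "\<bar>f x * h x\<bar> \<le> a * b" for x
    unfolding abs_mult using ab by (intro mult_mono) auto
  then show ?thesis using assms by (auto simp: dep_def)
qed

lemma dep_diff: assumes "dep J f" "dep J h" shows "dep J (\<lambda>x. f x - h x)"
  using dep_add[OF assms(1) dep_mult[OF dep_const[of _ "-1"] assms(2)]] by simp

lemma dep_sum: "(\<And>i. i \<in> I \<Longrightarrow> dep J (f i)) \<Longrightarrow> dep J (\<lambda>x. \<Sum>i\<in>I. f i x)"
  by (induction I rule: infinite_finite_induct) (auto intro: dep_const dep_add)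

lemma dep_power: "dep J f \<Longrightarrow> dep J (\<lambda>x. f x ^ k)"
  by (induction k) (auto intro: dep_const dep_mult)

lemma dep_divide: "dep J f \<Longrightarrow> dep J (\<lambda>x. f x / c)"
  using dep_mult[OF _ dep_const[of J "1 / c"], of f] by simp

lemmas dep_intros = dep_const dep_add dep_mult dep_diff dep_sum dep_power dep_divide

lemma dep_point:
  assumes "w \<in> borel_measurable B" "\<And>z. \<bar>w z\<bar> \<le> b" "i \<in> J" "k < m i"
  shows "dep J (\<lambda>x. w (x (i, k)))"
  using assms by (auto simp: dep_def idx_def intro!: measurable_compose[OF measurable_component_singleton])

lemma idx_nonempty: "idx {..<N} \<noteq> {}"
proof -
  have "(0, 0) \<in> idx {..<N}" using N_pos m_ge_2[of 0] by (simp add: idx_def)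
  then show ?thesis by blast
qed

lemma distr_R_component:
  assumes "q \<in> idx {..<N}" shows "distr R (\<mu> (fst q)) (\<lambda>x. x q) = \<mu> (fst q)"
  unfolding R_def using assms by (intro distr_PiM_component prob_\<mu>)

lemma indep_points: "R.indep_vars (\<lambda>_. B) (\<lambda>q x. x q) (idx {..<N})"
proof (subst R.indep_vars_iff_distr_eq_PiM'[OF idx_nonempty])
  show "(\<lambda>x. x q) \<in> measurable R B" if "q \<in> idx {..<N}" for q
    by (rule measurable_R_component) fact
  \<comment> \<open>Points of the product space are extensional on the index set, so the restriction
    is the identity there and the joint law is \<open>R\<close> itself.\<close>
  have "distr R (PiM (idx {..<N}) (\<lambda>_. B)) (\<lambda>x. \<lambda>q\<in>idx {..<N}. x q) = distr R R (\<lambda>x. x)"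
    by (rule distr_cong) (auto simp: R_def sets_PiM_\<mu> space_PiM PiE_restrict)
  also have "\<dots> = PiM (idx {..<N}) (\<lambda>q. distr R B (\<lambda>x. x q))"
    unfolding distr_id2[OF refl] R_def
  proof (rule PiM_cong)
    fix q assume "q \<in> idx {..<N}"
    then show "\<mu> (fst q) = distr (PiM (idx {..<N}) (\<lambda>q. \<mu> (fst q))) B (\<lambda>x. x q)"
      using distr_R_component[of q] distr_cong[OF refl sets_\<mu>[of "fst q", symmetric] refl, of R "\<lambda>x. x q"]
      by (simp add: R_def)
  qed simp
  finally show "distr R (PiM (idx {..<N}) (\<lambda>_. B)) (\<lambda>x. \<lambda>q\<in>idx {..<N}. x q)
    = PiM (idx {..<N}) (\<lambda>q. distr R B (\<lambda>x. x q))" .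
qed

abbreviation ER :: "((nat \<times> nat \<Rightarrow> 'a) \<Rightarrow> real) \<Rightarrow> real" where
  "ER f \<equiv> integral\<^sup>L R f"

text \<open>Disjoint sets of PSUs read disjoint blocks of coordinates, and blocks of independent
  coordinates are independent.\<close>

lemma dep_uncorrelated:
  assumes f: "dep J f" and h: "dep K h" and JK: "J \<inter> K = {}" "J \<subseteq> {..<N}" "K \<subseteq> {..<N}"
  shows "ER (\<lambda>x. f x * h x) = ER f * ER h"
proof -
  have "R.indep_var (PiM (idx J) (\<lambda>_. B)) (\<lambda>x. restrict (\<lambda>q. x q) (idx J))
      (PiM (idx K) (\<lambda>_. B)) (\<lambda>x. restrict (\<lambda>q. x q) (idx K))"
    using JK by (intro R.indep_var_restrict[OF indep_points] idx_mono) (auto simp: idx_def)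
  then have "R.indep_var borel (f \<circ> (\<lambda>x. restrict (\<lambda>q. x q) (idx J))) borel (h \<circ> (\<lambda>x. restrict (\<lambda>q. x q) (idx K)))"
    using f h by (intro R.indep_var_compose) (auto simp: dep_def)
  moreover have "f \<circ> (\<lambda>x. restrict (\<lambda>q. x q) (idx J)) = f" "h \<circ> (\<lambda>x. restrict (\<lambda>q. x q) (idx K)) = h"
    using f h by (auto simp: dep_def fun_eq_iff)
  ultimately have "R.indep_var borel f borel h" by simp
  then show ?thesis
    using f h JK by (intro R.indep_var_lebesgue_integral dep_integrable)
qed

lemma ER_const [simp]: "ER (\<lambda>_. c) = c"
  by (simp add: R.prob_space)

lemma ER_mono: "dep J f \<Longrightarrow> dep J h \<Longrightarrow> J \<subseteq> {..<N} \<Longrightarrow> (\<And>x. f x \<le> h x) \<Longrightarrow> ER f \<le> ER h"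
  by (intro integral_mono dep_integrable)

lemma abs_ER_le: "dep J f \<Longrightarrow> J \<subseteq> {..<N} \<Longrightarrow> (\<And>x. \<bar>f x\<bar> \<le> b) \<Longrightarrow> \<bar>ER f\<bar> \<le> b"
  using ER_mono[of J f "\<lambda>_. b"] ER_mono[of J "\<lambda>_. - b" f]
  by (simp add: dep_const abs_le_iff minus_le_iff R.prob_space)

lemma ER_sum:
  "(\<And>i. i \<in> I \<Longrightarrow> dep J (f i)) \<Longrightarrow> J \<subseteq> {..<N} \<Longrightarrow> ER (\<lambda>x. \<Sum>i\<in>I. f i x) = (\<Sum>i\<in>I. ER (f i))"
  by (intro Bochner_Integration.integral_sum dep_integrable)

lemma ER_sum2:
  assumes "\<And>i j. i \<in> I \<Longrightarrow> j \<in> I \<Longrightarrow> dep J (f i j)" "J \<subseteq> {..<N}"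
  shows "ER (\<lambda>x. \<Sum>i\<in>I. \<Sum>j\<in>I. f i j x) = (\<Sum>i\<in>I. \<Sum>j\<in>I. ER (f i j))"
proof -
  have "ER (\<lambda>x. \<Sum>i\<in>I. \<Sum>j\<in>I. f i j x) = (\<Sum>i\<in>I. ER (\<lambda>x. \<Sum>j\<in>I. f i j x))"
    using assms by (intro ER_sum[of _ J] dep_sum) auto
  also have "\<dots> = (\<Sum>i\<in>I. \<Sum>j\<in>I. ER (f i j))"
    using assms by (intro sum.cong refl ER_sum[of _ J]) auto
  finally show ?thesis .
qed

lemma ER_sum4:
  assumes "\<And>i j k l. i \<in> I \<Longrightarrow> j \<in> I \<Longrightarrow> k \<in> I \<Longrightarrow> l \<in> I \<Longrightarrow> dep J (f i j k l)" "J \<subseteq> {..<N}"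
  shows "ER (\<lambda>x. \<Sum>i\<in>I. \<Sum>j\<in>I. \<Sum>k\<in>I. \<Sum>l\<in>I. f i j k l x)
    = (\<Sum>i\<in>I. \<Sum>j\<in>I. \<Sum>k\<in>I. \<Sum>l\<in>I. ER (f i j k l))"
proof -
  have "ER (\<lambda>x. \<Sum>i\<in>I. \<Sum>j\<in>I. \<Sum>k\<in>I. \<Sum>l\<in>I. f i j k l x)
    = (\<Sum>i\<in>I. \<Sum>j\<in>I. ER (\<lambda>x. \<Sum>k\<in>I. \<Sum>l\<in>I. f i j k l x))"
    using assms by (intro ER_sum2[of _ J] dep_sum) auto
  also have "\<dots> = (\<Sum>i\<in>I. \<Sum>j\<in>I. \<Sum>k\<in>I. \<Sum>l\<in>I. ER (f i j k l))"
    using assms by (intro sum.cong refl ER_sum2[of _ J]) auto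
  finally show ?thesis .
qed

lemma ER_add: "dep J f \<Longrightarrow> dep J h \<Longrightarrow> J \<subseteq> {..<N} \<Longrightarrow> ER (\<lambda>x. f x + h x) = ER f + ER h"
  by (intro Bochner_Integration.integral_add dep_integrable)

lemma ER_diff: "dep J f \<Longrightarrow> dep J h \<Longrightarrow> J \<subseteq> {..<N} \<Longrightarrow> ER (\<lambda>x. f x - h x) = ER f - ER h"
  by (intro Bochner_Integration.integral_diff dep_integrable)

text \<open>The law of the points is the same for all first-stage samples, so one centring serves
  every sample.\<close>

definition ctr :: "((nat \<times> nat \<Rightarrow> 'a) \<Rightarrow> real) \<Rightarrow> (nat \<times> nat \<Rightarrow> 'a) \<Rightarrow> real" where
  "ctr f x = f x - ER f"

lemma dep_ctr: "dep J f \<Longrightarrow> dep J (ctr f)"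
  unfolding ctr_def by (intro dep_intros)

lemma ER_ctr: "dep J f \<Longrightarrow> J \<subseteq> {..<N} \<Longrightarrow> ER (ctr f) = 0"
  unfolding ctr_def using ER_diff[of J f "\<lambda>_. ER f"] by (simp add: dep_const R.prob_space)

lemma abs_ctr_le: "dep J f \<Longrightarrow> J \<subseteq> {..<N} \<Longrightarrow> (\<And>x. \<bar>f x\<bar> \<le> b) \<Longrightarrow> \<bar>ctr f x\<bar> \<le> 2 * b"
proof -
  assume "dep J f" "J \<subseteq> {..<N}" and b: "\<And>x. \<bar>f x\<bar> \<le> b"
  then have "\<bar>ER f\<bar> \<le> b" by (rule abs_ER_le)
  then show ?thesis using b[of x] unfolding ctr_def by linarith
qed

lemma ctr_uncorrelated:
  assumes "dep J f" "dep K h" "J \<inter> K = {}" "J \<subseteq> {..<N}" "K \<subseteq> {..<N}"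
  shows "ER (\<lambda>x. ctr f x * h x) = 0"
  using dep_uncorrelated[OF dep_ctr[OF assms(1)] assms(2-5)] ER_ctr[OF assms(1,4)] by simp

lemma ER_sum_ctr_power2:
  assumes G: "\<And>i. i \<in> s \<Longrightarrow> dep {i} (G i)" and s: "s \<subseteq> {..<N}"
  shows "ER (\<lambda>x. (\<Sum>i\<in>s. ctr (G i) x)\<^sup>2) = (\<Sum>i\<in>s. ER (\<lambda>x. (ctr (G i) x)\<^sup>2))"
proof -
  have fin: "finite s" using s finite_subset by blast
  have d: "dep s (ctr (G i))" if "i \<in> s" for i using dep_mono[OF dep_ctr[OF G[OF that]], of s] that by auto
  have "ER (\<lambda>x. (\<Sum>i\<in>s. ctr (G i) x)\<^sup>2) = (\<Sum>i\<in>s. \<Sum>j\<in>s. ER (\<lambda>x. ctr (G i) x * ctr (G j) x))"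
    unfolding sum_power2 
    by (rule ER_sum2[where f = "\<lambda>i j x. ctr (G i) x * ctr (G j) x" and I = s, OF dep_mult[OF d d] s])
  also have "\<dots> = (\<Sum>i\<in>s. \<Sum>j\<in>s. if i = j then ER (\<lambda>x. (ctr (G i) x)\<^sup>2) else 0)"
  proof (intro sum.cong refl)
    fix i j assume ij: "i \<in> s" "j \<in> s"
    show "ER (\<lambda>x. ctr (G i) x * ctr (G j) x) = (if i = j then ER (\<lambda>x. (ctr (G i) x)\<^sup>2) else 0)"
      using ij s ctr_uncorrelated[OF G[of i] dep_ctr[OF G[of j]]] by (auto simp: power2_eq_square)
  qed
  also have "\<dots> = (\<Sum>i\<in>s. ER (\<lambda>x. (ctr (G i) x)\<^sup>2))" using fin by simp
  finally show ?thesis .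
qed

lemma ER_sum_ctr_power2_le:
  fixes b :: real
  assumes G: "\<And>i. i \<in> s \<Longrightarrow> dep {i} (G i)" and s: "s \<subseteq> {..<N}" and b: "\<And>i x. i \<in> s \<Longrightarrow> \<bar>G i x\<bar> \<le> b"
  shows "ER (\<lambda>x. (\<Sum>i\<in>s. ctr (G i) x)\<^sup>2) \<le> 4 * real (card s) * b\<^sup>2"
proof -
  have "ER (\<lambda>x. (ctr (G i) x)\<^sup>2) \<le> (2 * b)\<^sup>2" if "i \<in> s" for i
  proof -
    have "\<bar>ER (\<lambda>x. (ctr (G i) x)\<^sup>2)\<bar> \<le> (2 * b)\<^sup>2"
    proof (rule abs_ER_le)
      show "dep {i} (\<lambda>x. (ctr (G i) x)\<^sup>2)" using G[OF that] by (intro dep_power dep_ctr)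
      show "{i} \<subseteq> {..<N}" using that s by auto
      have "\<bar>ctr (G i) x\<bar> \<le> 2 * b" for x using G[OF that] b[OF that] that s by (intro abs_ctr_le[of "{i}"]) auto
      then show "\<bar>(ctr (G i) x)\<^sup>2\<bar> \<le> (2 * b)\<^sup>2" for x
        using power_mono[of "\<bar>ctr (G i) x\<bar>" "2 * b" 2] by simp
    qed
    then show ?thesis by simp
  qed
  then have "(\<Sum>i\<in>s. ER (\<lambda>x. (ctr (G i) x)\<^sup>2)) \<le> (\<Sum>i\<in>s. (2 * b)\<^sup>2)" by (rule sum_mono)
  moreover have "ER (\<lambda>x. (\<Sum>i\<in>s. ctr (G i) x)\<^sup>2) = (\<Sum>i\<in>s. ER (\<lambda>x. (ctr (G i) x)\<^sup>2))"
    by (rule ER_sum_ctr_power2[OF G s])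
  ultimately show ?thesis by (simp add: power_mult_distrib)
qed

text \<open>A term survives only if its four indices match in pairs. There are three pairings with
  \<open>card s ^ 2\<close> quadruples each, and every term is at most \<open>(2 * b) ^ 4\<close>;
  hence 48 = 3 * 16.\<close>

lemma ER_sum_ctr_power4_le:
  fixes b :: real
  assumes G: "\<And>i. i \<in> s \<Longrightarrow> dep {i} (G i)" and s: "s \<subseteq> {..<N}" and b: "\<And>i x. i \<in> s \<Longrightarrow> \<bar>G i x\<bar> \<le> b"
  shows "ER (\<lambda>x. (\<Sum>i\<in>s. ctr (G i) x) ^ 4) \<le> 48 * real (card s) ^ 2 * b ^ 4"
proof -
  have fin: "finite s" using s finite_subset by blast
  have d1: "dep {i} (ctr (G i))" if "i \<in> s" for i by (rule dep_ctr[OF G[OF that]])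
  have d: "dep s (ctr (G i))" if "i \<in> s" for i using dep_mono[OF d1[OF that], of s] that by auto
  have c: "\<bar>ctr (G i) x\<bar> \<le> 2 * b" if "i \<in> s" for i x
    using G[OF that] b[OF that] that s by (intro abs_ctr_le[of "{i}"]) auto
  let ?e = "\<lambda>i j. if i = j then 1 else 0 :: real"
  have le: "ER (\<lambda>x. ctr (G i) x * ctr (G j) x * ctr (G k) x * ctr (G l) x)
      \<le> (2 * b) ^ 4 * (?e i j * ?e k l + ?e i k * ?e j l + ?e i l * ?e j k)"
    if I: "i \<in> s" "j \<in> s" "k \<in> s" "l \<in> s" for i j k l
  proof (cases "i = j \<and> k = l \<or> i = k \<and> j = l \<or> i = l \<and> j = k")
    case True
    have "0 \<le> 2 * b" using c[OF I(1), of undefined] by linarith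
    then have bd: "\<bar>ER (\<lambda>x. ctr (G i) x * ctr (G j) x * ctr (G k) x * ctr (G l) x)\<bar> \<le> (2 * b) ^ 4"
      unfolding power4_eq_xxxx using I s c
      by (intro abs_ER_le[of s] dep_intros d) (auto simp only: abs_mult intro!: mult_mono mult_nonneg_nonneg abs_ge_zero)
    have "(2 * b) ^ 4 * 1 \<le> (2 * b) ^ 4 * (?e i j * ?e k l + ?e i k * ?e j l + ?e i l * ?e j k)"
      using True by (intro mult_left_mono) auto
    then show ?thesis using bd by linarith
  next
    case False
    have iso: "ER (\<lambda>x. ctr (G i) x * (ctr (G j) x * ctr (G k) x * ctr (G l) x)) = 0"
      if "i \<in> s" "j \<in> s" "k \<in> s" "l \<in> s" "i \<notin> {j, k, l}" for i j k l
    proof -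
      have "dep {j,k,l} (\<lambda>x. ctr (G j) x * ctr (G k) x * ctr (G l) x)"
        using that by (intro dep_mult dep_mono[OF d1]) auto
      then show ?thesis using that s by (intro ctr_uncorrelated[OF G, where K = "{j,k,l}"]) auto
    qed
    \<comment> \<open>If the indices do not match in pairs, one of them differs from the other
      three. Its factor is centred and independent of the rest.\<close>
    from False consider "i \<notin> {j,k,l}" | "j \<notin> {i,k,l}" | "k \<notin> {i,j,l}" | "l \<notin> {i,j,k}" by auto
    then have "ER (\<lambda>x. ctr (G i) x * ctr (G j) x * ctr (G k) x * ctr (G l) x) = 0"
    proof cases
      case 1 then show ?thesis using iso[of i j k l] I by (simp add: mult_ac)
    next case 2 then show ?thesis using iso[of j i k l] I by (simp add: mult_ac)
    next case 3 then show ?thesis using iso[of k i j l] I by (simp add: mult_ac)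
    next case 4 then show ?thesis using iso[of l i j k] I by (simp add: mult_ac)
    qed
    then show ?thesis by simp
  qed
  have "ER (\<lambda>x. (\<Sum>i\<in>s. ctr (G i) x) ^ 4) =
    (\<Sum>i\<in>s. \<Sum>j\<in>s. \<Sum>k\<in>s. \<Sum>l\<in>s. ER (\<lambda>x. ctr (G i) x * ctr (G j) x * ctr (G k) x * ctr (G l) x))"
    unfolding sum_power4 by (rule ER_sum4[where f = "\<lambda>i j k l x. ctr (G i) x * ctr (G j) x * ctr (G k) x * ctr (G l) x" and I = s,
        OF dep_mult[OF dep_mult[OF dep_mult[OF d d] d] d] s])
  also have "\<dots> \<le> (\<Sum>i\<in>s. \<Sum>j\<in>s. \<Sum>k\<in>s. \<Sum>l\<in>s. (2 * b) ^ 4 * (?e i j * ?e k l + ?e i k * ?e j l + ?e i l * ?e j k))"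
    by (intro sum_mono le)
  also have "\<dots> = (2 * b) ^ 4 * (3 * real (card s) ^ 2)"
  proof -
    have 1: "(\<Sum>l\<in>s. ?e k l) = 1" "(\<Sum>l\<in>s. ?e l k) = 1" if "k \<in> s" for k using fin that by simp_all
    have "(\<Sum>i\<in>s. \<Sum>j\<in>s. \<Sum>k\<in>s. \<Sum>l\<in>s. ?e i j * ?e k l) = real (card s) ^ 2"
      "(\<Sum>i\<in>s. \<Sum>j\<in>s. \<Sum>k\<in>s. \<Sum>l\<in>s. ?e i k * ?e j l) = real (card s) ^ 2"
      "(\<Sum>i\<in>s. \<Sum>j\<in>s. \<Sum>k\<in>s. \<Sum>l\<in>s. ?e i l * ?e j k) = real (card s) ^ 2"
      using fin by (simp_all add: 1 sum_distrib_left[symmetric] sum_distrib_right[symmetric] power2_eq_square cong: sum.cong)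
    then show ?thesis
      unfolding sum_distrib_left[symmetric] sum.distrib by simp
  qed
  finally show ?thesis by (simp add: power_mult_distrib mult_ac)
qed

text \<open>Two pairs without a common PSU are uncorrelated. A common PSU can occur in four ways,
  each leaving three free indices, and the terms are at most \<open>(2 * b)\<^sup>2\<close>; hence
  16 = 4 * 4.\<close>

lemma ER_double_sum_ctr_power2_le:
  assumes \<Phi>: "\<And>i j. i \<in> s \<Longrightarrow> j \<in> s \<Longrightarrow> dep {i, j} (\<Phi> i j)" and s: "s \<subseteq> {..<N}"
    and b: "\<And>i j x. i \<in> s \<Longrightarrow> j \<in> s \<Longrightarrow> \<bar>\<Phi> i j x\<bar> \<le> b"
  shows "ER (\<lambda>x. (\<Sum>i\<in>s. \<Sum>j\<in>s. ctr (\<Phi> i j) x)\<^sup>2) \<le> 16 * real (card s) ^ 3 * b\<^sup>2"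
proof -
  have fin: "finite s" using s finite_subset by blast
  have d1: "dep {i, j} (ctr (\<Phi> i j))" if "i \<in> s" "j \<in> s" for i j by (rule dep_ctr[OF \<Phi>[OF that]])
  have d: "dep s (ctr (\<Phi> i j))" if "i \<in> s" "j \<in> s" for i j using dep_mono[OF d1[OF that], of s] that by auto
  have c: "\<bar>ctr (\<Phi> i j) x\<bar> \<le> 2 * b" if "i \<in> s" "j \<in> s" for i j x
    using \<Phi>[OF that] b[OF that] that s by (intro abs_ctr_le[of "{i, j}"]) auto
  let ?e = "\<lambda>i j. if i = j then 1 else 0 :: real"
  have le: "ER (\<lambda>x. ctr (\<Phi> i j) x * ctr (\<Phi> k l) x) \<le> (2 * b)\<^sup>2 * (?e i k + ?e i l + ?e j k + ?e j l)"
    if I: "i \<in> s" "j \<in> s" "k \<in> s" "l \<in> s" for i j k l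
  proof (cases "{i, j} \<inter> {k, l} = {}")
    case True
    have "ER (\<lambda>x. ctr (\<Phi> i j) x * ctr (\<Phi> k l) x) = 0"
      using I s by (intro ctr_uncorrelated[OF \<Phi>[OF I(1,2)] d1[OF I(3,4)] True]) auto
    then show ?thesis by simp
  next
    case False
    have "0 \<le> 2 * b" using c[OF I(1,2), of undefined] by linarith
    then have bd: "\<bar>ER (\<lambda>x. ctr (\<Phi> i j) x * ctr (\<Phi> k l) x)\<bar> \<le> (2 * b)\<^sup>2"
      unfolding power2_eq_square using I s c
      by (intro abs_ER_le[of s] dep_intros d) (auto simp only: abs_mult intro!: mult_mono mult_nonneg_nonneg abs_ge_zero)
    have "(2 * b)\<^sup>2 * 1 \<le> (2 * b)\<^sup>2 * (?e i k + ?e i l + ?e j k + ?e j l)"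
      using False by (intro mult_left_mono) auto
    then show ?thesis using bd by linarith
  qed
  have "ER (\<lambda>x. (\<Sum>i\<in>s. \<Sum>j\<in>s. ctr (\<Phi> i j) x)\<^sup>2) =
    (\<Sum>i\<in>s. \<Sum>j\<in>s. \<Sum>k\<in>s. \<Sum>l\<in>s. ER (\<lambda>x. ctr (\<Phi> i j) x * ctr (\<Phi> k l) x))"
    unfolding double_sum_power2 by (rule ER_sum4[where f = "\<lambda>i j k l x. ctr (\<Phi> i j) x * ctr (\<Phi> k l) x" and I = s,
        OF dep_mult[OF d d] s])
  also have "\<dots> \<le> (\<Sum>i\<in>s. \<Sum>j\<in>s. \<Sum>k\<in>s. \<Sum>l\<in>s. (2 * b)\<^sup>2 * (?e i k + ?e i l + ?e j k + ?e j l))"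
    by (intro sum_mono le)
  also have "\<dots> = (2 * b)\<^sup>2 * (4 * real (card s) ^ 3)"
  proof -
    have "(\<Sum>i\<in>s. \<Sum>j\<in>s. \<Sum>k\<in>s. \<Sum>l\<in>s. ?e i k) = real (card s) ^ 3"
      "(\<Sum>i\<in>s. \<Sum>j\<in>s. \<Sum>k\<in>s. \<Sum>l\<in>s. ?e i l) = real (card s) ^ 3"
      "(\<Sum>i\<in>s. \<Sum>j\<in>s. \<Sum>k\<in>s. \<Sum>l\<in>s. ?e j k) = real (card s) ^ 3"
      "(\<Sum>i\<in>s. \<Sum>j\<in>s. \<Sum>k\<in>s. \<Sum>l\<in>s. ?e j l) = real (card s) ^ 3"
      using fin by (simp_all add: sum_distrib_left[symmetric] sum_distrib_right[symmetric] power3_eq_cube cong: sum.cong)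
    then show ?thesis
      unfolding sum_distrib_left[symmetric] sum.distrib by simp
  qed
  finally show ?thesis by (simp add: power_mult_distrib mult_ac)
qed

end

section \<open>Variance estimators\<close>

context two_stage
begin

text \<open>The bound is the size of \<open>r z / pi_II D i z\<close> for a variable bounded by
  \<open>b\<close> when the density is at least N / \<open>\<kappa>\<close>. It is imposed at every
  point, so that all statistics are bounded without exceptional sets.\<close>

definition wbound :: "(nat \<Rightarrow> 'a \<Rightarrow> real) \<Rightarrow> real \<Rightarrow> bool" where
  "wbound w b \<longleftrightarrow> 0 \<le> b \<and> (\<forall>i<N. w i \<in> borel_measurable B \<and> (\<forall>z. \<bar>w i z\<bar> \<le> b * \<kappa> / (real N * real (m i))))"

text \<open>From here to \<open>ZYG\<close>: the estimators of the survey as functions of the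
  first-stage sample and of the points, with \<open>w\<close> in the place of the variable divided
  by \<open>pi_II\<close>.\<close>

definition T :: "(nat \<Rightarrow> 'a \<Rightarrow> real) \<Rightarrow> nat \<Rightarrow> (nat \<times> nat \<Rightarrow> 'a) \<Rightarrow> real" where
  "T w i x = (\<Sum>k<m i. w i (x (i, k)))"

definition y :: "(nat \<Rightarrow> 'a \<Rightarrow> real) \<Rightarrow> nat \<Rightarrow> (nat \<times> nat \<Rightarrow> 'a) \<Rightarrow> real" where
  "y w i x = T w i x / \<pi> i"

definition vh :: "(nat \<Rightarrow> 'a \<Rightarrow> real) \<Rightarrow> nat \<Rightarrow> (nat \<times> nat \<Rightarrow> 'a) \<Rightarrow> real" where
  "vh w i x = real (m i) / (real (m i) - 1) * (\<Sum>k<m i. (w i (x (i, k)) - T w i x / real (m i))\<^sup>2)"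

definition HTs :: "(nat \<Rightarrow> 'a \<Rightarrow> real) \<Rightarrow> nat set \<Rightarrow> (nat \<times> nat \<Rightarrow> 'a) \<Rightarrow> real" where
  "HTs w s x = (\<Sum>i\<in>s. y w i x)"

definition ZHT :: "(nat \<Rightarrow> 'a \<Rightarrow> real) \<Rightarrow> nat set \<Rightarrow> (nat \<times> nat \<Rightarrow> 'a) \<Rightarrow> real" where
  "ZHT w s x = (\<Sum>i\<in>s. \<Sum>j\<in>s. \<Delta> i j / \<pi>2 i j * y w i x * y w j x) + (\<Sum>i\<in>s. vh w i x / \<pi> i)"

definition ZYG :: "(nat \<Rightarrow> 'a \<Rightarrow> real) \<Rightarrow> nat set \<Rightarrow> (nat \<times> nat \<Rightarrow> 'a) \<Rightarrow> real" where
  "ZYG w s x = - (1 / 2) * (\<Sum>i\<in>s. \<Sum>j\<in>s - {i}. \<Delta> i j / \<pi>2 i j * (y w i x - y w j x)\<^sup>2) + (\<Sum>i\<in>s. vh w i x / \<pi> i)"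

text \<open>There is no region at this level, so the total is taken to be the mean of
  \<open>HTs\<close>; \<open>tau_eq\<close> identifies it with the integral.\<close>

definition tau :: "(nat \<Rightarrow> 'a \<Rightarrow> real) \<Rightarrow> real" where
  "tau w = (\<Sum>i<N. \<pi> i * ER (y w i))"

definition vtot :: "(nat \<Rightarrow> 'a \<Rightarrow> real) \<Rightarrow> real" where
  "vtot w = dmean (\<lambda>s. ER (\<lambda>x. (HTs w s x - tau w)\<^sup>2))"

lemma inverse_pi_le: "i < N \<Longrightarrow> 1 / \<pi> i \<le> \<kappa> * N / n"
  using pi_ge[of i] pi_pos[of i] n_pos N_pos by (simp add: field_simps)

lemma kappa_n: "1 \<le> \<kappa>" "0 < \<kappa>" "0 < real n" "0 < real N" "real n \<le> real N"
  using \<kappa> n_pos N_pos n_le_N by auto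

lemma m_pos: "i < N \<Longrightarrow> 0 < m i"
  using m_ge_2[of i] by simp

text \<open>Covariances of order n/N^2 are divided by joint inclusion probabilities of order at
  least n^2/N^2. This gain of 1/n makes the off-diagonal terms as small in total as the diagonal
  ones.\<close>

lemma weight_le: "i < N \<Longrightarrow> j < N \<Longrightarrow> i \<noteq> j \<Longrightarrow> \<bar>\<Delta> i j / \<pi>2 i j\<bar> \<le> \<kappa>\<^sup>2 / n"
proof -
  assume ij: "i < N" "j < N" "i \<noteq> j"
  have "1 / \<pi>2 i j \<le> \<kappa> * real N^2 / real n^2"
    using pi2_ge[OF ij] pi2_pos[OF ij] kappa_n by (simp add: field_simps)
  then have "\<bar>\<Delta> i j\<bar> * (1 / \<pi>2 i j) \<le> (\<kappa> * real n / real N ^ 2) * (\<kappa> * real N^2 / real n^2)"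
    using abs_Delta_le[OF ij] pi2_pos[OF ij] by (intro mult_mono) auto
  also have "\<dots> = \<kappa>\<^sup>2 / n" using kappa_n by (simp add: field_simps power2_eq_square)
  finally show ?thesis using pi2_pos[OF ij] by simp
qed

lemma weight_same: "i < N \<Longrightarrow> \<Delta> i i / \<pi>2 i i = 1 - \<pi> i"
  using pi_pos[of i] by (simp add: Delta_same pi2_same)

lemma dep_w: "wbound w b \<Longrightarrow> i < N \<Longrightarrow> k < m i \<Longrightarrow> dep {i} (\<lambda>x. w i (x (i, k)))"
  by (rule dep_point[of _ "b * \<kappa> / (real N * real (m i))"]) (auto simp: wbound_def)

lemma dep_T: "wbound w b \<Longrightarrow> i < N \<Longrightarrow> dep {i} (T w i)"
  unfolding T_def by (intro dep_sum dep_w) auto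

lemma dep_y: "wbound w b \<Longrightarrow> i < N \<Longrightarrow> dep {i} (y w i)"
  unfolding y_def by (intro dep_divide dep_T)

lemma dep_vh: "wbound w b \<Longrightarrow> i < N \<Longrightarrow> dep {i} (vh w i)"
  unfolding vh_def by (intro dep_intros dep_w dep_T) auto

lemma abs_w_le: "wbound w b \<Longrightarrow> i < N \<Longrightarrow> \<bar>w i z\<bar> \<le> b * \<kappa> / (real N * real (m i))"
  by (simp add: wbound_def)

lemma wbound_nonneg: "wbound w b \<Longrightarrow> 0 \<le> b"
  by (simp add: wbound_def)

lemma abs_T_le:
  assumes "wbound w b" "i < N"
  shows "\<bar>T w i x\<bar> \<le> b * \<kappa> / N"
proof -
  have "\<bar>T w i x\<bar> \<le> (\<Sum>k<m i. b * \<kappa> / (real N * real (m i)))"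
    unfolding T_def by (rule order_trans[OF sum_abs]) (intro sum_mono abs_w_le[OF assms])
  also have "\<dots> = b * \<kappa> / N" using m_pos[OF assms(2)] by simp
  finally show ?thesis .
qed

lemma abs_y_le:
  assumes "wbound w b" "i < N"
  shows "\<bar>y w i x\<bar> \<le> b * \<kappa>\<^sup>2 / n"
proof -
  have "\<bar>y w i x\<bar> = \<bar>T w i x\<bar> * (1 / \<pi> i)" using pi_pos[OF assms(2)] by (simp add: y_def)
  also have "\<dots> \<le> (b * \<kappa> / N) * (\<kappa> * N / n)"
    using abs_T_le[OF assms] inverse_pi_le[OF assms(2)] kappa_n wbound_nonneg[OF assms(1)] pi_pos[OF assms(2)]
    by (intro mult_mono) auto
  also have "\<dots> = b * \<kappa>\<^sup>2 / n" using kappa_n by (simp add: power2_eq_square)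
  finally show ?thesis .
qed

lemma abs_ER_y_le: "wbound w b \<Longrightarrow> i < N \<Longrightarrow> \<bar>ER (y w i)\<bar> \<le> b * \<kappa>\<^sup>2 / n"
  by (rule abs_ER_le[OF dep_y]) (auto intro: abs_y_le)

lemma residual_le:
  assumes "wbound w b" "i < N"
  shows "\<bar>w i z - T w i x / real (m i)\<bar> \<le> 2 * (b * \<kappa> / (real N * real (m i)))"
proof -
  have "\<bar>T w i x / real (m i)\<bar> \<le> b * \<kappa> / (real N * real (m i))"
    using abs_T_le[OF assms, of x] m_pos[OF assms(2)] by (simp add: field_simps)
  then show ?thesis using abs_w_le[OF assms, of z] by linarith
qed

text \<open>The second-stage variance estimator is a quadratic form, hence the product of the two bounds.\<close>

lemma vh_diff_le:
  assumes "wbound w b" "wbound w' b'" "wbound (\<lambda>i z. w i z - w' i z) \<delta>" "i < N"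
  shows "\<bar>vh w i x - vh w' i x\<bar> / \<pi> i \<le> 4 * \<kappa>^3 * \<delta> * (b + b') / n^2"
proof -
  let ?q = "\<kappa> / (real N * real (m i))"
  have m: "2 \<le> real (m i)" using m_ge_2[OF assms(4)] by simp
  have \<delta>: "0 \<le> \<delta>" "0 \<le> b" "0 \<le> b'" using assms wbound_nonneg by auto
  have T: "T w i x - T w' i x = T (\<lambda>i z. w i z - w' i z) i x"
    by (simp add: T_def sum_subtractf)
  have tm: "\<bar>(w i z - T w i x / real (m i))\<^sup>2 - (w' i z - T w' i x / real (m i))\<^sup>2\<bar>
      \<le> (2 * \<delta> * ?q) * (2 * (b + b') * ?q)" for z
  proof -
    let ?a = "w i z - T w i x / real (m i)" and ?a' = "w' i z - T w' i x / real (m i)"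
    have "\<bar>?a - ?a'\<bar> = \<bar>(w i z - w' i z) - T (\<lambda>i z. w i z - w' i z) i x / real (m i)\<bar>"
      unfolding T[symmetric] by (simp add: diff_divide_distrib)
    also have "\<dots> \<le> 2 * \<delta> * ?q" using residual_le[OF assms(3,4), of z x] by simp
    finally have 1: "\<bar>?a - ?a'\<bar> \<le> 2 * \<delta> * ?q" .
    have 2: "\<bar>?a + ?a'\<bar> \<le> 2 * (b + b') * ?q"
      using residual_le[OF assms(1,4), of z x] residual_le[OF assms(2,4), of z x]
      by (simp add: distrib_right distrib_left add_divide_distrib)
    have "\<bar>?a\<^sup>2 - ?a'\<^sup>2\<bar> = \<bar>?a - ?a'\<bar> * \<bar>?a + ?a'\<bar>"
      unfolding abs_mult[symmetric] by (simp only: power2_eq_square square_diff_square_factored mult.commute)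
    also have "\<dots> \<le> (2 * \<delta> * ?q) * (2 * (b + b') * ?q)" using 1 2 by (intro mult_mono) (auto simp: \<delta> kappa_n(2) less_imp_le)
    finally show ?thesis .
  qed
  have "\<bar>vh w i x - vh w' i x\<bar> = real (m i) / (real (m i) - 1) *
      \<bar>\<Sum>k<m i. (w i (x (i, k)) - T w i x / real (m i))\<^sup>2 - (w' i (x (i, k)) - T w' i x / real (m i))\<^sup>2\<bar>"
    using m unfolding vh_def right_diff_distrib[symmetric] abs_mult sum_subtractf by simp
  \<comment> \<open>At least two draws per PSU give m / (m - 1) at most 2, and below 1 / m at most
    1/2.\<close>
  also have "\<dots> \<le> 2 * (\<Sum>k<m i. (2 * \<delta> * ?q) * (2 * (b + b') * ?q))"
    using m by (intro mult_mono order_trans[OF sum_abs] sum_mono tm) (auto simp: field_simps)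
  also have "\<dots> = 8 * \<delta> * (b + b') * \<kappa>\<^sup>2 / (real N ^ 2) * (1 / real (m i))"
    using m kappa_n by (simp add: field_simps power2_eq_square)
  also have "\<dots> \<le> 8 * \<delta> * (b + b') * \<kappa>\<^sup>2 / (real N ^ 2) * (1 / 2)"
    using m \<delta> by (intro mult_left_mono) (auto simp: field_simps)
  finally have le: "\<bar>vh w i x - vh w' i x\<bar> \<le> 4 * \<delta> * (b + b') * \<kappa>\<^sup>2 / (real N ^ 2)" by simp
  have "\<bar>vh w i x - vh w' i x\<bar> * (1 / \<pi> i) \<le> (4 * \<delta> * (b + b') * \<kappa>\<^sup>2 / (real N ^ 2)) * (\<kappa> * N / n)"
    using le inverse_pi_le[OF assms(4)] \<delta> pi_pos[OF assms(4)] by (intro mult_mono) auto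
  also have "\<dots> = 4 * \<kappa>^3 * \<delta> * (b + b') / (real n * real N)"
    using kappa_n by (simp add: field_simps power2_eq_square power3_eq_cube)
  \<comment> \<open>One factor N is traded for the smaller n, since the sum over the sample will
    have n terms.\<close>
  also have "\<dots> \<le> 4 * \<kappa>^3 * \<delta> * (b + b') / (real n * real n)"
    using kappa_n \<delta> by (intro divide_left_mono mult_left_mono mult_nonneg_nonneg) auto
  finally show ?thesis by (simp add: power2_eq_square)
qed

lemma wbound_zero: "wbound (\<lambda>i z. 0) 0"
  by (simp add: wbound_def)

text \<open>This is the comparison with the zero variable.\<close>

lemma vh_le:
  assumes "wbound w b" "i < N"
  shows "\<bar>vh w i x / \<pi> i\<bar> \<le> 4 * \<kappa>^3 * b^2 / n^2"
proof -
  have "vh (\<lambda>i z. 0) i x = 0" by (simp add: vh_def T_def)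
  then show ?thesis
    using vh_diff_le[OF assms(1) wbound_zero _ assms(2), of b x] assms pi_pos[OF assms(2)]
    by (simp add: power2_eq_square mult_ac)
qed

lemma y_diff: "y w i x - y w' i x = y (\<lambda>i z. w i z - w' i z) i x"
  by (simp add: y_def T_def sum_subtractf diff_divide_distrib)

lemma vh_sum_diff_le:
  assumes w: "wbound w b" "wbound w' b'" "wbound (\<lambda>i z. w i z - w' i z) \<delta>" and s: "s \<in> samples"
  shows "\<bar>(\<Sum>i\<in>s. vh w i x / \<pi> i) - (\<Sum>i\<in>s. vh w' i x / \<pi> i)\<bar> \<le> 4 * \<kappa>^6 * \<delta> * (b + b') / n"
proof -
  have "\<bar>(\<Sum>i\<in>s. vh w i x / \<pi> i) - (\<Sum>i\<in>s. vh w' i x / \<pi> i)\<bar> \<le> (\<Sum>i\<in>s. 4 * \<kappa>^3 * \<delta> * (b + b') / n^2)"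
    unfolding sum_subtractf[symmetric] diff_divide_distrib[symmetric]
  proof (rule order_trans[OF sum_abs], rule sum_mono)
    fix i assume "i \<in> s"
    then have i: "i < N" using s by auto
    show "\<bar>(vh w i x - vh w' i x) / \<pi> i\<bar> \<le> 4 * \<kappa>^3 * \<delta> * (b + b') / n^2"
      using vh_diff_le[OF w i, of x] pi_pos[OF i] by simp
  qed
  also have "\<dots> = 4 * \<kappa>^3 * (\<delta> * (b + b')) / n"
    using s kappa_n by (simp add: power2_eq_square)
  \<comment> \<open>The power of \<open>\<kappa>\<close> is raised to match that of the double sum
    to which this term is added.\<close>
  also have "\<dots> \<le> 4 * \<kappa>^6 * (\<delta> * (b + b')) / n"
    using w[THEN wbound_nonneg] kappa_n
    by (intro divide_right_mono mult_right_mono mult_left_mono power_increasing) auto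
  finally show ?thesis by (simp add: mult.assoc)
qed

text \<open>The n diagonal weights are at most 1 and the n^2 others at most
  \<open>\<kappa>\<^sup>2 / n\<close>, so the total weight is of order n.\<close>

lemma weighted_double_sum_le:
  assumes s: "s \<in> samples" and d: "0 \<le> d" and a: "\<And>i j. i \<in> s \<Longrightarrow> j \<in> s \<Longrightarrow> \<bar>a i j\<bar> \<le> d"
  shows "\<bar>\<Sum>i\<in>s. \<Sum>j\<in>s. \<Delta> i j / \<pi>2 i j * a i j\<bar> \<le> 2 * \<kappa>\<^sup>2 * n * d"
proof -
  have fin: "finite s" and sN: "\<And>i. i \<in> s \<Longrightarrow> i < N" and card: "card s = n"
    using s finite_sample[OF s] by auto
  have "\<bar>\<Sum>i\<in>s. \<Sum>j\<in>s. \<Delta> i j / \<pi>2 i j * a i j\<bar> \<le> (\<Sum>i\<in>s. \<Sum>j\<in>s. (\<kappa>\<^sup>2 / n + (if i = j then 1 else 0)) * d)"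
  proof (intro order_trans[OF sum_abs] sum_mono)
    fix i j assume ij: "i \<in> s" "j \<in> s"
    have "\<bar>\<Delta> i j / \<pi>2 i j\<bar> \<le> \<kappa>\<^sup>2 / n + (if i = j then 1 else 0)"
    proof (cases "i = j")
      case True
      have "\<bar>\<Delta> i i / \<pi>2 i i\<bar> \<le> 1"
        unfolding weight_same[OF sN[OF ij(1)]] using pi_bounds[of i] by simp
      moreover have "0 \<le> \<kappa>\<^sup>2 / n" by simp
      ultimately have "\<bar>\<Delta> i i / \<pi>2 i i\<bar> \<le> \<kappa>\<^sup>2 / n + 1" by linarith
      then show ?thesis by (simp only: True[symmetric] simp_thms if_True)
    qed (use weight_le sN ij in auto)
    then show "\<bar>\<Delta> i j / \<pi>2 i j * a i j\<bar> \<le> (\<kappa>\<^sup>2 / n + (if i = j then 1 else 0)) * d"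
      unfolding abs_mult using a[OF ij] by (intro mult_mono) auto
  qed
  also have "\<dots> = (\<kappa>\<^sup>2 + 1) * (n * d)"
    unfolding sum_distrib_right[symmetric] using fin kappa_n by (simp add: sum.distrib card algebra_simps)
  also have "\<dots> \<le> (\<kappa>\<^sup>2 + \<kappa>\<^sup>2) * (n * d)"
    using kappa_powers d by (intro mult_right_mono add_left_mono) auto
  finally show ?thesis by (simp add: algebra_simps)
qed

text \<open>A quadratic form changes by at most the change of its argument times the size of the
  arguments. The bound holds for each sample and each \<open>x\<close>, so it applies to a variable
  that itself depends on the sample.\<close>

lemma ZHT_diff_le:
  assumes w: "wbound w b" "wbound w' b'" "wbound (\<lambda>i z. w i z - w' i z) \<delta>" and s: "s \<in> samples"
  shows "\<bar>ZHT w s x - ZHT w' s x\<bar> \<le> 8 * \<kappa>^6 * \<delta> * (b + b') / n"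
proof -
  let ?D = "\<kappa>^4 * (\<delta> * (b + b')) / real n ^ 2"
  note \<delta> = w[THEN wbound_nonneg]
  have "\<bar>y w i x * y w j x - y w' i x * y w' j x\<bar> \<le> ?D" if "i \<in> s" "j \<in> s" for i j
  proof -
    have ij: "i < N" "j < N" using that s by auto
    have eq: "y w i x * y w j x - y w' i x * y w' j x
      = y (\<lambda>i z. w i z - w' i z) i x * y w j x + y w' i x * y (\<lambda>i z. w i z - w' i z) j x"
      unfolding y_diff[symmetric] by (simp add: algebra_simps)
    have "\<bar>y w i x * y w j x - y w' i x * y w' j x\<bar>
        \<le> (\<delta> * \<kappa>\<^sup>2 / n) * (b * \<kappa>\<^sup>2 / n) + (b' * \<kappa>\<^sup>2 / n) * (\<delta> * \<kappa>\<^sup>2 / n)"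
      unfolding eq using ij[THEN abs_y_le[OF w(3)], of x] ij[THEN abs_y_le[OF w(1)], of x] ij[THEN abs_y_le[OF w(2)], of x] \<delta>
      by (intro order_trans[OF abs_triangle_ineq] add_mono) (simp_all only: abs_mult, (intro mult_mono; simp)+)
    also have "\<dots> = ?D" using kappa_n by (simp add: field_simps power2_eq_square power4_eq_xxxx)
    finally show ?thesis .
  qed
  then have "\<bar>\<Sum>i\<in>s. \<Sum>j\<in>s. \<Delta> i j / \<pi>2 i j * (y w i x * y w j x - y w' i x * y w' j x)\<bar> \<le> 2 * \<kappa>\<^sup>2 * n * ?D"
    using \<delta> by (intro weighted_double_sum_le[OF s]) auto
  also have "\<dots> = 2 * \<kappa>^6 * (\<delta> * (b + b')) / n"
    using kappa_n by (simp add: eval_nat_numeral)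
  also have "\<dots> \<le> 4 * \<kappa>^6 * (\<delta> * (b + b')) / n"
    using \<delta> kappa_n by (intro divide_right_mono mult_right_mono) auto
  finally have "\<bar>\<Sum>i\<in>s. \<Sum>j\<in>s. \<Delta> i j / \<pi>2 i j * (y w i x * y w j x - y w' i x * y w' j x)\<bar> \<le> 4 * \<kappa>^6 * \<delta> * (b + b') / n"
    by (simp only: mult.assoc)
  note S = this
  have eq: "ZHT w s x - ZHT w' s x = (\<Sum>i\<in>s. \<Sum>j\<in>s. \<Delta> i j / \<pi>2 i j * (y w i x * y w j x - y w' i x * y w' j x))
      + ((\<Sum>i\<in>s. vh w i x / \<pi> i) - (\<Sum>i\<in>s. vh w' i x / \<pi> i))"
    unfolding ZHT_def by (simp add: sum_subtractf right_diff_distrib mult.assoc)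
  have "\<bar>ZHT w s x - ZHT w' s x\<bar> \<le> 4 * \<kappa>^6 * \<delta> * (b + b') / n + 4 * \<kappa>^6 * \<delta> * (b + b') / n"
    unfolding eq by (rule order_trans[OF abs_triangle_ineq add_mono[OF S vh_sum_diff_le[OF w s]]])
  then show ?thesis by (simp add: mult_ac)
qed

text \<open>The squared difference vanishes on the diagonal; with the full double sum
  \<open>weighted_double_sum_le\<close> applies.\<close>

lemma ZYG_eq:
  assumes "s \<in> samples"
  shows "ZYG w s x = - (1 / 2) * (\<Sum>i\<in>s. \<Sum>j\<in>s. \<Delta> i j / \<pi>2 i j * (y w i x - y w j x)\<^sup>2) + (\<Sum>i\<in>s. vh w i x / \<pi> i)"
proof -
  have "(\<Sum>j\<in>s - {i}. \<Delta> i j / \<pi>2 i j * (y w i x - y w j x)\<^sup>2) = (\<Sum>j\<in>s. \<Delta> i j / \<pi>2 i j * (y w i x - y w j x)\<^sup>2)" for i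
    using finite_sample[OF assms] by (intro sum.mono_neutral_left) auto
  then show ?thesis by (simp only: ZYG_def)
qed

lemma ZYG_diff_le:
  assumes w: "wbound w b" "wbound w' b'" "wbound (\<lambda>i z. w i z - w' i z) \<delta>" and s: "s \<in> samples"
  shows "\<bar>ZYG w s x - ZYG w' s x\<bar> \<le> 8 * \<kappa>^6 * \<delta> * (b + b') / n"
proof -
  \<comment> \<open>The 4 arises from two differences of \<open>y\<close>, each doubling its bound.
    With the factor 1/2 of the estimator and the within-PSU part the final constant is again
    8.\<close>
  let ?D = "4 * \<kappa>^4 * (\<delta> * (b + b')) / real n ^ 2"
  let ?S = "\<Sum>i\<in>s. \<Sum>j\<in>s. \<Delta> i j / \<pi>2 i j * ((y w i x - y w j x)\<^sup>2 - (y w' i x - y w' j x)\<^sup>2)"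
  note \<delta> = w[THEN wbound_nonneg]
  have "\<bar>(y w i x - y w j x)\<^sup>2 - (y w' i x - y w' j x)\<^sup>2\<bar> \<le> ?D" if "i \<in> s" "j \<in> s" for i j
  proof -
    have ij: "i < N" "j < N" using that s by auto
    note y = ij[THEN abs_y_le[rotated], of _ _ x]
    have eq: "(y w i x - y w j x)\<^sup>2 - (y w' i x - y w' j x)\<^sup>2
      = (y (\<lambda>i z. w i z - w' i z) i x - y (\<lambda>i z. w i z - w' i z) j x) * ((y w i x - y w j x) + (y w' i x - y w' j x))"
      unfolding y_diff[symmetric] by (simp add: power2_eq_square algebra_simps)
    have "\<bar>(y w i x - y w j x)\<^sup>2 - (y w' i x - y w' j x)\<^sup>2\<bar> \<le> (2 * (\<delta> * \<kappa>\<^sup>2 / n)) * (2 * (b * \<kappa>\<^sup>2 / n) + 2 * (b' * \<kappa>\<^sup>2 / n))"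
      unfolding eq abs_mult
    proof (rule mult_mono)
      show "\<bar>y (\<lambda>i z. w i z - w' i z) i x - y (\<lambda>i z. w i z - w' i z) j x\<bar> \<le> 2 * (\<delta> * \<kappa>\<^sup>2 / n)"
        using y[OF w(3)] by linarith
      show "\<bar>y w i x - y w j x + (y w' i x - y w' j x)\<bar> \<le> 2 * (b * \<kappa>\<^sup>2 / n) + 2 * (b' * \<kappa>\<^sup>2 / n)"
        using y[OF w(1)] y[OF w(2)] by linarith
    qed (use \<delta> in auto)
    also have "\<dots> = ?D" using kappa_n by (simp add: field_simps power2_eq_square power4_eq_xxxx)
    finally show ?thesis .
  qed
  then have "\<bar>?S\<bar> \<le> 2 * \<kappa>\<^sup>2 * n * ?D"
    using \<delta> by (intro weighted_double_sum_le[OF s]) auto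
  also have "\<dots> = 8 * \<kappa>^6 * \<delta> * (b + b') / n"
    using kappa_n by (simp add: eval_nat_numeral)
  finally have S: "\<bar>?S\<bar> \<le> 8 * \<kappa>^6 * \<delta> * (b + b') / n" .
  have "ZYG w s x - ZYG w' s x = - (1 / 2) * ?S + ((\<Sum>i\<in>s. vh w i x / \<pi> i) - (\<Sum>i\<in>s. vh w' i x / \<pi> i))"
    unfolding ZYG_eq[OF s] by (simp add: sum_subtractf right_diff_distrib)
  then have "\<bar>ZYG w s x - ZYG w' s x\<bar> \<le> 1 / 2 * \<bar>?S\<bar> + \<bar>(\<Sum>i\<in>s. vh w i x / \<pi> i) - (\<Sum>i\<in>s. vh w' i x / \<pi> i)\<bar>"
    by linarith
  also have "\<dots> \<le> 1 / 2 * (8 * \<kappa>^6 * \<delta> * (b + b') / n) + 4 * \<kappa>^6 * \<delta> * (b + b') / n"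
    by (intro add_mono mult_left_mono S vh_sum_diff_le[OF w s]) auto
  finally show ?thesis by (simp add: mult_ac)
qed

section \<open>Moments of the Horvitz-Thompson and variance estimators in the product model\<close>

lemma dmean_sample_sum: "dmean (\<lambda>s. \<Sum>i\<in>s. f i) = (\<Sum>i<N. \<pi> i * f i)"
proof -
  have "dmean (\<lambda>s. \<Sum>i\<in>s. f i) = dmean (\<lambda>s. \<Sum>i<N. indicat_real s i * f i)"
    by (intro dmean_cong sum_indicator_sample[symmetric])
  then show ?thesis by (simp only: dmean_sum dmean_multc \<pi>_def)
qed

text \<open>The error splits into the second-stage error within the given sample and the first-stage
  error of the conditional mean.\<close>

lemma HTs_minus_tau:
  assumes "s \<in> samples"
  shows "HTs w s x - tau w = (\<Sum>i\<in>s. ctr (y w i) x) + (\<Sum>i<N. ci s i * ER (y w i))"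
proof -
  have "(\<Sum>i<N. ci s i * ER (y w i)) = (\<Sum>i\<in>s. ER (y w i)) - tau w"
    unfolding sum_indicator_sample[OF assms, symmetric] tau_def ci_def
    by (simp add: left_diff_distrib sum_subtractf)
  then show ?thesis by (simp add: HTs_def ctr_def sum_subtractf)
qed

text \<open>Each \<open>y\<close> is of order b/n, and the fourth moments of both parts of the error
  are of order n^2 * (b/n)^4.\<close>

lemma HT_fourth_moment:
  assumes w: "wbound w b"
  shows "dmean (\<lambda>s. ER (\<lambda>x. (HTs w s x - tau w) ^ 4)) \<le> 1344 * \<kappa>^10 * b^4 / n^2"
proof -
  let ?L = "\<lambda>s. \<Sum>i<N. ci s i * ER (y w i)"
  have "dmean (\<lambda>s. ER (\<lambda>x. (HTs w s x - tau w) ^ 4))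
    \<le> dmean (\<lambda>s. 8 * (48 * real n ^ 2 * (b * \<kappa>\<^sup>2 / n) ^ 4) + 8 * (?L s) ^ 4)"
  proof (rule dmean_mono)
    fix s assume s: "s \<in> samples"
    then have sN: "s \<subseteq> {..<N}" "card s = n" by auto
    have d: "dep s (\<lambda>x. \<Sum>i\<in>s. ctr (y w i) x)"
      using sN w by (intro dep_sum dep_mono[OF dep_ctr[OF dep_y]]) auto
    have "ER (\<lambda>x. (HTs w s x - tau w) ^ 4) \<le> ER (\<lambda>x. 8 * (\<Sum>i\<in>s. ctr (y w i) x) ^ 4 + 8 * (?L s) ^ 4)"
      unfolding HTs_minus_tau[OF s] by (intro ER_mono[OF _ _ sN(1)] dep_add dep_mult dep_power dep_const d power4_add_le)
    also have "\<dots> = 8 * ER (\<lambda>x. (\<Sum>i\<in>s. ctr (y w i) x) ^ 4) + 8 * (?L s) ^ 4"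
      by (subst ER_add[OF _ _ sN(1)]) (intro dep_mult dep_power dep_const d | simp)+
    also have "\<dots> \<le> 8 * (48 * real (card s) ^ 2 * (b * \<kappa>\<^sup>2 / n) ^ 4) + 8 * (?L s) ^ 4"
      using sN w by (intro add_mono mult_left_mono ER_sum_ctr_power4_le dep_y abs_y_le order_refl) auto
    finally show "ER (\<lambda>x. (HTs w s x - tau w) ^ 4) \<le> 8 * (48 * real n ^ 2 * (b * \<kappa>\<^sup>2 / n) ^ 4) + 8 * (?L s) ^ 4"
      by (simp add: sN)
  qed
  also have "\<dots> = 8 * (48 * real n ^ 2 * (b * \<kappa>\<^sup>2 / n) ^ 4) + 8 * dmean (\<lambda>s. (?L s) ^ 4)"
    by (simp only: dmean_add dmean_cmult dmean_const)
  also have "\<dots> \<le> 8 * (48 * real n ^ 2 * (b * \<kappa>\<^sup>2 / n) ^ 4) + 8 * (120 * \<kappa>^2 * n^2 * (b * \<kappa>\<^sup>2 / n) ^ 4)"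
    using abs_ER_y_le[OF w] by (intro add_mono mult_left_mono linear_fourth_moment) auto
  \<comment> \<open>384 = 8 * 48 is the share of the second stage and 960 = 8 * 120 that of the
    first.\<close>
  also have "\<dots> = (384 + 960 * \<kappa>^2) * (\<kappa>^8 * b^4 / n^2)"
    using kappa_n by (simp add: field_simps eval_nat_numeral)
  also have "\<dots> \<le> (384 * \<kappa>^2 + 960 * \<kappa>^2) * (\<kappa>^8 * b^4 / n^2)"
    using kappa_powers by (intro mult_right_mono add_mono) auto
  also have "\<dots> = 1344 * \<kappa>^10 * b^4 / n^2" by (simp add: eval_nat_numeral)
  finally show ?thesis .
qed

lemma dmean_linear_sq: "dmean (\<lambda>s. (\<Sum>i<N. ci s i * t i)\<^sup>2) = (\<Sum>i<N. \<Sum>j<N. \<Delta> i j * (t i * t j))"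
proof -
  have "(\<Sum>i<N. ci s i * t i)\<^sup>2 = (\<Sum>i<N. \<Sum>j<N. (t i * t j) * (ci s i * ci s j))" for s
    unfolding sum_power2 by (intro sum.cong refl) (simp only: mult_ac)
  then show ?thesis by (simp only: dmean_sum dmean_cmult dmean_ci_ci mult.commute[of "\<Delta> _ _"])
qed

text \<open>This is the law of total variance: given the sample the second-stage error has mean
  zero, so the cross term disappears.\<close>

lemma vtot_eq:
  assumes w: "wbound w b"
  shows "vtot w = (\<Sum>i<N. \<pi> i * ER (\<lambda>x. (ctr (y w i) x)\<^sup>2)) + (\<Sum>i<N. \<Sum>j<N. \<Delta> i j * (ER (y w i) * ER (y w j)))"
proof -
  let ?L = "\<lambda>s. \<Sum>i<N. ci s i * ER (y w i)"
  have "vtot w = dmean (\<lambda>s. (\<Sum>i\<in>s. ER (\<lambda>x. (ctr (y w i) x)\<^sup>2)) + (?L s)\<^sup>2)"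
    unfolding vtot_def
  proof (rule dmean_cong)
    fix s assume s: "s \<in> samples"
    then have sN: "s \<subseteq> {..<N}" "card s = n" by auto
    have d1: "dep s (ctr (y w i))" if "i \<in> s" for i
      using sN w that by (intro dep_mono[OF dep_ctr[OF dep_y]]) auto
    let ?S = "\<lambda>x. \<Sum>i\<in>s. ctr (y w i) x"
    have d: "dep s ?S" by (intro dep_sum d1)
    have "ER ?S = (\<Sum>i\<in>s. ER (ctr (y w i)))" using sN by (intro ER_sum[of _ s] d1) auto
    also have "\<dots> = 0" using sN by (intro sum.neutral ballI ER_ctr[OF dep_y[OF w]]) auto
    finally have 0: "ER ?S = 0" .
    have "ER (\<lambda>x. (HTs w s x - tau w)\<^sup>2) = ER (\<lambda>x. ((?S x)\<^sup>2 + (2 * ?L s) * ?S x) + (?L s)\<^sup>2)"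
      unfolding HTs_minus_tau[OF s] by (simp add: power2_sum algebra_simps)
    also have "\<dots> = ER (\<lambda>x. (?S x)\<^sup>2 + (2 * ?L s) * ?S x) + (?L s)\<^sup>2"
      by (subst ER_add[OF _ _ sN(1)]) (intro dep_add dep_mult dep_power dep_const d | simp)+
    also have "ER (\<lambda>x. (?S x)\<^sup>2 + (2 * ?L s) * ?S x) = ER (\<lambda>x. (?S x)\<^sup>2) + ER (\<lambda>x. (2 * ?L s) * ?S x)"
      by (intro ER_add[OF _ _ sN(1)] dep_mult dep_power dep_const d)
    also have "ER (\<lambda>x. (2 * ?L s) * ?S x) = 0" using 0 by simp
    also have "ER (\<lambda>x. (?S x)\<^sup>2) = (\<Sum>i\<in>s. ER (\<lambda>x. (ctr (y w i) x)\<^sup>2))"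
      using sN by (intro ER_sum_ctr_power2 dep_y[OF w]) auto
    finally show "ER (\<lambda>x. (HTs w s x - tau w)\<^sup>2) = (\<Sum>i\<in>s. ER (\<lambda>x. (ctr (y w i) x)\<^sup>2)) + (?L s)\<^sup>2"
      by simp
  qed
  then show ?thesis by (simp only: dmean_add dmean_sample_sum dmean_linear_sq)
qed

text \<open>Single-PSU terms and pair terms fluctuate in both stages, which gives four centred sums
  to be bounded separately. The hypothesis on \<open>Z\<close> says that the statistic is unbiased
  for it. With \<open>\<beta>\<close> of order n^-2 and \<open>\<phi>\<close> of order n^-3 both
  summands of the bound are of order n^-3.\<close>

lemma second_moment_general:
  assumes B: "\<And>i. i < N \<Longrightarrow> dep {i} (G i)" "\<And>i x. i < N \<Longrightarrow> \<bar>G i x\<bar> \<le> \<beta>"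
    and \<Phi>: "\<And>i j. i < N \<Longrightarrow> j < N \<Longrightarrow> dep {i, j} (\<Phi> i j)" "\<And>i j x. i < N \<Longrightarrow> j < N \<Longrightarrow> \<bar>\<Phi> i j x\<bar> \<le> \<phi>"
      "\<And>i x. \<Phi> i i x = 0"
    and Z: "Z = (\<Sum>i<N. \<pi> i * ER (G i)) + (\<Sum>i<N. \<Sum>j<N. \<pi>2 i j * ER (\<Phi> i j))"
  shows "dmean (\<lambda>s. ER (\<lambda>x. ((\<Sum>i\<in>s. G i x) + (\<Sum>i\<in>s. \<Sum>j\<in>s. \<Phi> i j x) - Z)\<^sup>2))
    \<le> 24 * \<kappa> * n * \<beta>\<^sup>2 + 1088 * \<kappa>^3 * real n^3 * \<phi>\<^sup>2"
proof -
  let ?A = "\<lambda>s x. \<Sum>i\<in>s. ctr (G i) x" and ?B = "\<lambda>s x. \<Sum>i\<in>s. \<Sum>j\<in>s. ctr (\<Phi> i j) x"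
  let ?C = "\<lambda>s. \<Sum>i<N. ci s i * ER (G i)"
  let ?D = "\<lambda>s. (\<Sum>i\<in>s. \<Sum>j\<in>s. ER (\<Phi> i j)) - (\<Sum>i<N. \<Sum>j<N. \<pi>2 i j * ER (\<Phi> i j))"
  have sq4: "(a + b + c + d)\<^sup>2 \<le> 4 * a\<^sup>2 + 4 * b\<^sup>2 + 4 * c\<^sup>2 + 4 * d\<^sup>2" for a b c d :: real
  proof -
    show ?thesis using power2_add_le[of "a + b" "c + d"] power2_add_le[of a b] power2_add_le[of c d]
      by (simp add: add.assoc)
  qed
  have le: "ER (\<lambda>x. ((\<Sum>i\<in>s. G i x) + (\<Sum>i\<in>s. \<Sum>j\<in>s. \<Phi> i j x) - Z)\<^sup>2)
    \<le> (16 * real n * \<beta>\<^sup>2 + 64 * real n ^ 3 * \<phi>\<^sup>2) + (4 * (?C s)\<^sup>2 + 4 * (?D s)\<^sup>2)"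
    if s: "s \<in> samples" for s
  proof -
    from s have sN: "s \<subseteq> {..<N}" "card s = n" by auto
    then have lt: "i < N" if "i \<in> s" for i using that by auto
    have dA: "dep s (?A s)"
      using B(1)[OF lt] by (intro dep_sum dep_mono[OF dep_ctr]) auto
    have dB: "dep s (?B s)"
      using \<Phi>(1)[OF lt lt] by (intro dep_sum dep_mono[OF dep_ctr]) auto
    have C: "?C s = (\<Sum>i\<in>s. ER (G i)) - (\<Sum>i<N. \<pi> i * ER (G i))"
      unfolding sum_indicator_sample[OF s, symmetric] ci_def by (simp add: left_diff_distrib sum_subtractf)
    have eq: "(\<Sum>i\<in>s. G i x) + (\<Sum>i\<in>s. \<Sum>j\<in>s. \<Phi> i j x) - Z = ?A s x + ?B s x + ?C s + ?D s" for x
      unfolding C Z ctr_def sum_subtractf by simp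
    have "ER (\<lambda>x. ((\<Sum>i\<in>s. G i x) + (\<Sum>i\<in>s. \<Sum>j\<in>s. \<Phi> i j x) - Z)\<^sup>2)
      \<le> ER (\<lambda>x. 4 * (?A s x)\<^sup>2 + 4 * (?B s x)\<^sup>2 + 4 * (?C s)\<^sup>2 + 4 * (?D s)\<^sup>2)"
      unfolding eq by (rule ER_mono[OF _ _ sN(1) sq4]) (intro dep_add dep_mult dep_power dep_const dA dB)+
    also have "\<dots> = ER (\<lambda>x. (4 * (?A s x)\<^sup>2 + 4 * (?B s x)\<^sup>2) + (4 * (?C s)\<^sup>2 + 4 * (?D s)\<^sup>2))"
      by (simp only: add.assoc)
    also have "\<dots> = ER (\<lambda>x. 4 * (?A s x)\<^sup>2 + 4 * (?B s x)\<^sup>2) + (4 * (?C s)\<^sup>2 + 4 * (?D s)\<^sup>2)"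
      by (subst ER_add[OF _ _ sN(1)]) (intro dep_add dep_mult dep_power dep_const dA dB | simp)+
    also have "ER (\<lambda>x. 4 * (?A s x)\<^sup>2 + 4 * (?B s x)\<^sup>2) = 4 * ER (\<lambda>x. (?A s x)\<^sup>2) + 4 * ER (\<lambda>x. (?B s x)\<^sup>2)"
      by (subst ER_add[OF _ _ sN(1)]) (intro dep_add dep_mult dep_power dep_const dA dB | simp)+
    also have "\<dots> \<le> 4 * (4 * real (card s) * \<beta>\<^sup>2) + 4 * (16 * real (card s) ^ 3 * \<phi>\<^sup>2)"
    proof (intro add_mono mult_left_mono)
      show "ER (\<lambda>x. (?A s x)\<^sup>2) \<le> 4 * real (card s) * \<beta>\<^sup>2"
        by (rule ER_sum_ctr_power2_le[OF B(1) sN(1) B(2)]) (auto dest: lt)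
      show "ER (\<lambda>x. (?B s x)\<^sup>2) \<le> 16 * real (card s) ^ 3 * \<phi>\<^sup>2"
        by (rule ER_double_sum_ctr_power2_le[OF \<Phi>(1) sN(1) \<Phi>(2)]) (auto dest: lt)
    qed auto
    finally show ?thesis by (simp add: sN)
  qed
  have "dmean (\<lambda>s. ER (\<lambda>x. ((\<Sum>i\<in>s. G i x) + (\<Sum>i\<in>s. \<Sum>j\<in>s. \<Phi> i j x) - Z)\<^sup>2))
    \<le> dmean (\<lambda>s. (16 * real n * \<beta>\<^sup>2 + 64 * real n ^ 3 * \<phi>\<^sup>2) + (4 * (?C s)\<^sup>2 + 4 * (?D s)\<^sup>2))"
    by (intro dmean_mono le)
  also have "\<dots> = (16 * real n * \<beta>\<^sup>2 + 64 * real n ^ 3 * \<phi>\<^sup>2) + (4 * dmean (\<lambda>s. (?C s)\<^sup>2) + 4 * dmean (\<lambda>s. (?D s)\<^sup>2))"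
    by (simp only: dmean_add dmean_cmult dmean_const)
  also have "\<dots> \<le> (16 * real n * \<beta>\<^sup>2 + 64 * real n ^ 3 * \<phi>\<^sup>2)
      + (4 * (2 * \<kappa> * n * \<beta>\<^sup>2) + 4 * (256 * \<kappa>^3 * \<phi>\<^sup>2 * n^3))"
  proof -
    have "\<bar>ER (G i)\<bar> \<le> \<beta>" if "i < N" for i
      using B that by (intro abs_ER_le[of "{i}"]) auto
    moreover have "\<bar>ER (\<Phi> i j)\<bar> \<le> \<phi>" if "i < N" "j < N" for i j
      using \<Phi> that by (intro abs_ER_le[of "{i, j}"]) auto
    moreover have "ER (\<Phi> i i) = 0" for i
    proof -
      have "\<Phi> i i = (\<lambda>_. 0)" using \<Phi>(3) by (intro ext)
      then show ?thesis by simp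
    qed
    ultimately show ?thesis
      by (intro add_mono mult_left_mono order_refl linear_second_moment quadratic_second_moment) auto
  qed
  \<comment> \<open>The factors 1 are inserted to be replaced by \<open>\<kappa>\<close> and its
    cube, so that the second-stage constants 16 and 64 merge with the first-stage constants 8 and
    1024.\<close>
  also have "\<dots> = 8 * \<kappa> * n * \<beta>\<^sup>2 + 16 * 1 * n * \<beta>\<^sup>2 + (64 * 1 * real n ^ 3 * \<phi>\<^sup>2 + 1024 * \<kappa>^3 * real n ^ 3 * \<phi>\<^sup>2)"
    by simp
  also have "\<dots> \<le> 8 * \<kappa> * n * \<beta>\<^sup>2 + 16 * \<kappa> * n * \<beta>\<^sup>2 + (64 * \<kappa>^3 * real n ^ 3 * \<phi>\<^sup>2 + 1024 * \<kappa>^3 * real n ^ 3 * \<phi>\<^sup>2)"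
    using kappa_n by (intro add_mono mult_right_mono mult_left_mono order_refl one_le_power) auto
  also have "\<dots> = 24 * \<kappa> * n * \<beta>\<^sup>2 + 1088 * \<kappa>^3 * real n^3 * \<phi>\<^sup>2" by simp
  finally show ?thesis .
qed

lemma ER_point:
  assumes "i < N" "k < m i" "u \<in> borel_measurable B"
  shows "ER (\<lambda>x. u (x (i, k))) = integral\<^sup>L (\<mu> i) u"
proof -
  have q: "(i, k) \<in> idx {..<N}" using assms by (simp add: idx_def)
  have u: "u \<in> borel_measurable (\<mu> i)"
    using assms(3) unfolding measurable_cong_sets[OF sets_\<mu> refl] .
  have "(\<lambda>x. x (i, k)) \<in> measurable R (\<mu> i)"
    using measurable_R_component[OF q] unfolding measurable_cong_sets[OF refl sets_\<mu>] .
  then have "integral\<^sup>L (distr R (\<mu> i) (\<lambda>x. x (i, k))) u = ER (\<lambda>x. u (x (i, k)))"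
    by (rule integral_distr[OF _ u])
  then show ?thesis using distr_R_component[OF q] by simp
qed

text \<open>\<open>dep\<close> distinguishes PSUs but not draws, so the independence of two draws
  within one PSU is taken from single coordinates.\<close>

lemma ER_point_mult:
  assumes "i < N" "k < m i" "l < m i" "k \<noteq> l" and u: "u \<in> borel_measurable B" "\<And>z. \<bar>u z\<bar> \<le> b"
  shows "ER (\<lambda>x. u (x (i, k)) * u (x (i, l))) = (integral\<^sup>L (\<mu> i) u)\<^sup>2"
proof -
  have "R.indep_var (PiM {(i, k)} (\<lambda>_. B)) (\<lambda>x. restrict (\<lambda>q. x q) {(i, k)})
      (PiM {(i, l)} (\<lambda>_. B)) (\<lambda>x. restrict (\<lambda>q. x q) {(i, l)})"
    using assms by (intro R.indep_var_restrict[OF indep_points]) (auto simp: idx_def)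
  then have "R.indep_var borel ((\<lambda>f. u (f (i, k))) \<circ> (\<lambda>x. restrict (\<lambda>q. x q) {(i, k)}))
      borel ((\<lambda>f. u (f (i, l))) \<circ> (\<lambda>x. restrict (\<lambda>q. x q) {(i, l)}))"
    using u by (intro R.indep_var_compose)
      (auto intro!: measurable_compose[OF measurable_component_singleton])
  then have "R.indep_var borel (\<lambda>x. u (x (i, k))) borel (\<lambda>x. u (x (i, l)))"
    by (simp add: comp_def)
  then have "ER (\<lambda>x. u (x (i, k)) * u (x (i, l))) = ER (\<lambda>x. u (x (i, k))) * ER (\<lambda>x. u (x (i, l)))"
    using dep_point[OF u, of i "{i}"] assms
    by (intro R.indep_var_lebesgue_integral dep_integrable[of "{i}"]) auto
  then show ?thesis using ER_point assms by (simp add: power2_eq_square)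
qed

text \<open>This is the unbiasedness of the sample variance of independent draws: both sides are the
  variance of \<open>T w i\<close>, the factor \<open>(\<pi> i)\<^sup>2\<close> undoing the division
  by \<open>\<pi> i\<close> in \<open>y\<close>.\<close>

lemma ER_vh:
  assumes w: "wbound w b" and i: "i < N"
  shows "ER (vh w i) = (\<pi> i)\<^sup>2 * ER (\<lambda>x. (ctr (y w i) x)\<^sup>2)"
proof -
  let ?e = "integral\<^sup>L (\<mu> i) (w i)" and ?q = "integral\<^sup>L (\<mu> i) (\<lambda>z. (w i z)\<^sup>2)" and ?m = "real (m i)"
  have wm: "w i \<in> borel_measurable B" and wb: "\<And>z. \<bar>w i z\<bar> \<le> b * \<kappa> / (real N * real (m i))"
    using w i by (auto simp: wbound_def)
  have sub: "{i} \<subseteq> {..<N}" using i by auto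
  have m: "2 \<le> ?m" using m_ge_2[OF i] by simp
  have dw: "dep {i} (\<lambda>x. w i (x (i, k)))" if "k < m i" for k by (rule dep_w[OF w i that])
  have dT: "dep {i} (T w i)" by (rule dep_T[OF w i])
  have ET: "ER (T w i) = ?m * ?e"
  proof -
    have "ER (T w i) = (\<Sum>k<m i. ER (\<lambda>x. w i (x (i, k))))"
      unfolding T_def by (intro ER_sum[OF _ sub] dw) auto
    also have "\<dots> = (\<Sum>k<m i. ?e)" by (intro sum.cong refl ER_point[OF i _ wm]) auto
    finally show ?thesis by simp
  qed
  have Q: "ER (\<lambda>x. \<Sum>k<m i. (w i (x (i, k)))\<^sup>2) = ?m * ?q"
  proof -
    have "ER (\<lambda>x. \<Sum>k<m i. (w i (x (i, k)))\<^sup>2) = (\<Sum>k<m i. ER (\<lambda>x. (w i (x (i, k)))\<^sup>2))"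
      by (intro ER_sum[OF _ sub] dep_power dw) auto
    also have "\<dots> = (\<Sum>k<m i. ?q)"
      using wm by (intro sum.cong refl ER_point[OF i, of _ "\<lambda>z. (w i z)\<^sup>2"]) auto
    finally show ?thesis by simp
  qed
  have T2: "ER (\<lambda>x. (T w i x)\<^sup>2) = ?m * ?q + ?m * (?m - 1) * ?e\<^sup>2"
  proof -
    have "ER (\<lambda>x. (T w i x)\<^sup>2) = (\<Sum>k<m i. \<Sum>l<m i. ER (\<lambda>x. w i (x (i, k)) * w i (x (i, l))))"
      unfolding T_def sum_power2
      by (rule ER_sum2[where f = "\<lambda>k l x. w i (x (i, k)) * w i (x (i, l))", OF dep_mult[OF dw dw] sub]) auto
    also have "\<dots> = (\<Sum>k<m i. \<Sum>l<m i. ?e\<^sup>2 + (if k = l then ?q - ?e\<^sup>2 else 0))"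
    proof (intro sum.cong refl)
      fix k l assume kl: "k \<in> {..<m i}" "l \<in> {..<m i}"
      show "ER (\<lambda>x. w i (x (i, k)) * w i (x (i, l))) = ?e\<^sup>2 + (if k = l then ?q - ?e\<^sup>2 else 0)"
      proof (cases "k = l")
        case True
        then show ?thesis using ER_point[OF i, of k "\<lambda>z. (w i z)\<^sup>2"] wm kl by (simp add: power2_eq_square)
      next
        case False
        then show ?thesis using ER_point_mult[OF i _ _ False wm wb] kl by simp
      qed
    qed
    also have "\<dots> = ?m * ?q + ?m * (?m - 1) * ?e\<^sup>2"
      by (simp add: sum.distrib) (simp add: algebra_simps)
    finally show ?thesis .
  qed
  \<comment> \<open>The sum of squares about the mean in terms of raw moments, whose expectations
    are \<open>Q\<close> and \<open>T2\<close>.\<close>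
  have sq: "(\<Sum>k<m i. (w i (x (i, k)) - T w i x / ?m)\<^sup>2) = (\<Sum>k<m i. (w i (x (i, k)))\<^sup>2) - (1 / ?m) * (T w i x)\<^sup>2" for x
  proof -
    have "(\<Sum>k<m i. (w i (x (i, k)) - T w i x / ?m)\<^sup>2)
      = (\<Sum>k<m i. (w i (x (i, k)))\<^sup>2 - 2 * (T w i x / ?m) * w i (x (i, k)) + (T w i x / ?m)\<^sup>2)"
      by (simp add: power2_diff algebra_simps)
    also have "\<dots> = (\<Sum>k<m i. (w i (x (i, k)))\<^sup>2) - 2 * (T w i x / ?m) * T w i x + ?m * (T w i x / ?m)\<^sup>2"
      by (simp add: sum.distrib sum_subtractf T_def sum_distrib_left)
    also have "\<dots> = (\<Sum>k<m i. (w i (x (i, k)))\<^sup>2) - (1 / ?m) * (T w i x)\<^sup>2"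
      using m by (simp add: field_simps power2_eq_square)
    finally show ?thesis .
  qed
  have "ER (vh w i) = ?m / (?m - 1) * ER (\<lambda>x. (\<Sum>k<m i. (w i (x (i, k)))\<^sup>2) - (1 / ?m) * (T w i x)\<^sup>2)"
    unfolding vh_def sq by simp
  also have "ER (\<lambda>x. (\<Sum>k<m i. (w i (x (i, k)))\<^sup>2) - (1 / ?m) * (T w i x)\<^sup>2)
      = ER (\<lambda>x. \<Sum>k<m i. (w i (x (i, k)))\<^sup>2) - ER (\<lambda>x. (1 / ?m) * (T w i x)\<^sup>2)"
    by (intro ER_diff[OF _ _ sub] dep_sum dep_power dep_mult dep_const dw dT) auto
  also have "\<dots> = ?m * ?q - (?q + (?m - 1) * ?e\<^sup>2)"
    using m by (simp add: Q T2 field_simps)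
  also have "\<dots> = (?m - 1) * (?q - ?e\<^sup>2)" by (simp add: algebra_simps)
  finally have 1: "ER (vh w i) = ?m * (?q - ?e\<^sup>2)" using m by simp
  have ctr: "(ctr (y w i) x)\<^sup>2 = (1 / \<pi> i)\<^sup>2 * (((T w i x)\<^sup>2 - 2 * (?m * ?e) * T w i x) + (?m * ?e)\<^sup>2)" for x
    using pi_pos[OF i] unfolding ctr_def y_def by (simp add: ET field_simps power2_eq_square)
  have "ER (\<lambda>x. (ctr (y w i) x)\<^sup>2) = (1 / \<pi> i)\<^sup>2 * ER (\<lambda>x. ((T w i x)\<^sup>2 - 2 * (?m * ?e) * T w i x) + (?m * ?e)\<^sup>2)"
    unfolding ctr by simp
  also have "ER (\<lambda>x. ((T w i x)\<^sup>2 - 2 * (?m * ?e) * T w i x) + (?m * ?e)\<^sup>2)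
      = ER (\<lambda>x. (T w i x)\<^sup>2 - 2 * (?m * ?e) * T w i x) + (?m * ?e)\<^sup>2"
    by (subst ER_add[OF _ _ sub]) (intro dep_diff dep_power dep_mult dep_const dT | simp)+
  also have "ER (\<lambda>x. (T w i x)\<^sup>2 - 2 * (?m * ?e) * T w i x) = ER (\<lambda>x. (T w i x)\<^sup>2) - ER (\<lambda>x. 2 * (?m * ?e) * T w i x)"
    by (intro ER_diff[OF _ _ sub] dep_power dep_mult dep_const dT)
  finally have "ER (\<lambda>x. (ctr (y w i) x)\<^sup>2)
      = (1 / \<pi> i)\<^sup>2 * ((?m * ?q + ?m * (?m - 1) * ?e\<^sup>2) - 2 * (?m * ?e) * (?m * ?e) + (?m * ?e)\<^sup>2)"
    by (simp only: ET T2 integral_mult_right_zero)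
  also have "(?m * ?q + ?m * (?m - 1) * ?e\<^sup>2) - 2 * (?m * ?e) * (?m * ?e) + (?m * ?e)\<^sup>2 = ?m * (?q - ?e\<^sup>2)"
    by (simp add: algebra_simps power2_eq_square)
  finally have 2: "ER (\<lambda>x. (ctr (y w i) x)\<^sup>2) = (1 / \<pi> i)\<^sup>2 * (?m * (?q - ?e\<^sup>2))" .
  show ?thesis unfolding 1 2 using pi_pos[OF i] by (simp add: power_divide)
qed

lemma ER_y_mult:
  assumes "wbound w b" "i < N" "j < N" "i \<noteq> j"
  shows "ER (\<lambda>x. y w i x * y w j x) = ER (y w i) * ER (y w j)"
  using assms by (intro dep_uncorrelated[OF dep_y dep_y]) auto

lemma ER_y_sq:
  assumes w: "wbound w b" and i: "i < N"
  shows "ER (\<lambda>x. (y w i x)\<^sup>2) = (ER (y w i))\<^sup>2 + ER (\<lambda>x. (ctr (y w i) x)\<^sup>2)"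
proof -
  have d: "dep {i} (y w i)" and sub: "{i} \<subseteq> {..<N}" using dep_y[OF w i] i by auto
  have "ER (\<lambda>x. (ctr (y w i) x)\<^sup>2) = ER (\<lambda>x. ((y w i x)\<^sup>2 - 2 * ER (y w i) * y w i x) + (ER (y w i))\<^sup>2)"
    by (simp add: ctr_def power2_diff algebra_simps)
  also have "\<dots> = ER (\<lambda>x. (y w i x)\<^sup>2 - 2 * ER (y w i) * y w i x) + (ER (y w i))\<^sup>2"
    by (subst ER_add[OF _ _ sub]) (intro dep_diff dep_power dep_mult dep_const d | simp)+
  also have "ER (\<lambda>x. (y w i x)\<^sup>2 - 2 * ER (y w i) * y w i x) = ER (\<lambda>x. (y w i x)\<^sup>2) - ER (\<lambda>x. 2 * ER (y w i) * y w i x)"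
    by (intro ER_diff[OF _ _ sub] dep_power dep_mult dep_const d)
  finally show ?thesis by (simp add: power2_eq_square)
qed

text \<open>Here 24 * 25 = 600 and 1088 * 4 = 4352, rounded up to 4400. The bounds inserted for
  \<open>\<beta>\<close> and \<open>\<phi>\<close> are large enough for both variance
  estimators.\<close>

lemma moment_constants:
  fixes b :: real
  shows "24 * \<kappa> * n * (5 * \<kappa>^4 * b^2 / n^2)\<^sup>2 + 1088 * \<kappa>^3 * real n^3 * (2 * \<kappa>^6 * b^2 / n^3)\<^sup>2
    \<le> 5000 * \<kappa>^15 * b^4 / n^3"
proof -
  have "24 * \<kappa> * n * (5 * \<kappa>^4 * b^2 / n^2)\<^sup>2 + 1088 * \<kappa>^3 * real n^3 * (2 * \<kappa>^6 * b^2 / n^3)\<^sup>2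
    = (600 * \<kappa>^9 + 4352 * \<kappa>^15) * (b^4 / n^3)"
    using kappa_n by (simp add: field_simps eval_nat_numeral)
  also have "\<dots> \<le> (600 * \<kappa>^15 + 4400 * \<kappa>^15) * (b^4 / n^3)"
    using kappa_n by (intro mult_right_mono add_mono mult_left_mono power_increasing) auto
  finally show ?thesis by simp
qed

text \<open>For each of the two estimators this leaves a decomposition into single-PSU and pair
  terms, their bounds, and unbiasedness.\<close>

lemma second_moment_statistic:
  assumes G: "\<And>i. i < N \<Longrightarrow> dep {i} (G i)" "\<And>i x. i < N \<Longrightarrow> \<bar>G i x\<bar> \<le> 5 * \<kappa>^4 * b^2 / n^2"
    and \<Phi>: "\<And>i j. i < N \<Longrightarrow> j < N \<Longrightarrow> dep {i, j} (\<Phi> i j)"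
      "\<And>i j x. i < N \<Longrightarrow> j < N \<Longrightarrow> \<bar>\<Phi> i j x\<bar> \<le> 2 * \<kappa>^6 * b^2 / n^3" "\<And>i x. \<Phi> i i x = 0"
    and Z: "Z = (\<Sum>i<N. \<pi> i * ER (G i)) + (\<Sum>i<N. \<Sum>j<N. \<pi>2 i j * ER (\<Phi> i j))"
    and h: "\<And>s x. s \<in> samples \<Longrightarrow> h s x = (\<Sum>i\<in>s. G i x) + (\<Sum>i\<in>s. \<Sum>j\<in>s. \<Phi> i j x)"
  shows "dmean (\<lambda>s. ER (\<lambda>x. (h s x - Z)\<^sup>2)) \<le> 5000 * \<kappa>^15 * b^4 / n^3"
proof -
  have "dmean (\<lambda>s. ER (\<lambda>x. (h s x - Z)\<^sup>2))
    = dmean (\<lambda>s. ER (\<lambda>x. ((\<Sum>i\<in>s. G i x) + (\<Sum>i\<in>s. \<Sum>j\<in>s. \<Phi> i j x) - Z)\<^sup>2))"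
    by (rule dmean_cong) (simp only: h)
  also have "\<dots> \<le> 24 * \<kappa> * n * (5 * \<kappa>^4 * b^2 / n^2)\<^sup>2 + 1088 * \<kappa>^3 * real n^3 * (2 * \<kappa>^6 * b^2 / n^3)\<^sup>2"
    by (rule second_moment_general[OF G \<Phi> Z])
  also note moment_constants
  finally show ?thesis .
qed

lemma ZHT_second_moment:
  assumes w: "wbound w b"
  shows "dmean (\<lambda>s. ER (\<lambda>x. (ZHT w s x - vtot w)\<^sup>2)) \<le> 5000 * \<kappa>^15 * b^4 / n^3"
proof (rule second_moment_statistic)
  \<comment> \<open>The diagonal of the double sum depends on one PSU only and is moved to the
    single-PSU terms, where it has the larger admissible size n^-2.\<close>
  define G where "G i x = (1 - \<pi> i) * (y w i x)\<^sup>2 + vh w i x / \<pi> i" for i x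
  define \<Phi> where "\<Phi> i j x = (if i = j then 0 else \<Delta> i j / \<pi>2 i j) * (y w i x * y w j x)" for i j x
  show "dep {i} (G i)" if "i < N" for i
    unfolding G_def[abs_def] using that by (intro dep_add dep_mult dep_power dep_const dep_divide dep_y[OF w] dep_vh[OF w])
  show "\<bar>G i x\<bar> \<le> 5 * \<kappa>^4 * b^2 / n^2" if i: "i < N" for i x
  proof -
    have "\<bar>1 - \<pi> i\<bar> * (y w i x)\<^sup>2 \<le> 1 * (b * \<kappa>\<^sup>2 / n)\<^sup>2"
      using pi_bounds[of i] sq_le_of_abs_le[OF abs_y_le[OF w i]] by (intro mult_mono) auto
    then have "\<bar>G i x\<bar> \<le> (b * \<kappa>\<^sup>2 / n)\<^sup>2 + 4 * \<kappa>^3 * b^2 / n^2"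
      unfolding G_def using vh_le[OF w i, of x]
      by (intro order_trans[OF abs_triangle_ineq] add_mono) (auto simp: abs_mult)
    also have "\<dots> = (\<kappa>^4 + 4 * \<kappa>^3) * (b^2 / n^2)"
      using kappa_n by (simp add: field_simps eval_nat_numeral)
    also have "\<dots> \<le> (\<kappa>^4 + 4 * \<kappa>^4) * (b^2 / n^2)"
      using kappa_n by (intro mult_right_mono add_mono mult_left_mono power_increasing) auto
    finally show ?thesis by simp
  qed
  show "dep {i, j} (\<Phi> i j)" if "i < N" "j < N" for i j
    unfolding \<Phi>_def[abs_def]
    using dep_mono[OF dep_y[OF w that(1)], of "{i, j}"] dep_mono[OF dep_y[OF w that(2)], of "{i, j}"]
    by (intro dep_mult dep_const) auto
  show "\<bar>\<Phi> i j x\<bar> \<le> 2 * \<kappa>^6 * b^2 / n^3" if ij: "i < N" "j < N" for i j x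
  proof -
    have "\<bar>if i = j then 0 else \<Delta> i j / \<pi>2 i j\<bar> \<le> \<kappa>\<^sup>2 / n"
      using weight_le ij by auto
    then have "\<bar>\<Phi> i j x\<bar> \<le> (\<kappa>\<^sup>2 / n) * ((b * \<kappa>\<^sup>2 / n) * (b * \<kappa>\<^sup>2 / n))"
      unfolding \<Phi>_def abs_mult using abs_y_le[OF w ij(1), of x] abs_y_le[OF w ij(2), of x] wbound_nonneg[OF w]
      by (intro mult_mono) auto
    also have "\<dots> = \<kappa>^6 * b^2 / n^3" using kappa_n by (simp add: field_simps eval_nat_numeral)
    also have "\<dots> \<le> 2 * \<kappa>^6 * b^2 / n^3" using kappa_n by (intro divide_right_mono) auto
    finally show ?thesis .
  qed
  show "\<Phi> i i x = 0" for i x by (simp add: \<Phi>_def)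
  show "ZHT w s x = (\<Sum>i\<in>s. G i x) + (\<Sum>i\<in>s. \<Sum>j\<in>s. \<Phi> i j x)" if s: "s \<in> samples" for s x
  proof -
    have fin: "finite s" and sN: "\<And>i. i \<in> s \<Longrightarrow> i < N"
      using s finite_sample[OF s] by auto
    have "(\<Sum>i\<in>s. \<Sum>j\<in>s. \<Delta> i j / \<pi>2 i j * y w i x * y w j x)
      = (\<Sum>i\<in>s. \<Sum>j\<in>s. \<Phi> i j x + (if i = j then (1 - \<pi> i) * (y w i x)\<^sup>2 else 0))"
    proof (intro sum.cong refl)
      fix i j assume ij: "i \<in> s" "j \<in> s"
      show "\<Delta> i j / \<pi>2 i j * y w i x * y w j x = \<Phi> i j x + (if i = j then (1 - \<pi> i) * (y w i x)\<^sup>2 else 0)"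
      proof (cases "i = j")
        case True
        then show ?thesis using weight_same[OF sN[OF ij(1)]]
          by (simp only: \<Phi>_def power2_eq_square if_True simp_thms mult_zero_left add_0 mult.assoc)
      qed (simp add: \<Phi>_def)
    qed
    also have "\<dots> = (\<Sum>i\<in>s. \<Sum>j\<in>s. \<Phi> i j x) + (\<Sum>i\<in>s. (1 - \<pi> i) * (y w i x)\<^sup>2)"
      using fin by (simp add: sum.distrib)
    finally show ?thesis by (simp add: ZHT_def G_def sum.distrib)
  qed
  show "vtot w = (\<Sum>i<N. \<pi> i * ER (G i)) + (\<Sum>i<N. \<Sum>j<N. \<pi>2 i j * ER (\<Phi> i j))"
  proof -
    let ?t = "\<lambda>i. ER (y w i)" and ?v = "\<lambda>i. ER (\<lambda>x. (ctr (y w i) x)\<^sup>2)"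
    \<comment> \<open>The mean of \<open>(y w i x)\<^sup>2\<close> contains the second-stage
      variance. Its share \<open>1 - \<pi> i\<close> from the diagonal and the share
      \<open>\<pi> i\<close> from the within-PSU estimator add up to the variance term of
      \<open>vtot_eq\<close>.\<close>
    have EG: "\<pi> i * ER (G i) = \<pi> i * ?v i + \<Delta> i i * (?t i)\<^sup>2" if i: "i < N" for i
    proof -
      have sub: "{i} \<subseteq> {..<N}" using i by auto
      have "ER (G i) = ER (\<lambda>x. (1 - \<pi> i) * (y w i x)\<^sup>2) + ER (\<lambda>x. vh w i x / \<pi> i)"
        unfolding G_def[abs_def] using i
        by (intro ER_add[OF _ _ sub] dep_mult dep_power dep_const dep_divide dep_y[OF w] dep_vh[OF w])
      also have "\<dots> = (1 - \<pi> i) * ((?t i)\<^sup>2 + ?v i) + \<pi> i * ?v i"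
      proof -
        have "ER (\<lambda>x. vh w i x / \<pi> i) = (\<pi> i)\<^sup>2 * ?v i / \<pi> i" using ER_vh[OF w i] by simp
        also have "\<dots> = \<pi> i * ?v i" using pi_pos[OF i] by (simp add: power2_eq_square)
        finally show ?thesis by (simp add: ER_y_sq[OF w i])
      qed
      finally show ?thesis by (simp only: Delta_same) (simp add: distrib_left left_diff_distrib right_diff_distrib)
    qed
    \<comment> \<open>Off the diagonal \<open>\<pi>2\<close> cancels the denominator of the weight;
      the subtracted term restores the diagonal, whose contribution is already in
      \<open>G\<close>.\<close>
    have EP: "\<pi>2 i j * ER (\<Phi> i j) = \<Delta> i j * (?t i * ?t j) - (if i = j then \<Delta> i i * (?t i)\<^sup>2 else 0)"
      if ij: "i < N" "j < N" for i j
    proof (cases "i = j")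
      case False
      then show ?thesis using ER_y_mult[OF w ij False] pi2_pos[OF ij False] by (simp add: \<Phi>_def[abs_def])
    qed (simp add: \<Phi>_def[abs_def] power2_eq_square)
    have "(\<Sum>i<N. \<pi> i * ER (G i)) = (\<Sum>i<N. \<pi> i * ?v i) + (\<Sum>i<N. \<Delta> i i * (?t i)\<^sup>2)"
      unfolding sum.distrib[symmetric] by (intro sum.cong refl EG) auto
    moreover have "(\<Sum>i<N. \<Sum>j<N. \<pi>2 i j * ER (\<Phi> i j))
      = (\<Sum>i<N. \<Sum>j<N. \<Delta> i j * (?t i * ?t j) - (if i = j then \<Delta> i i * (?t i)\<^sup>2 else 0))"
      by (intro sum.cong refl EP) auto
    moreover have "\<dots> = (\<Sum>i<N. \<Sum>j<N. \<Delta> i j * (?t i * ?t j)) - (\<Sum>i<N. \<Delta> i i * (?t i)\<^sup>2)"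
      by (simp add: sum_subtractf)
    ultimately show ?thesis unfolding vtot_eq[OF w] by linarith
  qed
qed

text \<open>Expanding the squared differences produces pure squares as well as products. The squares
  cancel because the rows of \<open>\<Delta>\<close> sum to zero, and the products give the same
  form as for the Horvitz-Thompson estimator.\<close>

lemma ZYG_second_moment:
  assumes w: "wbound w b"
  shows "dmean (\<lambda>s. ER (\<lambda>x. (ZYG w s x - vtot w)\<^sup>2)) \<le> 5000 * \<kappa>^15 * b^4 / n^3"
proof (rule second_moment_statistic)
  define G where "G i x = vh w i x / \<pi> i" for i x
  define c where "c i j = (if i = j then 0 else - (1 / 2) * (\<Delta> i j / \<pi>2 i j))" for i j
  define \<Phi> where "\<Phi> i j x = c i j * (y w i x - y w j x)\<^sup>2" for i j x
  show "dep {i} (G i)" if "i < N" for i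
    unfolding G_def[abs_def] using that by (intro dep_divide dep_vh[OF w])
  show "\<bar>G i x\<bar> \<le> 5 * \<kappa>^4 * b^2 / n^2" if i: "i < N" for i x
  proof -
    have "\<bar>G i x\<bar> \<le> 4 * \<kappa>^3 * b^2 / n^2" unfolding G_def by (rule vh_le[OF w i])
    also have "\<dots> \<le> 5 * \<kappa>^4 * b^2 / n^2"
      using kappa_n by (intro divide_right_mono mult_right_mono mult_mono power_increasing) auto
    finally show ?thesis .
  qed
  show "dep {i, j} (\<Phi> i j)" if "i < N" "j < N" for i j
    unfolding \<Phi>_def[abs_def]
    using dep_mono[OF dep_y[OF w that(1)], of "{i, j}"] dep_mono[OF dep_y[OF w that(2)], of "{i, j}"]
    by (intro dep_mult dep_power dep_diff dep_const) auto
  show "\<bar>\<Phi> i j x\<bar> \<le> 2 * \<kappa>^6 * b^2 / n^3" if ij: "i < N" "j < N" for i j x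
  proof -
    have c: "\<bar>c i j\<bar> \<le> 1 / 2 * (\<kappa>\<^sup>2 / n)"
      using weight_le[OF ij] unfolding c_def by (auto simp: abs_mult simp del: abs_divide)
    have "\<bar>y w i x - y w j x\<bar> \<le> 2 * (b * \<kappa>\<^sup>2 / n)"
      using abs_y_le[OF w ij(1), of x] abs_y_le[OF w ij(2), of x] by linarith
    then have "\<bar>\<Phi> i j x\<bar> \<le> (1 / 2 * (\<kappa>\<^sup>2 / n)) * (2 * (b * \<kappa>\<^sup>2 / n))\<^sup>2"
      unfolding \<Phi>_def abs_mult using c sq_le_of_abs_le by (intro mult_mono) auto
    also have "\<dots> = 2 * \<kappa>^6 * b^2 / n^3" using kappa_n by (simp add: field_simps eval_nat_numeral)
    finally show ?thesis .
  qed
  show "\<Phi> i i x = 0" for i x by (simp add: \<Phi>_def)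
  show "ZYG w s x = (\<Sum>i\<in>s. G i x) + (\<Sum>i\<in>s. \<Sum>j\<in>s. \<Phi> i j x)" if s: "s \<in> samples" for s x
  proof -
    have "- (1 / 2) * (\<Sum>i\<in>s. \<Sum>j\<in>s. \<Delta> i j / \<pi>2 i j * (y w i x - y w j x)\<^sup>2) = (\<Sum>i\<in>s. \<Sum>j\<in>s. \<Phi> i j x)"
      unfolding sum_distrib_left by (intro sum.cong refl) (auto simp: \<Phi>_def c_def)
    then show ?thesis by (simp only: ZYG_eq[OF s] G_def add.commute)
  qed
  show "vtot w = (\<Sum>i<N. \<pi> i * ER (G i)) + (\<Sum>i<N. \<Sum>j<N. \<pi>2 i j * ER (\<Phi> i j))"
  proof -
    let ?t = "\<lambda>i. ER (y w i)" and ?v = "\<lambda>i. ER (\<lambda>x. (ctr (y w i) x)\<^sup>2)"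
    have EG: "\<pi> i * ER (G i) = (\<pi> i)\<^sup>2 * ?v i" if i: "i < N" for i
      using pi_pos[OF i] by (simp add: G_def[abs_def] ER_vh[OF w i] power2_eq_square)
    \<comment> \<open>The term for equal indices makes the right-hand side vanish on the diagonal,
      so that the sums can run over all pairs.\<close>
    have EP: "\<pi>2 i j * ER (\<Phi> i j) = \<Delta> i j * (?t i * ?t j) + (if i = j then \<Delta> i i * ?v i else 0)
        - (1 / 2) * (\<Delta> i j * ((?t i)\<^sup>2 + ?v i)) - (1 / 2) * (\<Delta> i j * ((?t j)\<^sup>2 + ?v j))"
      if ij: "i < N" "j < N" for i j
    proof (cases "i = j")
      case False
      have sub: "{i, j} \<subseteq> {..<N}" using ij by auto
      have d: "dep {i, j} (y w i)" "dep {i, j} (y w j)"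
        using dep_mono[OF dep_y[OF w ij(1)], of "{i, j}"] dep_mono[OF dep_y[OF w ij(2)], of "{i, j}"] by auto
      have "ER (\<lambda>x. (y w i x - y w j x)\<^sup>2) = ER (\<lambda>x. ((y w i x)\<^sup>2 + (y w j x)\<^sup>2) - 2 * (y w i x * y w j x))"
        by (simp add: power2_diff algebra_simps)
      also have "\<dots> = (ER (\<lambda>x. (y w i x)\<^sup>2) + ER (\<lambda>x. (y w j x)\<^sup>2)) - ER (\<lambda>x. 2 * (y w i x * y w j x))"
        using d by (simp add: ER_diff[OF _ _ sub] ER_add[OF _ _ sub] dep_add dep_mult dep_power dep_const del: integral_mult_right_zero)
      also have "\<dots> = (?t i)\<^sup>2 + ?v i + ((?t j)\<^sup>2 + ?v j) - 2 * (?t i * ?t j)"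
        using ER_y_mult[OF w ij False] by (simp add: ER_y_sq[OF w ij(1)] ER_y_sq[OF w ij(2)])
      finally have E: "ER (\<lambda>x. (y w i x - y w j x)\<^sup>2) = (?t i)\<^sup>2 + ?v i + ((?t j)\<^sup>2 + ?v j) - 2 * (?t i * ?t j)" .
      have "\<pi>2 i j * ER (\<Phi> i j) = - (1 / 2) * (\<Delta> i j * ER (\<lambda>x. (y w i x - y w j x)\<^sup>2))"
        using pi2_pos[OF ij False] False by (simp add: \<Phi>_def[abs_def] c_def)
      then show ?thesis unfolding E using False by (simp add: algebra_simps)
    qed (simp add: \<Phi>_def[abs_def] power2_eq_square algebra_simps)
    \<comment> \<open>Here the fixed sample size enters: terms depending on one index only are
      multiplied by a vanishing row or column sum of \<open>\<Delta>\<close>.\<close>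
    have col: "(\<Sum>i<N. \<Sum>j<N. (1 / 2) * (\<Delta> i j * f i)) = 0" for f
      unfolding sum_distrib_left[symmetric] sum_distrib_right[symmetric] sum_Delta by simp
    have row: "(\<Sum>i<N. \<Sum>j<N. (1 / 2) * (\<Delta> i j * f j)) = 0" for f
      using col[of f] unfolding sum.swap[of "\<lambda>i j. (1 / 2) * (\<Delta> i j * f j)"] by (simp only: \<Delta>_commute)
    have "(\<Sum>i<N. \<Sum>j<N. \<pi>2 i j * ER (\<Phi> i j)) = (\<Sum>i<N. \<Sum>j<N. \<Delta> i j * (?t i * ?t j) + (if i = j then \<Delta> i i * ?v i else 0)
        - (1 / 2) * (\<Delta> i j * ((?t i)\<^sup>2 + ?v i)) - (1 / 2) * (\<Delta> i j * ((?t j)\<^sup>2 + ?v j)))"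
      by (intro sum.cong refl EP) auto
    also have "\<dots> = (\<Sum>i<N. \<Sum>j<N. \<Delta> i j * (?t i * ?t j)) + (\<Sum>i<N. \<Delta> i i * ?v i)"
      unfolding sum_subtractf col row sum.distrib by simp
    finally have P: "(\<Sum>i<N. \<Sum>j<N. \<pi>2 i j * ER (\<Phi> i j)) = (\<Sum>i<N. \<Sum>j<N. \<Delta> i j * (?t i * ?t j)) + (\<Sum>i<N. \<Delta> i i * ?v i)" .
    \<comment> \<open>The diagonal left over in \<open>P\<close> completes the weight
      \<open>(\<pi> i)\<^sup>2\<close> of the second-stage variance to
      \<open>\<pi> i\<close>.\<close>
    have "(\<Sum>i<N. \<pi> i * ER (G i)) + (\<Sum>i<N. \<Delta> i i * ?v i) = (\<Sum>i<N. (\<pi> i)\<^sup>2 * ?v i + \<Delta> i i * ?v i)"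
      unfolding sum.distrib by (simp add: EG)
    also have "\<dots> = (\<Sum>i<N. \<pi> i * ?v i)"
      by (intro sum.cong refl) (simp add: Delta_same power2_eq_square algebra_simps)
    finally show ?thesis unfolding vtot_eq[OF w] P by linarith
  qed
qed

end

section \<open>Two-stage designs\<close>

text \<open>Conditioning is normalized restriction. On a null event both sides are zero, whatever
  \<open>uniform_measure\<close> means there.\<close>

lemma (in prob_space) integral_indicator_uniform_measure:
  assumes A: "A \<in> sets M" and f: "f \<in> borel_measurable M"
  shows "(LINT \<omega>|M. indicat_real A \<omega> * f \<omega>) = measure M A * (LINT \<omega>|uniform_measure M A. f \<omega>)"
proof (cases "measure M A = 0")
  case True
  then have "emeasure M A = 0" by (simp add: emeasure_eq_measure)
  then have "AE \<omega> in M. \<omega> \<notin> A" using A by (intro AE_not_in) (auto simp: null_sets_def)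
  then have "AE \<omega> in M. indicat_real A \<omega> * f \<omega> = 0" by eventually_elim simp
  then show ?thesis using True by (simp add: integral_eq_zero_AE)
next
  case False
  have "uniform_measure M A = density M (\<lambda>\<omega>. ennreal (indicat_real A \<omega> / measure M A))"
    unfolding uniform_measure_def
  proof (rule density_cong)
    show "(\<lambda>\<omega>. indicator A \<omega> / emeasure M A) \<in> borel_measurable M"
      "(\<lambda>\<omega>. ennreal (indicat_real A \<omega> / measure M A)) \<in> borel_measurable M"
      using A by measurable
    have "1 / ennreal (measure M A) = ennreal (1 / measure M A)"
      using False divide_ennreal[of 1 "measure M A"] by (simp add: zero_less_measure_iff)
    then show "AE \<omega> in M. indicator A \<omega> / emeasure M A = ennreal (indicat_real A \<omega> / measure M A)"
      by (intro AE_I2) (auto simp: emeasure_eq_measure indicator_def)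
  qed
  then have "(LINT \<omega>|uniform_measure M A. f \<omega>) = (LINT \<omega>|M. (indicat_real A \<omega> / measure M A) *\<^sub>R f \<omega>)"
    using A f by (simp add: integral_density)
  also have "\<dots> = (LINT \<omega>|M. (1 / measure M A) * (indicat_real A \<omega> * f \<omega>))"
    by simp
  finally show ?thesis using False by simp
qed

lemma set_integrable_bounded_lmeasurable:
  fixes r :: "'a::euclidean_space \<Rightarrow> 'b::euclidean_space"
  assumes F: "F \<in> lmeasurable" and r: "r \<in> borel_measurable (lebesgue_on F)" and b: "\<And>z. z \<in> F \<Longrightarrow> norm (r z) \<le> b"
  shows "set_integrable lebesgue F r"
  unfolding set_integrable_def
proof (rule integrableI_bounded_set[where A = F and B = b])
  show "F \<in> sets lebesgue" "emeasure lebesgue F < \<infinity>" using F by (auto simp: fmeasurable_def)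
  have "(\<lambda>z. if z \<in> F then r z else 0) \<in> borel_measurable lebesgue"
    using r F by (subst borel_measurable_if) (auto simp: fmeasurableD)
  also have "(\<lambda>z. if z \<in> F then r z else 0) = (\<lambda>z. indicat_real F z *\<^sub>R r z)" by (auto simp: fun_eq_iff)
  finally show "(\<lambda>z. indicat_real F z *\<^sub>R r z) \<in> borel_measurable lebesgue" .
qed (use b in \<open>auto intro!: AE_I2\<close>)

text \<open>One member of the sequence of designs. The conditions on areas and densities are merged
  into a density comparable to the number of PSUs.\<close>

locale regular_survey =
  fixes F :: "'a::euclidean_space set" and D :: "('w, 'a) two_stage_design" and \<kappa> :: real
  assumes sampling: "two_stage_sampling F D" and F: "F \<in> lmeasurable"
    and \<kappa>: "1 \<le> \<kappa>" and N: "0 < N_I D" and n: "0 < n_I D"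
    and pi_le: "\<And>i. i < N_I D \<Longrightarrow> pi_I D i \<le> \<kappa> * n_I D / N_I D"
    and pi_ge: "\<And>i. i < N_I D \<Longrightarrow> n_I D / N_I D \<le> \<kappa> * pi_I D i"
    and pi2_ge: "\<And>i j. i < N_I D \<Longrightarrow> j < N_I D \<Longrightarrow> i \<noteq> j \<Longrightarrow> (n_I D)\<^sup>2 / (N_I D)\<^sup>2 \<le> \<kappa> * pi_I2 D i j"
    and cm2: "\<And>J. J \<subseteq> {..<N_I D} \<Longrightarrow> card J = 2 \<Longrightarrow> \<bar>central_moment D J\<bar> \<le> \<kappa> * n_I D / N_I D ^ 2"
    and cm3: "\<And>J. J \<subseteq> {..<N_I D} \<Longrightarrow> card J = 3 \<Longrightarrow> \<bar>central_moment D J\<bar> \<le> \<kappa> * n_I D ^ 2 / N_I D ^ 3"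
    and cm4: "\<And>J. J \<subseteq> {..<N_I D} \<Longrightarrow> card J = 4 \<Longrightarrow> \<bar>central_moment D J\<bar> \<le> \<kappa> * n_I D ^ 2 / N_I D ^ 4"
    and n_II_ge: "\<And>i. i < N_I D \<Longrightarrow> 2 \<le> n_II D i"
    and dens_ge: "\<And>i x. i < N_I D \<Longrightarrow> x \<in> psu D i \<Longrightarrow> N_I D \<le> \<kappa> * dens D i x"
    and dens_le: "\<And>i x. i < N_I D \<Longrightarrow> x \<in> psu D i \<Longrightarrow> dens D i x \<le> \<kappa> * N_I D"
begin

abbreviation M where "M \<equiv> pspace D"

definition p :: "nat set \<Rightarrow> real" where
  "p s = measure M (fst_event D s)"

text \<open>The product model asks for a probability measure at every index; the point mass is a
  filler outside the range of PSUs.\<close>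

definition \<mu> :: "nat \<Rightarrow> 'a measure" where
  "\<mu> i = (if i < N_I D then density lebesgue (dens D i) else return lebesgue 0)"

definition pt :: "'w \<Rightarrow> nat \<times> nat \<Rightarrow> 'a" where
  "pt \<omega> = (\<lambda>(i, k). point D i k \<omega>)"

sublocale M: prob_space M
  using sampling by (simp add: two_stage_sampling_def first_stage_def)

lemma fst_sample_measurable:
  "fst_sample D \<in> measurable M (count_space {s. s \<subseteq> {..<N_I D} \<and> card s = n_I D})"
  using sampling by (simp add: two_stage_sampling_def first_stage_def)

lemma fst_sample_in: "\<omega> \<in> space M \<Longrightarrow> fst_sample D \<omega> \<subseteq> {..<N_I D} \<and> card (fst_sample D \<omega>) = n_I D"
  using measurable_space[OF fst_sample_measurable] by simp

lemma fst_event_sets [measurable]: "s \<subseteq> {..<N_I D} \<and> card s = n_I D \<Longrightarrow> fst_event D s \<in> sets M"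
proof -
  assume "s \<subseteq> {..<N_I D} \<and> card s = n_I D"
  then have "fst_sample D -` {s} \<inter> space M \<in> sets M"
    using measurable_sets[OF fst_sample_measurable, of "{s}"] by simp
  also have "fst_sample D -` {s} \<inter> space M = fst_event D s" by (auto simp: fst_event_def)
  finally show ?thesis .
qed

lemma finite_all_samples: "finite {s. s \<subseteq> {..<N_I D} \<and> card s = n_I D}"
  by (rule finite_subset[of _ "Pow {..<N_I D}"]) auto

text \<open>The events of the possible samples form a finite partition, which turns a random sample
  into a finite sum over fixed ones.\<close>

lemma sample_decomp:
  assumes "\<omega> \<in> space M"
  shows "h (fst_sample D \<omega>) = (\<Sum>s | s \<subseteq> {..<N_I D} \<and> card s = n_I D. indicat_real (fst_event D s) \<omega> * h s)"
proof -
  have "(\<Sum>s | s \<subseteq> {..<N_I D} \<and> card s = n_I D. indicat_real (fst_event D s) \<omega> * h s)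
    = (\<Sum>s | s \<subseteq> {..<N_I D} \<and> card s = n_I D. if s = fst_sample D \<omega> then h s else 0)"
    using assms by (intro sum.cong) (auto simp: fst_event_def indicator_def)
  then show ?thesis using finite_all_samples fst_sample_in[OF assms] by simp
qed

lemma expectation_sample:
  "(LINT \<omega>|M. h (fst_sample D \<omega>)) = (\<Sum>s | s \<subseteq> {..<N_I D} \<and> card s = n_I D. p s * h s)"
proof -
  have "(LINT \<omega>|M. h (fst_sample D \<omega>))
    = (LINT \<omega>|M. (\<Sum>s | s \<subseteq> {..<N_I D} \<and> card s = n_I D. indicat_real (fst_event D s) \<omega> * h s))"
    by (intro Bochner_Integration.integral_cong refl sample_decomp)
  also have "\<dots> = (\<Sum>s | s \<subseteq> {..<N_I D} \<and> card s = n_I D. LINT \<omega>|M. indicat_real (fst_event D s) \<omega> * h s)"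
    by (intro Bochner_Integration.integral_sum integrable_mult_left)
      (auto intro!: integrable_real_indicator simp: fst_event_sets M.emeasure_eq_measure)
  also have "\<dots> = (\<Sum>s | s \<subseteq> {..<N_I D} \<and> card s = n_I D. p s * h s)"
    by (intro sum.cong refl) (auto simp: p_def fst_event_sets)
  finally show ?thesis .
qed

sublocale S: finite_design "N_I D" "n_I D" p
proof
  show "0 \<le> p s" for s by (simp add: p_def)
  show "(\<Sum>s | s \<subseteq> {..<N_I D} \<and> card s = n_I D. p s) = 1"
    using expectation_sample[of "\<lambda>_. 1"] by (simp add: M.prob_space)
qed

lemma expectation_sample': "(LINT \<omega>|M. h (fst_sample D \<omega>)) = S.dmean h"
  by (simp add: expectation_sample S.dmean_def)

lemma pi_eq: "S.\<pi> = pi_I D"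
  by (auto simp: S.\<pi>_def pi_I_def incl_def expectation_sample'[symmetric] fun_eq_iff)

lemma pi2_eq: "S.\<pi>2 = pi_I2 D"
  by (auto simp: S.\<pi>2_def pi_I2_def incl_def expectation_sample'[symmetric] fun_eq_iff)

lemma Delta_eq: "S.\<Delta> = Delta_I D"
  by (auto simp: S.\<Delta>_def Delta_I_def pi_eq pi2_eq fun_eq_iff)

lemma central_moment_eq: "S.dmean (\<lambda>s. \<Prod>i\<in>J. S.ci s i) = central_moment D J"
  by (simp add: central_moment_def incl_def S.ci_def expectation_sample'[symmetric] pi_eq)

lemma second: "second_stage D" and partition: "partition_of F D"
  using sampling by (auto simp: two_stage_sampling_def)

lemma psu_subset: "i < N_I D \<Longrightarrow> psu D i \<subseteq> F"
  using partition by (auto simp: partition_of_def)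

lemma dens_zero: "i < N_I D \<Longrightarrow> x \<notin> psu D i \<Longrightarrow> dens D i x = 0"
  using second by (auto simp: second_stage_def)

lemma dens_pos: "i < N_I D \<Longrightarrow> x \<in> psu D i \<Longrightarrow> 0 < dens D i x"
  using dens_ge[of i x] \<kappa> N by (smt (verit) mult_nonneg_nonpos of_nat_0_less_iff)

lemma dens_nonneg: "i < N_I D \<Longrightarrow> 0 \<le> dens D i x"
  using second by (auto simp: second_stage_def)

lemma dens_measurable: "i < N_I D \<Longrightarrow> dens D i \<in> borel_measurable lebesgue"
  using second by (auto simp: second_stage_def)

lemma prob_space_\<mu>: "prob_space (\<mu> i)"
proof (cases "i < N_I D")
  case True
  then have "(\<integral>\<^sup>+x. ennreal (dens D i x) \<partial>lebesgue) = 1"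
    using second by (auto simp: second_stage_def)
  then show ?thesis
    using True dens_measurable[OF True] by (intro prob_spaceI) (simp add: \<mu>_def emeasure_density cong: nn_integral_cong)
qed (auto simp: \<mu>_def intro: prob_space_return)

sublocale S: two_stage "N_I D" "n_I D" p \<kappa> "n_II D" \<mu> lebesgue
proof (intro two_stage.intro regular_finite_design.intro S.finite_design_axioms
    regular_finite_design_axioms.intro two_stage_axioms.intro)
  show "1 \<le> \<kappa>" "0 < N_I D" "0 < n_I D" by (rule \<kappa>, rule N, rule n)
  show "S.\<pi> i \<le> \<kappa> * n_I D / N_I D" if "i < N_I D" for i using pi_le that by (simp add: pi_eq)
  show "n_I D / N_I D \<le> \<kappa> * S.\<pi> i" if "i < N_I D" for i using pi_ge that by (simp add: pi_eq)
  show "(n_I D)\<^sup>2 / (N_I D)\<^sup>2 \<le> \<kappa> * S.\<pi>2 i j" if "i < N_I D" "j < N_I D" "i \<noteq> j" for i j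
    using pi2_ge that by (simp add: pi2_eq)
  show "\<bar>S.dmean (\<lambda>s. \<Prod>i\<in>J. S.ci s i)\<bar> \<le> \<kappa> * n_I D / N_I D ^ 2" if "J \<subseteq> {..<N_I D}" "card J = 2" for J
    using cm2 that by (simp add: central_moment_eq)
  show "\<bar>S.dmean (\<lambda>s. \<Prod>i\<in>J. S.ci s i)\<bar> \<le> \<kappa> * n_I D ^ 2 / N_I D ^ 3" if "J \<subseteq> {..<N_I D}" "card J = 3" for J
    using cm3 that by (simp add: central_moment_eq)
  show "\<bar>S.dmean (\<lambda>s. \<Prod>i\<in>J. S.ci s i)\<bar> \<le> \<kappa> * n_I D ^ 2 / N_I D ^ 4" if "J \<subseteq> {..<N_I D}" "card J = 4" for J
    using cm4 that by (simp add: central_moment_eq)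
  show "prob_space (\<mu> i)" for i by (rule prob_space_\<mu>)
  show "sets (\<mu> i) = sets lebesgue" for i by (simp add: \<mu>_def)
  show "2 \<le> n_II D i" if "i < N_I D" for i by (rule n_II_ge[OF that])
qed

lemma point_measurable: "q \<in> S.idx {..<N_I D} \<Longrightarrow> (\<lambda>\<omega>. pt \<omega> q) \<in> measurable M lebesgue"
  using second by (auto simp: second_stage_def S.idx_def pt_def)

lemma pt_measurable:
  assumes "s \<subseteq> {..<N_I D}"
  shows "(\<lambda>\<omega>. restrict (pt \<omega>) (S.idx s)) \<in> measurable M (PiM (S.idx s) (\<lambda>_. lebesgue))"
  using S.idx_mono[OF assms] by (intro measurable_restrict point_measurable) auto

lemma dep_pt_measurable:
  assumes "S.dep s f" "s \<subseteq> {..<N_I D}"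
  shows "(\<lambda>\<omega>. f (pt \<omega>)) \<in> borel_measurable M"
  using measurable_compose[OF pt_measurable[OF assms(2)], of f borel] assms(1) by (simp add: S.dep_def)

text \<open>Given that \<open>s\<close> is selected, the points of its PSUs have the product law by
  the second-stage assumption, and the marginal of \<open>R\<close> on these coordinates is the same
  product. The coordinates outside \<open>s\<close>, about which the design says nothing, do not
  affect \<open>f\<close>.\<close>

lemma conditional_expectation:
  assumes f: "S.dep s f" and s: "s \<subseteq> {..<N_I D}" "card s = n_I D" and pos: "0 < p s"
  shows "(LINT \<omega>|uniform_measure M (fst_event D s). f (pt \<omega>)) = S.ER f"
proof -
  let ?Q = "uniform_measure M (fst_event D s)" and ?I = "S.idx s"
  have em: "emeasure M (fst_event D s) > 0"
    using pos by (simp add: p_def M.emeasure_eq_measure)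
  interpret Q: prob_space ?Q
    using em by (intro prob_space_uniform_measure) (auto simp: M.emeasure_eq_measure)
  have fI: "f \<in> borel_measurable (PiM ?I (\<lambda>_. lebesgue))" and fr: "\<And>x. f (restrict x ?I) = f x"
    using f by (auto simp: S.dep_def)
  \<comment> \<open>The characterization of independence by the joint law is stated for nonempty
    index sets.\<close>
  have "s \<noteq> {}" using s n by auto
  then obtain i where i: "i \<in> s" by auto
  then have "(i, 0) \<in> ?I" using n_II_ge[of i] s by (auto simp: S.idx_def)
  then have ne: "?I \<noteq> {}" by auto
  have meas: "(\<lambda>\<omega>. pt \<omega> q) \<in> measurable ?Q lebesgue" if "q \<in> ?I" for q
    using point_measurable[of q] S.idx_mono[OF s(1)] that 
    by (auto simp: measurable_cong_sets[OF sets_uniform_measure refl])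
  have "Q.indep_vars (\<lambda>_. lebesgue) (\<lambda>q \<omega>. pt \<omega> q) ?I"
    using second em by (auto simp: second_stage_def S.idx_def pt_def case_prod_beta' split_def)
  then have "distr ?Q (PiM ?I (\<lambda>_. lebesgue)) (\<lambda>\<omega>. restrict (pt \<omega>) ?I) = PiM ?I (\<lambda>q. distr ?Q lebesgue (\<lambda>\<omega>. pt \<omega> q))"
    using Q.indep_vars_iff_distr_eq_PiM'[OF ne meas] by simp
  also have "\<dots> = PiM ?I (\<lambda>q. \<mu> (fst q))"
  proof (rule PiM_cong[OF refl])
    fix q assume q: "q \<in> ?I"
    then obtain i k where ik: "q = (i, k)" "i \<in> s" "k < n_II D i" by (auto simp: S.idx_def)
    have "distributed ?Q lebesgue (point D i k) (\<lambda>x. ennreal (dens D i x))"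
      using second em ik by (auto simp: second_stage_def)
    then have "distr ?Q lebesgue (point D i k) = density lebesgue (\<lambda>x. ennreal (dens D i x))"
      by (rule distributed_distr_eq_density)
    then show "distr ?Q lebesgue (\<lambda>\<omega>. pt \<omega> q) = \<mu> (fst q)"
      using ik s by (auto simp: pt_def \<mu>_def)
  qed
  also have "\<dots> = distr S.R (PiM ?I (\<lambda>q. \<mu> (fst q))) (\<lambda>x. restrict x ?I)"
    unfolding S.R_def using S.idx_mono[OF s(1)] by (intro S.points.distr_restrict S.finite_idx) auto
  also have "\<dots> = distr S.R (PiM ?I (\<lambda>_. lebesgue)) (\<lambda>x. restrict x ?I)"
    by (intro distr_cong refl S.sets_PiM_\<mu>)
  finally have eq: "distr ?Q (PiM ?I (\<lambda>_. lebesgue)) (\<lambda>\<omega>. restrict (pt \<omega>) ?I)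
    = distr S.R (PiM ?I (\<lambda>_. lebesgue)) (\<lambda>x. restrict x ?I)" .
  have "(LINT \<omega>|?Q. f (restrict (pt \<omega>) ?I)) = integral\<^sup>L (distr ?Q (PiM ?I (\<lambda>_. lebesgue)) (\<lambda>\<omega>. restrict (pt \<omega>) ?I)) f"
    using pt_measurable[OF s(1)] by (intro integral_distr[symmetric] fI) (simp only: measurable_cong_sets[OF sets_uniform_measure refl])
  also have "\<dots> = S.ER (\<lambda>x. f (restrict x ?I))"
    unfolding eq by (intro integral_distr fI S.measurable_R_restrict s)
  finally show ?thesis by (simp only: fr)
qed

lemma statistic_measurable:
  fixes f :: "nat set \<Rightarrow> (nat \<times> nat \<Rightarrow> 'a) \<Rightarrow> real"
  assumes "\<And>s. s \<subseteq> {..<N_I D} \<Longrightarrow> card s = n_I D \<Longrightarrow> S.dep s (f s)"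
  shows "(\<lambda>\<omega>. f (fst_sample D \<omega>) (pt \<omega>)) \<in> borel_measurable M"
proof -
  have "(\<lambda>\<omega>. \<Sum>s | s \<subseteq> {..<N_I D} \<and> card s = n_I D. indicat_real (fst_event D s) \<omega> * f s (pt \<omega>)) \<in> borel_measurable M"
    by (intro borel_measurable_sum borel_measurable_times borel_measurable_indicator fst_event_sets dep_pt_measurable) (auto intro: assms)
  then show ?thesis
    using measurable_cong[of M "\<lambda>\<omega>. f (fst_sample D \<omega>) (pt \<omega>)"] sample_decomp[of _ "\<lambda>s. f s (pt _)"] by simp
qed

lemma statistic_bounded:
  assumes "\<And>s. s \<subseteq> {..<N_I D} \<Longrightarrow> card s = n_I D \<Longrightarrow> S.dep s (f s)"
  shows "\<exists>b. \<forall>\<omega>\<in>space M. \<bar>f (fst_sample D \<omega>) (pt \<omega>)\<bar> \<le> b"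
proof -
  have "\<forall>s\<in>{s. s \<subseteq> {..<N_I D} \<and> card s = n_I D}. \<exists>b. \<forall>x. \<bar>f s x\<bar> \<le> b"
    using assms by (auto simp: S.dep_def)
  then obtain b where b: "\<And>s x. s \<subseteq> {..<N_I D} \<Longrightarrow> card s = n_I D \<Longrightarrow> \<bar>f s x\<bar> \<le> b s"
    unfolding bchoice_iff by blast
  let ?b = "Max (b ` {s. s \<subseteq> {..<N_I D} \<and> card s = n_I D})"
  have "\<bar>f (fst_sample D \<omega>) (pt \<omega>)\<bar> \<le> ?b" if "\<omega> \<in> space M" for \<omega>
  proof -
    have "\<bar>f (fst_sample D \<omega>) (pt \<omega>)\<bar> \<le> b (fst_sample D \<omega>)" using b fst_sample_in[OF that] by blast
    also have "\<dots> \<le> ?b" using fst_sample_in[OF that] finite_all_samples by (intro Max_ge) auto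
    finally show ?thesis .
  qed
  then show ?thesis by blast
qed

lemma statistic_integrable:
  fixes f :: "nat set \<Rightarrow> (nat \<times> nat \<Rightarrow> 'a) \<Rightarrow> real"
  assumes "\<And>s. s \<subseteq> {..<N_I D} \<Longrightarrow> card s = n_I D \<Longrightarrow> S.dep s (f s)"
  shows "integrable M (\<lambda>\<omega>. f (fst_sample D \<omega>) (pt \<omega>))"
proof -
  obtain b where b: "\<And>\<omega>. \<omega> \<in> space M \<Longrightarrow> \<bar>f (fst_sample D \<omega>) (pt \<omega>)\<bar> \<le> b"
    using statistic_bounded[of f, OF assms] by blast
  show ?thesis
    by (rule M.integrable_const_bound[where B = b, OF _ statistic_measurable[of f, OF assms]])
      (auto intro!: AE_I2 b)
qed

text \<open>The bridge from the survey to the product model: the expectation is split over the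
  first-stage samples, and each part is a conditional expectation times \<open>p s\<close>. Samples
  of probability zero contribute nothing.\<close>

lemma expectation_statistic:
  fixes f :: "nat set \<Rightarrow> (nat \<times> nat \<Rightarrow> 'a) \<Rightarrow> real"
  assumes f: "\<And>s. s \<subseteq> {..<N_I D} \<Longrightarrow> card s = n_I D \<Longrightarrow> S.dep s (f s)"
  shows "(LINT \<omega>|M. f (fst_sample D \<omega>) (pt \<omega>)) = S.dmean (\<lambda>s. S.ER (f s))"
proof -
  have int: "integrable M (\<lambda>\<omega>. indicat_real (fst_event D s) \<omega> * f s (pt \<omega>))"
    if s: "s \<subseteq> {..<N_I D}" "card s = n_I D" for s
  proof -
    obtain b where b: "\<And>x. \<bar>f s x\<bar> \<le> b" using f[OF s] by (auto simp: S.dep_def)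
    show ?thesis
    proof (rule M.integrable_const_bound[where B = b])
      show "AE \<omega> in M. norm (indicat_real (fst_event D s) \<omega> * f s (pt \<omega>)) \<le> b"
        using b order_trans[OF abs_ge_zero b] by (auto simp: indicator_def intro!: AE_I2)
      show "(\<lambda>\<omega>. indicat_real (fst_event D s) \<omega> * f s (pt \<omega>)) \<in> borel_measurable M"
        using s by (intro borel_measurable_times borel_measurable_indicator fst_event_sets dep_pt_measurable[OF f]) auto
    qed
  qed
  have "(LINT \<omega>|M. f (fst_sample D \<omega>) (pt \<omega>))
    = (LINT \<omega>|M. (\<Sum>s | s \<subseteq> {..<N_I D} \<and> card s = n_I D. indicat_real (fst_event D s) \<omega> * f s (pt \<omega>)))"
    by (intro Bochner_Integration.integral_cong refl sample_decomp)
  also have "\<dots> = (\<Sum>s | s \<subseteq> {..<N_I D} \<and> card s = n_I D. LINT \<omega>|M. indicat_real (fst_event D s) \<omega> * f s (pt \<omega>))"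
    by (intro Bochner_Integration.integral_sum int) auto
  also have "\<dots> = S.dmean (\<lambda>s. S.ER (f s))"
    unfolding S.dmean_def
  proof (intro sum.cong refl)
    fix s assume "s \<in> {s. s \<subseteq> {..<N_I D} \<and> card s = n_I D}"
    then have s: "s \<subseteq> {..<N_I D}" "card s = n_I D" by auto
    have "(LINT \<omega>|M. indicat_real (fst_event D s) \<omega> * f s (pt \<omega>))
      = p s * (LINT \<omega>|uniform_measure M (fst_event D s). f s (pt \<omega>))"
      unfolding p_def using s by (intro M.integral_indicator_uniform_measure fst_event_sets dep_pt_measurable[OF f[OF s] s(1)]) auto
    also have "\<dots> = p s * S.ER (f s)"
      using conditional_expectation[OF f[OF s] s] S.p_nonneg[of s] by (cases "p s = 0") auto
    finally show "(LINT \<omega>|M. indicat_real (fst_event D s) \<omega> * f s (pt \<omega>)) = p s * S.ER (f s)" .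
  qed
  finally show ?thesis .
qed

end

section \<open>Estimators of the survey as statistics of the product model\<close>

context two_stage
begin

lemma dep_HTs:
  assumes w: "wbound w b" and s: "s \<in> samples"
  shows "dep s (HTs w s)"
  unfolding HTs_def using s by (intro dep_sum dep_mono[OF dep_y[OF w]]) auto

lemma dep_ZHT:
  assumes w: "wbound w b" and s: "s \<in> samples"
  shows "dep s (ZHT w s)"
proof -
  have "dep s (y w i)" "dep s (vh w i)" if "i \<in> s" for i
  proof -
    have i: "i < N" "{i} \<subseteq> s" using s that by auto
    show "dep s (y w i)" by (rule dep_mono[OF dep_y[OF w i(1)] i(2)])
    show "dep s (vh w i)" by (rule dep_mono[OF dep_vh[OF w i(1)] i(2)])
  qed
  then show ?thesis unfolding ZHT_def by (intro dep_add dep_sum dep_mult dep_const dep_divide) auto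
qed

lemma dep_ZYG:
  assumes w: "wbound w b" and s: "s \<in> samples"
  shows "dep s (ZYG w s)"
proof -
  have "dep s (y w i)" "dep s (vh w i)" if "i \<in> s" for i
  proof -
    have i: "i < N" "{i} \<subseteq> s" using s that by auto
    show "dep s (y w i)" by (rule dep_mono[OF dep_y[OF w i(1)] i(2)])
    show "dep s (vh w i)" by (rule dep_mono[OF dep_vh[OF w i(1)] i(2)])
  qed
  then show ?thesis unfolding ZYG_def by (intro dep_add dep_sum dep_mult dep_power dep_diff dep_const dep_divide) auto
qed

end

context regular_survey
begin

text \<open>Outside the PSU the density is 0 and, as division by zero gives 0, so is the
  weight.\<close>

definition wr :: "('a \<Rightarrow> real) \<Rightarrow> nat \<Rightarrow> 'a \<Rightarrow> real" where
  "wr r i z = r z / pi_II D i z"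

lemma psu_sets: "i < N_I D \<Longrightarrow> psu D i \<in> sets lebesgue"
  using partition by (auto simp: partition_of_def)

lemma wr_outside: "i < N_I D \<Longrightarrow> z \<notin> psu D i \<Longrightarrow> wr r i z = 0"
  by (simp add: wr_def pi_II_def dens_zero)

lemma wr_measurable:
  assumes r: "r \<in> borel_measurable (lebesgue_on F)" and i: "i < N_I D"
  shows "wr r i \<in> borel_measurable lebesgue"
proof -
  \<comment> \<open>\<open>r\<close> is measurable on \<open>F\<close> only. Its extension by zero
    gives the same weights, which vanish off the PSU anyway.\<close>
  have "(\<lambda>z. if z \<in> F then r z else 0) \<in> borel_measurable lebesgue"
    using r F by (subst borel_measurable_if) (auto simp: fmeasurableD)
  then have "(\<lambda>z. (if z \<in> F then r z else 0) / pi_II D i z) \<in> borel_measurable lebesgue"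
    unfolding pi_II_def using dens_measurable[OF i] by (intro borel_measurable_divide borel_measurable_times borel_measurable_const)
  also have "(\<lambda>z. (if z \<in> F then r z else 0) / pi_II D i z) = wr r i"
    using wr_outside[OF i] psu_subset[OF i] by (auto simp: wr_def fun_eq_iff)
  finally show ?thesis .
qed

lemma wbound_wr:
  assumes r: "r \<in> borel_measurable (lebesgue_on F)" and b: "0 \<le> b" "\<And>z. z \<in> F \<Longrightarrow> \<bar>r z\<bar> \<le> b"
  shows "S.wbound (wr r) b"
  unfolding S.wbound_def
proof (intro conjI allI impI b(1) wr_measurable[OF r])
  fix i z assume i: "i < N_I D"
  show "\<bar>wr r i z\<bar> \<le> b * \<kappa> / (real (N_I D) * real (n_II D i))"
  proof (cases "z \<in> psu D i")
    case True
    have m: "0 < real (n_II D i)" using n_II_ge[OF i] by simp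
    have d: "0 < dens D i z" using dens_pos[OF i True] .
    have "1 / dens D i z \<le> \<kappa> / N_I D"
      using dens_ge[OF i True] d N by (simp add: field_simps)
    then have "\<bar>r z\<bar> * (1 / dens D i z) \<le> b * (\<kappa> / N_I D)"
      using b(2)[of z] psu_subset[OF i] True d b(1) by (intro mult_mono) auto
    then have "\<bar>r z\<bar> * (1 / dens D i z) / n_II D i \<le> b * (\<kappa> / N_I D) / n_II D i"
      using m by (intro divide_right_mono) auto
    then show ?thesis using d m by (simp add: wr_def pi_II_def field_simps)
  next
    case False
    then show ?thesis using b \<kappa> by (simp add: wr_outside[OF i])
  qed
qed

lemma HT_psu_eq: "HT_psu D r i \<omega> = S.T (wr r) i (pt \<omega>)"
  by (simp add: HT_psu_def S.T_def wr_def pt_def divide_inverse mult.commute)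

lemma HT_eq: "HT D r \<omega> = S.HTs (wr r) (fst_sample D \<omega>) (pt \<omega>)"
  by (simp add: HT_def S.HTs_def S.y_def HT_psu_eq pi_eq divide_inverse mult.commute)

lemma V_psu_eq: "V_psu D r i \<omega> = S.vh (wr r) i (pt \<omega>)"
  by (simp add: V_psu_def S.vh_def HT_psu_eq wr_def pt_def)

lemma V_HT_eq: "V_HT D r \<omega> = S.ZHT (wr r) (fst_sample D \<omega>) (pt \<omega>)"
  by (simp add: V_HT_def S.ZHT_def S.y_def HT_psu_eq V_psu_eq pi_eq pi2_eq Delta_eq)

lemma V_YG_eq: "V_YG D r \<omega> = S.ZYG (wr r) (fst_sample D \<omega>) (pt \<omega>)"
  by (simp add: V_YG_def S.ZYG_def S.y_def HT_psu_eq V_psu_eq pi_eq pi2_eq Delta_eq)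

lemma integral_\<mu>:
  assumes i: "i < N_I D" and u: "u \<in> borel_measurable lebesgue"
  shows "integral\<^sup>L (\<mu> i) u = (LINT z|lebesgue. dens D i z * u z)"
  using i u dens_measurable[OF i] dens_nonneg[OF i]
  by (simp add: \<mu>_def integral_density)

text \<open>The density of a draw cancels against the denominator of its weight, and the number of
  draws against the factor in \<open>pi_II\<close>.\<close>

lemma ER_T_wr:
  assumes r: "r \<in> borel_measurable (lebesgue_on F)" and b: "0 \<le> b" "\<And>z. z \<in> F \<Longrightarrow> \<bar>r z\<bar> \<le> b" and i: "i < N_I D"
  shows "S.ER (S.T (wr r) i) = (LINT z:psu D i|lebesgue. r z)"
proof -
  note w = wbound_wr[OF r b]
  have m: "0 < real (n_II D i)" using n_II_ge[OF i] by simp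
  have "S.ER (S.T (wr r) i) = (\<Sum>k<n_II D i. S.ER (\<lambda>x. wr r i (x (i, k))))"
    unfolding S.T_def[abs_def] using i by (intro S.ER_sum[of _ "{i}"] S.dep_w[OF w]) auto
  also have "\<dots> = (\<Sum>k<n_II D i. integral\<^sup>L (\<mu> i) (wr r i))"
    using wr_measurable[OF r i] by (intro sum.cong refl S.ER_point i) auto
  also have "\<dots> = (LINT z|lebesgue. n_II D i * (dens D i z * wr r i z))"
    by (simp add: integral_\<mu>[OF i wr_measurable[OF r i]])
  also have "\<dots> = (LINT z:psu D i|lebesgue. r z)"
    unfolding set_lebesgue_integral_def
  proof (intro Bochner_Integration.integral_cong refl)
    fix z
    show "n_II D i * (dens D i z * wr r i z) = indicat_real (psu D i) z *\<^sub>R r z"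
      using m dens_pos[OF i, of z] wr_outside[OF i, of z] by (cases "z \<in> psu D i") (auto simp: wr_def pi_II_def)
  qed
  finally show ?thesis .
qed

lemma tau_eq:
  assumes r: "r \<in> borel_measurable (lebesgue_on F)" and b: "0 \<le> b" "\<And>z. z \<in> F \<Longrightarrow> \<bar>r z\<bar> \<le> b"
  shows "S.tau (wr r) = total F r"
proof -
  have "S.tau (wr r) = (\<Sum>i<N_I D. LINT z:psu D i|lebesgue. r z)"
    unfolding S.tau_def
  proof (intro sum.cong refl)
    fix i assume "i \<in> {..<N_I D}"
    then have i: "i < N_I D" by simp
    show "S.\<pi> i * S.ER (S.y (wr r) i) = (LINT z:psu D i|lebesgue. r z)"
      using S.pi_pos[OF i] ER_T_wr[OF r b i] by (simp add: S.y_def[abs_def])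
  qed
  also have "\<dots> = (LINT z:(\<Union>i<N_I D. psu D i)|lebesgue. r z)"
  proof (rule set_integral_finite_Union[symmetric])
    show "disjoint_family_on (psu D) {..<N_I D}" using partition by (simp add: partition_of_def)
    show "set_integrable lebesgue (psu D i) r" if "i \<in> {..<N_I D}" for i
      using that b by (intro set_integrable_subset[OF set_integrable_bounded_lmeasurable[OF F r, of b]] psu_sets psu_subset) auto
  qed (use psu_sets in auto)
  also have "(\<Union>i<N_I D. psu D i) = F" using partition by (simp add: partition_of_def)
  finally show ?thesis by (simp add: total_def)
qed

text \<open>\<open>vtot\<close> is centred at \<open>tau\<close>; it is the variance because
  \<open>tau\<close> is also the mean of the estimator.\<close>

lemma variance_HT:
  assumes r: "r \<in> borel_measurable (lebesgue_on F)" and b: "0 \<le> b" "\<And>z. z \<in> F \<Longrightarrow> \<bar>r z\<bar> \<le> b"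
  shows "M.variance (HT D r) = S.vtot (wr r)"
proof -
  note w = wbound_wr[OF r b]
  have "M.expectation (HT D r) = S.dmean (\<lambda>s. S.ER (S.HTs (wr r) s))"
    unfolding HT_eq[abs_def] by (intro expectation_statistic S.dep_HTs[OF w]) auto
  also have "\<dots> = S.dmean (\<lambda>s. \<Sum>i\<in>s. S.ER (S.y (wr r) i))"
  proof (rule S.dmean_cong)
    fix s assume s: "s \<in> S.samples"
    have sub: "s \<subseteq> {..<N_I D}" using s by auto
    show "S.ER (S.HTs (wr r) s) = (\<Sum>i\<in>s. S.ER (S.y (wr r) i))"
      unfolding S.HTs_def[abs_def] using s by (intro S.ER_sum[OF _ sub] S.dep_mono[OF S.dep_y[OF w]]) auto
  qed
  also have "\<dots> = S.tau (wr r)" by (simp add: S.dmean_sample_sum S.tau_def)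
  finally have E: "M.expectation (HT D r) = S.tau (wr r)" .
  have "M.variance (HT D r) = (LINT \<omega>|M. (S.HTs (wr r) (fst_sample D \<omega>) (pt \<omega>) - S.tau (wr r))\<^sup>2)"
    by (simp only: E HT_eq)
  also have "\<dots> = S.vtot (wr r)"
    unfolding S.vtot_def
    by (intro expectation_statistic[where f = "\<lambda>s x. (S.HTs (wr r) s x - S.tau (wr r))\<^sup>2"]
        S.dep_power S.dep_diff S.dep_const S.dep_HTs[OF w]) auto
  finally show ?thesis .
qed

lemma HT_moment4:
  fixes r :: "'a \<Rightarrow> real"
  assumes r: "r \<in> borel_measurable (lebesgue_on F)" and b: "0 \<le> b" "\<And>z. z \<in> F \<Longrightarrow> \<bar>r z\<bar> \<le> b"
  shows "integrable M (\<lambda>\<omega>. (HT D r \<omega> - total F r) ^ 4)"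
    and "(LINT \<omega>|M. (HT D r \<omega> - total F r) ^ 4) \<le> 1344 * \<kappa>^10 * b^4 / (n_I D)^2"
proof -
  note w = wbound_wr[OF r b]
  have tau: "S.tau (wr r) = total F r" by (rule tau_eq[OF r b])
  have d: "S.dep s (\<lambda>x. (S.HTs (wr r) s x - S.tau (wr r)) ^ 4)" if "s \<subseteq> {..<N_I D}" "card s = n_I D" for s
    using that by (intro S.dep_power S.dep_diff S.dep_const S.dep_HTs[OF w]) auto
  show "integrable M (\<lambda>\<omega>. (HT D r \<omega> - total F r) ^ 4)"
    unfolding HT_eq tau[symmetric]
    by (rule statistic_integrable[where f = "\<lambda>s x. (S.HTs (wr r) s x - S.tau (wr r)) ^ 4", OF d])
  have "(LINT \<omega>|M. (HT D r \<omega> - total F r) ^ 4) = S.dmean (\<lambda>s. S.ER (\<lambda>x. (S.HTs (wr r) s x - S.tau (wr r)) ^ 4))"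
    unfolding HT_eq tau[symmetric]
    by (rule expectation_statistic[where f = "\<lambda>s x. (S.HTs (wr r) s x - S.tau (wr r)) ^ 4", OF d])
  also have "\<dots> \<le> 1344 * \<kappa>^10 * b^4 / (n_I D)^2" by (rule S.HT_fourth_moment[OF w])
  finally show "(LINT \<omega>|M. (HT D r \<omega> - total F r) ^ 4) \<le> 1344 * \<kappa>^10 * b^4 / (n_I D)^2" .
qed

text \<open>The elementary inequality |u| <= c + u^2 / c replaces Cauchy-Schwarz; it turns a bound
  on the second moment into one on the first by linearity alone.\<close>

lemma expectation_abs_le:
  fixes f :: "nat set \<Rightarrow> (nat \<times> nat \<Rightarrow> 'a) \<Rightarrow> real"
  assumes d: "\<And>s. s \<subseteq> {..<N_I D} \<Longrightarrow> card s = n_I D \<Longrightarrow> S.dep s (f s)"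
    and K: "S.dmean (\<lambda>s. S.ER (\<lambda>x. (f s x - v)\<^sup>2)) \<le> K / n_I D ^ 3"
  shows "integrable M (\<lambda>\<omega>. \<bar>f (fst_sample D \<omega>) (pt \<omega>) - v\<bar>)"
    and "(LINT \<omega>|M. \<bar>f (fst_sample D \<omega>) (pt \<omega>) - v\<bar>) \<le> (1 + K) * n_I D powr (- 3 / 2)"
proof -
  let ?X = "\<lambda>\<omega>. f (fst_sample D \<omega>) (pt \<omega>) - v"
  \<comment> \<open>The order of the root of the second moment, for which both terms of the
    inequality are of the same size.\<close>
  let ?c = "n_I D powr (- 3 / 2)"
  have c: "0 < ?c" using n by simp
  have c2: "?c * ?c = 1 / n_I D ^ 3"
  proof -
    have "?c * ?c = n_I D powr (- 3)" using powr_add[of "real (n_I D)" "- 3 / 2" "- 3 / 2"] by simp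
    also have "\<dots> = 1 / n_I D ^ 3" using n by (simp add: powr_minus_divide)
    finally show ?thesis .
  qed
  have d1: "S.dep s (\<lambda>x. f s x - v)" if "s \<subseteq> {..<N_I D}" "card s = n_I D" for s
    using that by (intro S.dep_diff S.dep_const d)
  have d2: "S.dep s (\<lambda>x. (f s x - v)\<^sup>2)" if "s \<subseteq> {..<N_I D}" "card s = n_I D" for s
    using that by (intro S.dep_power d1)
  have i1: "integrable M ?X" by (rule statistic_integrable[where f = "\<lambda>s x. f s x - v", OF d1])
  have i2: "integrable M (\<lambda>\<omega>. (?X \<omega>)\<^sup>2)" by (rule statistic_integrable[where f = "\<lambda>s x. (f s x - v)\<^sup>2", OF d2])
  have e2: "(LINT \<omega>|M. (?X \<omega>)\<^sup>2) \<le> K / n_I D ^ 3"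
    using K expectation_statistic[where f = "\<lambda>s x. (f s x - v)\<^sup>2", OF d2] by simp
  show ia: "integrable M (\<lambda>\<omega>. \<bar>?X \<omega>\<bar>)" using i1 by simp
  have le: "\<bar>u\<bar> \<le> ?c + u\<^sup>2 / ?c" for u :: real
  proof (cases "\<bar>u\<bar> \<le> ?c")
    case True then show ?thesis using c by (simp add: add_increasing2)
  next
    case False
    then have "\<bar>u\<bar> * ?c \<le> \<bar>u\<bar> * \<bar>u\<bar>" by (intro mult_left_mono) auto
    then have "\<bar>u\<bar> \<le> u\<^sup>2 / ?c" using c by (simp add: pos_le_divide_eq power2_eq_square)
    then show ?thesis using c by linarith
  qed
  have "(LINT \<omega>|M. \<bar>?X \<omega>\<bar>) \<le> (LINT \<omega>|M. ?c + (?X \<omega>)\<^sup>2 / ?c)"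
    using ia i2 by (intro integral_mono le) auto
  also have "\<dots> = ?c + (LINT \<omega>|M. (?X \<omega>)\<^sup>2) / ?c"
    using i2 by (simp add: M.prob_space)
  also have "\<dots> \<le> ?c + (K / n_I D ^ 3) / ?c"
    using e2 c by (intro add_left_mono divide_right_mono) auto
  also have "K / n_I D ^ 3 = K * (?c * ?c)" unfolding c2 by simp
  also have "?c + K * (?c * ?c) / ?c = (1 + K) * ?c" using c by (simp add: field_simps)
  finally show "(LINT \<omega>|M. \<bar>?X \<omega>\<bar>) \<le> (1 + K) * ?c" .
qed

lemma V_HT_moment:
  assumes r: "r \<in> borel_measurable (lebesgue_on F)" and b: "0 \<le> b" "\<And>z. z \<in> F \<Longrightarrow> \<bar>r z\<bar> \<le> b"
  shows "integrable M (\<lambda>\<omega>. \<bar>V_HT D r \<omega> - M.variance (HT D r)\<bar>)"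
    and "(LINT \<omega>|M. \<bar>V_HT D r \<omega> - M.variance (HT D r)\<bar>) \<le> (1 + 5000 * \<kappa>^15 * b^4) * n_I D powr (- 3 / 2)"
proof -
  have w: "S.wbound (wr r) b" by (rule wbound_wr[OF r b])
  have v: "M.variance (HT D r) = S.vtot (wr r)" by (rule variance_HT[OF r b])
  have d: "S.dep s (S.ZHT (wr r) s)" if "s \<subseteq> {..<N_I D}" "card s = n_I D" for s
    using that by (intro S.dep_ZHT[OF w]) auto
  show "integrable M (\<lambda>\<omega>. \<bar>V_HT D r \<omega> - M.variance (HT D r)\<bar>)"
    "(LINT \<omega>|M. \<bar>V_HT D r \<omega> - M.variance (HT D r)\<bar>) \<le> (1 + 5000 * \<kappa>^15 * b^4) * n_I D powr (- 3 / 2)"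
    unfolding V_HT_eq v using S.ZHT_second_moment[OF w]
    by (intro expectation_abs_le[of "S.ZHT (wr r)" "S.vtot (wr r)" "5000 * \<kappa>^15 * b^4", OF d]; simp)+
qed

lemma V_YG_moment:
  assumes r: "r \<in> borel_measurable (lebesgue_on F)" and b: "0 \<le> b" "\<And>z. z \<in> F \<Longrightarrow> \<bar>r z\<bar> \<le> b"
  shows "integrable M (\<lambda>\<omega>. \<bar>V_YG D r \<omega> - M.variance (HT D r)\<bar>)"
    and "(LINT \<omega>|M. \<bar>V_YG D r \<omega> - M.variance (HT D r)\<bar>) \<le> (1 + 5000 * \<kappa>^15 * b^4) * n_I D powr (- 3 / 2)"
proof -
  have w: "S.wbound (wr r) b" by (rule wbound_wr[OF r b])
  have v: "M.variance (HT D r) = S.vtot (wr r)" by (rule variance_HT[OF r b])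
  have d: "S.dep s (S.ZYG (wr r) s)" if "s \<subseteq> {..<N_I D}" "card s = n_I D" for s
    using that by (intro S.dep_ZYG[OF w]) auto
  show "integrable M (\<lambda>\<omega>. \<bar>V_YG D r \<omega> - M.variance (HT D r)\<bar>)"
    "(LINT \<omega>|M. \<bar>V_YG D r \<omega> - M.variance (HT D r)\<bar>) \<le> (1 + 5000 * \<kappa>^15 * b^4) * n_I D powr (- 3 / 2)"
    unfolding V_YG_eq v using S.ZYG_second_moment[OF w]
    by (intro expectation_abs_le[of "S.ZYG (wr r)" "S.vtot (wr r)" "5000 * \<kappa>^15 * b^4", OF d]; simp)+
qed

lemma V_diff_le:
  assumes r: "r \<in> borel_measurable (lebesgue_on F)" and b: "0 \<le> b" "\<And>z. z \<in> F \<Longrightarrow> \<bar>r z\<bar> \<le> b"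
    and r': "r' \<in> borel_measurable (lebesgue_on F)" and b': "0 \<le> b'" "\<And>z. z \<in> F \<Longrightarrow> \<bar>r' z\<bar> \<le> b'"
    and \<delta>: "0 \<le> \<delta>" "\<And>z. z \<in> F \<Longrightarrow> \<bar>r z - r' z\<bar> \<le> \<delta>" and \<omega>: "\<omega> \<in> space M"
  shows "\<bar>V_HT D r \<omega> - V_HT D r' \<omega>\<bar> \<le> 8 * \<kappa>^6 * \<delta> * (b + b') / n_I D"
    and "\<bar>V_YG D r \<omega> - V_YG D r' \<omega>\<bar> \<le> 8 * \<kappa>^6 * \<delta> * (b + b') / n_I D"
proof -
  have "S.wbound (wr (\<lambda>z. r z - r' z)) \<delta>" using r r' \<delta> by (intro wbound_wr) auto
  then have w: "S.wbound (\<lambda>i z. wr r i z - wr r' i z) \<delta>" by (simp add: wr_def[abs_def] diff_divide_distrib)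
  have s: "fst_sample D \<omega> \<in> S.samples" using fst_sample_in[OF \<omega>] by simp
  show "\<bar>V_HT D r \<omega> - V_HT D r' \<omega>\<bar> \<le> 8 * \<kappa>^6 * \<delta> * (b + b') / n_I D"
    unfolding V_HT_eq by (rule S.ZHT_diff_le[OF wbound_wr[OF r b] wbound_wr[OF r' b'] w s])
  show "\<bar>V_YG D r \<omega> - V_YG D r' \<omega>\<bar> \<le> 8 * \<kappa>^6 * \<delta> * (b + b') / n_I D"
    unfolding V_YG_eq by (rule S.ZYG_diff_le[OF wbound_wr[OF r b] wbound_wr[OF r' b'] w s])
qed

text \<open>The points are only distributed with a density vanishing off the PSU, so they may leave
  it on a null set. Its nullity is read off from an expectation.\<close>

lemma AE_points_in_psu:
  "AE \<omega> in M. \<forall>i\<in>fst_sample D \<omega>. \<forall>k<n_II D i. point D i k \<omega> \<in> psu D i"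
proof -
  define u where "u i = indicat_real (- psu D i)" for i
  \<comment> \<open>The number of sampled points outside their PSU: nonnegative with mean zero,
    hence zero almost everywhere.\<close>
  define f where "f s x = (\<Sum>i\<in>s. \<Sum>k<n_II D i. u i (x (i, k)))" for s :: "nat set" and x :: "nat \<times> nat \<Rightarrow> 'a"
  have um: "u i \<in> borel_measurable lebesgue" if "i < N_I D" for i
    using sets.compl_sets[OF psu_sets[OF that]] unfolding u_def
    by (intro borel_measurable_indicator) (simp add: Compl_eq_Diff_UNIV)
  have ub: "\<bar>u i z\<bar> \<le> 1" for i z by (simp add: u_def indicator_def)
  have du: "S.dep J (\<lambda>x. u i (x (i, k)))" if "i < N_I D" "i \<in> J" "k < n_II D i" for i k J
    using S.dep_point[OF um[OF that(1)] ub that(2,3)] .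
  have d: "S.dep s (f s)" if "s \<subseteq> {..<N_I D}" for s
    unfolding f_def[abs_def] using that by (intro S.dep_sum du) auto
  have Eu: "S.ER (\<lambda>x. u i (x (i, k))) = 0" if "i < N_I D" "k < n_II D i" for i k
  proof -
    have "S.ER (\<lambda>x. u i (x (i, k))) = (LINT z|lebesgue. dens D i z * u i z)"
      using S.ER_point[OF that um[OF that(1)]] integral_\<mu>[OF that(1) um[OF that(1)]] by simp
    also have "(\<lambda>z. dens D i z * u i z) = (\<lambda>z. 0)"
      using dens_zero[OF that(1)] by (auto simp: u_def indicator_def fun_eq_iff)
    finally show ?thesis by simp
  qed
  have "(LINT \<omega>|M. f (fst_sample D \<omega>) (pt \<omega>)) = S.dmean (\<lambda>s. S.ER (f s))"
    by (rule expectation_statistic[of f]) (rule d)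
  also have "\<dots> = S.dmean (\<lambda>s. 0)"
  proof (rule S.dmean_cong)
    fix s assume "s \<in> S.samples"
    then have s: "s \<subseteq> {..<N_I D}" by simp
    have "S.ER (f s) = (\<Sum>i\<in>s. S.ER (\<lambda>x. \<Sum>k<n_II D i. u i (x (i, k))))"
      unfolding f_def[abs_def] using s by (intro S.ER_sum[OF _ s] S.dep_sum du) auto
    also have "\<dots> = (\<Sum>i\<in>s. \<Sum>k<n_II D i. S.ER (\<lambda>x. u i (x (i, k))))"
      using s by (intro sum.cong refl S.ER_sum[OF _ s] du) auto
    also have "\<dots> = 0" using s Eu by (intro sum.neutral ballI) auto
    finally show "S.ER (f s) = 0" .
  qed
  finally have "(LINT \<omega>|M. f (fst_sample D \<omega>) (pt \<omega>)) = 0" by simp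
  moreover have "integrable M (\<lambda>\<omega>. f (fst_sample D \<omega>) (pt \<omega>))"
    by (rule statistic_integrable[of f]) (rule d)
  moreover have "AE \<omega> in M. 0 \<le> f (fst_sample D \<omega>) (pt \<omega>)"
    by (intro AE_I2) (auto simp: f_def u_def intro!: sum_nonneg)
  ultimately have "AE \<omega> in M. f (fst_sample D \<omega>) (pt \<omega>) = 0"
    using integral_nonneg_eq_0_iff_AE by blast
  then show ?thesis
  proof (rule AE_mp, intro AE_I2 impI ballI allI)
    fix \<omega> i k assume \<omega>: "\<omega> \<in> space M" and f0: "f (fst_sample D \<omega>) (pt \<omega>) = 0"
      and ik: "i \<in> fst_sample D \<omega>" "k < n_II D i"
    have fin: "finite (fst_sample D \<omega>)" using fst_sample_in[OF \<omega>] finite_subset by blast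
    have "u i (pt \<omega> (i, k)) = 0"
    proof -
      have "\<forall>i\<in>fst_sample D \<omega>. (\<Sum>k<n_II D i. u i (pt \<omega> (i, k))) = 0"
        using f0 fin unfolding f_def by (subst (asm) sum_nonneg_eq_0_iff) (auto simp: u_def intro!: sum_nonneg)
      then have "(\<Sum>k<n_II D i. u i (pt \<omega> (i, k))) = 0" using ik by blast
      then show ?thesis using ik(2) by (subst (asm) sum_nonneg_eq_0_iff) (auto simp: u_def)
    qed
    then show "point D i k \<omega> \<in> psu D i" by (auto simp: u_def pt_def indicator_def split: if_splits)
  qed
qed

text \<open>Each of the n sampled PSUs contributes at least 1 / (\<open>\<kappa>\<^sup>2\<close> *
  n) to the estimated area. This is what makes its inverse harmless in all later moment
  bounds.\<close>

lemma AE_HT_one_ge: "AE \<omega> in M. 1 / \<kappa>\<^sup>2 \<le> HT D (\<lambda>_. 1 :: real) \<omega>"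
  using AE_points_in_psu
proof (rule AE_mp, intro AE_I2 impI)
  fix \<omega> assume \<omega>: "\<omega> \<in> space M" and pts: "\<forall>i\<in>fst_sample D \<omega>. \<forall>k<n_II D i. point D i k \<omega> \<in> psu D i"
  have s: "fst_sample D \<omega> \<subseteq> {..<N_I D}" "card (fst_sample D \<omega>) = n_I D" using fst_sample_in[OF \<omega>] by auto
  have "1 / \<kappa>\<^sup>2 = (\<Sum>i\<in>fst_sample D \<omega>. (N_I D / (\<kappa> * n_I D)) * (1 / (\<kappa> * N_I D)))"
    using s n N by (simp add: power2_eq_square)
  also have "\<dots> \<le> (\<Sum>i\<in>fst_sample D \<omega>. (1 / pi_I D i) * HT_psu D (\<lambda>_. 1) i \<omega>)"
  proof (intro sum_mono mult_mono)
    fix i assume i: "i \<in> fst_sample D \<omega>"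
    then have iN: "i < N_I D" using s by auto
    have pp: "0 < pi_I D i" using S.pi_pos[OF iN] by (simp add: pi_eq)
    show "N_I D / (\<kappa> * n_I D) \<le> 1 / pi_I D i"
      using pi_le[OF iN] pp n N \<kappa> by (simp add: field_simps)
    have m: "0 < real (n_II D i)" using n_II_ge[OF iN] by simp
    have "1 / (\<kappa> * N_I D) = (\<Sum>k<n_II D i. 1 / (n_II D i * (\<kappa> * N_I D)))" using m by simp
    also have "\<dots> \<le> HT_psu D (\<lambda>_. 1) i \<omega>"
      unfolding HT_psu_def
    proof (rule sum_mono)
      fix k assume "k \<in> {..<n_II D i}"
      then have z: "point D i k \<omega> \<in> psu D i" using pts i by auto
      have "1 / (n_II D i * (\<kappa> * N_I D)) \<le> 1 / (n_II D i * dens D i (point D i k \<omega>))"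
        using dens_le[OF iN z] dens_pos[OF iN z] m \<kappa> N by (intro divide_left_mono mult_left_mono mult_pos_pos) auto
      then show "1 / (n_II D i * (\<kappa> * N_I D)) \<le> 1 /\<^sub>R pi_II D i (point D i k \<omega>)"
        by (simp add: pi_II_def divide_inverse)
    qed
    finally show "1 / (\<kappa> * N_I D) \<le> HT_psu D (\<lambda>_. 1) i \<omega>" .
    show "0 \<le> 1 / pi_I D i" using pp by simp
    show "0 \<le> 1 / (\<kappa> * N_I D)" using \<kappa> by simp
  qed
  also have "\<dots> = HT D (\<lambda>_. 1 :: real) \<omega>" by (simp add: HT_def divide_inverse)
  finally show "1 / \<kappa>\<^sup>2 \<le> HT D (\<lambda>_. 1 :: real) \<omega>" .
qed

lemma HT_inner: "HT D \<rho> \<omega> \<bullet> b = HT D (\<lambda>z. \<rho> z \<bullet> b) \<omega>"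
  by (simp add: HT_def HT_psu_def inner_sum_left)

lemma HT_measurable:
  fixes r :: "'a \<Rightarrow> real"
  assumes r: "r \<in> borel_measurable (lebesgue_on F)" and b: "0 \<le> b" "\<And>z. z \<in> F \<Longrightarrow> \<bar>r z\<bar> \<le> b"
  shows "HT D r \<in> borel_measurable M"
  unfolding HT_eq[abs_def]
  by (rule statistic_measurable[of "S.HTs (wr r)"]) (use S.dep_HTs[OF wbound_wr[OF r b]] in simp)

lemma HT_vector_measurable:
  fixes \<rho> :: "'a \<Rightarrow> 'b::euclidean_space"
  assumes r: "\<rho> \<in> borel_measurable (lebesgue_on F)" and b: "\<And>z. z \<in> F \<Longrightarrow> norm (\<rho> z) \<le> b" and b0: "0 \<le> b"
  shows "HT D \<rho> \<in> borel_measurable M"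
proof (rule borel_measurable_euclidean_space[THEN iffD2], intro ballI)
  fix e :: 'b assume e: "e \<in> Basis"
  have "HT D (\<lambda>z. \<rho> z \<bullet> e) \<in> borel_measurable M"
    using r b b0 e by (intro HT_measurable[of _ b] borel_measurable_inner borel_measurable_const) (auto intro: order_trans[OF Basis_le_norm])
  then show "(\<lambda>\<omega>. HT D \<rho> \<omega> \<bullet> e) \<in> borel_measurable M" by (simp add: HT_inner[abs_def])
qed

text \<open>Points outside their PSU get weight \<open>1 / 0 = 0\<close>, so this holds everywhere. Almost everywhere would
  not do for the measurability of the plug-in estimators, since \<open>M\<close> need not be complete.\<close>

lemma HT_in_cone:
  fixes \<rho> :: "'a \<Rightarrow> 'b::euclidean_space"
  assumes K: "convex K" and \<rho>: "\<rho> ` F \<subseteq> K" and \<omega>: "\<omega> \<in> space M"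
  defines "W \<equiv> HT D (\<lambda>_. 1 :: real) \<omega>"
  shows "(W = 0 \<and> HT D \<rho> \<omega> = 0) \<or> (0 < W \<and> HT D \<rho> \<omega> /\<^sub>R W \<in> K)"
proof -
  have s: "fst_sample D \<omega> \<subseteq> {..<N_I D}" "card (fst_sample D \<omega>) = n_I D" using fst_sample_in[OF \<omega>] by auto
  have fin: "finite (fst_sample D \<omega>)" using s finite_subset by blast
  define I where "I = (SIGMA i:fst_sample D \<omega>. {..<n_II D i})"
  \<comment> \<open>The total weight of one sampled point in both estimators. Their quotient is a
    convex combination of the values of \<open>\<rho>\<close> with weights
    \<open>c q / W\<close>.\<close>
  define c where "c q = inverse (pi_I D (fst q)) * inverse (pi_II D (fst q) (pt \<omega> q))" for q
  have finI: "finite I" unfolding I_def using fin by auto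
  have W: "W = sum c I"
  proof -
    have "W = (\<Sum>i\<in>fst_sample D \<omega>. \<Sum>k<n_II D i. c (i, k))"
      unfolding W_def HT_def HT_psu_def c_def by (simp add: sum_distrib_left pt_def)
    then show ?thesis unfolding I_def using fin by (simp add: sum.Sigma)
  qed
  have HT: "HT D \<rho> \<omega> = (\<Sum>q\<in>I. c q *\<^sub>R \<rho> (pt \<omega> q))"
  proof -
    have "HT D \<rho> \<omega> = (\<Sum>i\<in>fst_sample D \<omega>. \<Sum>k<n_II D i. c (i, k) *\<^sub>R \<rho> (pt \<omega> (i, k)))"
      unfolding HT_def HT_psu_def c_def by (simp add: scaleR_sum_right pt_def)
    also have "\<dots> = (\<Sum>(i, k)\<in>I. c (i, k) *\<^sub>R \<rho> (pt \<omega> (i, k)))"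
      unfolding I_def using fin by (intro sum.Sigma) auto
    finally show ?thesis by (simp add: case_prod_beta')
  qed
  have c0: "0 \<le> c q" if "q \<in> I" for q
  proof -
    have "fst q < N_I D" using that s by (auto simp: I_def)
    then have "0 \<le> pi_I D (fst q)" "0 \<le> pi_II D (fst q) (pt \<omega> q)"
      using S.pi_pos dens_nonneg by (auto simp: pi_eq pi_II_def less_imp_le)
    then show ?thesis by (simp add: c_def)
  qed
  have cK: "c q = 0 \<or> \<rho> (pt \<omega> q) \<in> K" if "q \<in> I" for q
  proof (cases "pt \<omega> q \<in> psu D (fst q)")
    case True
    moreover have "fst q < N_I D" using that s by (auto simp: I_def)
    ultimately have "pt \<omega> q \<in> F" using psu_subset by blast
    then show ?thesis using \<rho> by blast
  next
    case False
    moreover have "fst q < N_I D" using that s by (auto simp: I_def)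
    ultimately show ?thesis by (simp add: c_def pi_II_def dens_zero)
  qed
  show ?thesis
  proof (cases "W = 0")
    case True
    then have "c q = 0" if "q \<in> I" for q
      using W c0 finI that by (simp add: sum_nonneg_eq_0_iff)
    then have "HT D \<rho> \<omega> = 0" unfolding HT by (intro sum.neutral) auto
    then show ?thesis using True by simp
  next
    case False
    have Wp: "0 < W" using False c0 W by (simp add: order.strict_iff_order sum_nonneg)
    then obtain q0 where "q0 \<in> I" "c q0 \<noteq> 0" unfolding W by (metis less_irrefl sum.neutral)
    then obtain a0 where a0: "a0 \<in> K" using cK by blast
    \<comment> \<open>A point outside its PSU has weight zero but possibly a value outside
      \<open>K\<close>; replacing that value by \<open>a0\<close> makes all the points of the convex
      combination lie in \<open>K\<close>.\<close>
    define \<rho>' where "\<rho>' q = (if \<rho> (pt \<omega> q) \<in> K then \<rho> (pt \<omega> q) else a0)" for q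
    have "(\<Sum>q\<in>I. (c q / W) *\<^sub>R \<rho>' q) \<in> K"
    proof (rule convex_sum[OF finI K])
      show "(\<Sum>q\<in>I. c q / W) = 1" using Wp by (simp add: W[symmetric] sum_divide_distrib[symmetric])
    qed (use c0 Wp a0 in \<open>auto simp: \<rho>'_def\<close>)
    also have "(\<Sum>q\<in>I. (c q / W) *\<^sub>R \<rho>' q) = HT D \<rho> \<omega> /\<^sub>R W"
      unfolding HT scaleR_sum_right using cK by (intro sum.cong refl) (auto simp: \<rho>'_def divide_inverse mult.commute)
    finally show ?thesis using Wp by simp
  qed
qed

end

section \<open>Plug-in of homogeneous functions\<close>

lemma GDERIV_unique:
  assumes "GDERIV g x :> u" "GDERIV g x :> v"
  shows "u = v"
proof -
  have "(\<lambda>h. h \<bullet> u) = (\<lambda>h. h \<bullet> v)"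
    using assms unfolding gderiv_def by (rule has_derivative_unique)
  then have "(u - v) \<bullet> u = (u - v) \<bullet> v" by metis
  then have "(u - v) \<bullet> (u - v) = 0" by (simp add: inner_diff_right)
  then show ?thesis by simp
qed

lemma gradient_eqI: "GDERIV g x :> v \<Longrightarrow> gradient g x = v"
  unfolding gradient_def by (rule the_equality) (auto intro: GDERIV_unique)

lemma GDERIV_gradient:
  fixes g :: "'b::euclidean_space \<Rightarrow> real"
  assumes "g differentiable (at x)"
  shows "GDERIV g x :> gradient g x"
proof -
  obtain g' where g': "(g has_derivative g') (at x)"
    using assms by (auto simp: differentiable_def)
  then interpret bounded_linear g' by (rule has_derivative_bounded_linear)
  \<comment> \<open>The derivative is represented by the vector with its values on the basis as
    coordinates.\<close>
  have "g' h = h \<bullet> (\<Sum>b\<in>Basis. g' b *\<^sub>R b)" for h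
  proof -
    have "g' h = g' (\<Sum>b\<in>Basis. (h \<bullet> b) *\<^sub>R b)" by (simp add: euclidean_representation)
    also have "\<dots> = (\<Sum>b\<in>Basis. (h \<bullet> b) * g' b)" by (simp add: sum scaleR)
    finally show ?thesis by (simp add: inner_sum_right mult.commute)
  qed
  then have "GDERIV g x :> (\<Sum>b\<in>Basis. g' b *\<^sub>R b)"
    unfolding gderiv_def using g' by (metis (no_types, lifting) ext)
  then show ?thesis using gradient_eqI by metis
qed

locale homogeneous_plugin =
  fixes g :: "'b::euclidean_space \<Rightarrow> real" and K :: "'b set" and L :: real
  assumes hom: "PI1 g" and K: "convex K" "compact K"
    and diff: "\<And>a. a \<in> K \<Longrightarrow> g differentiable (at a)"
    and L: "0 < L" and lip: "\<And>a b. a \<in> K \<Longrightarrow> b \<in> K \<Longrightarrow> norm (gradient g b - gradient g a) \<le> L * norm (b - a)"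
begin

lemma g_scale: "0 < r \<Longrightarrow> g (r *\<^sub>R a) = g a"
  using hom by (simp add: PI1_def)

lemma grad: "a \<in> K \<Longrightarrow> (g has_derivative (\<lambda>h. h \<bullet> gradient g a)) (at a)"
  using GDERIV_gradient[OF diff] by (simp add: gderiv_def)

text \<open>The identity g (x / r) = g x carries differentiability from \<open>a\<close> to the
  point \<open>r *\<^sub>R a\<close>, which may lie outside \<open>K\<close>. The total is such a
  point: only the mean is known to be in \<open>K\<close>.\<close>

lemma gradient_scale:
  assumes a: "a \<in> K" and r: "0 < r"
  shows "gradient g (r *\<^sub>R a) = gradient g a /\<^sub>R r"
proof (rule gradient_eqI)
  have "((\<lambda>x. inverse r *\<^sub>R x) has_derivative (\<lambda>h. inverse r *\<^sub>R h)) (at (r *\<^sub>R a))"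
    by (auto intro!: derivative_eq_intros)
  moreover have "(g has_derivative (\<lambda>h. h \<bullet> gradient g a)) (at (inverse r *\<^sub>R (r *\<^sub>R a)))"
    using grad[OF a] r by simp
  ultimately have "((\<lambda>x. g (inverse r *\<^sub>R x)) has_derivative (\<lambda>h. (inverse r *\<^sub>R h) \<bullet> gradient g a)) (at (r *\<^sub>R a))"
    by (rule has_derivative_compose)
  moreover have "(\<lambda>x. g (inverse r *\<^sub>R x)) = g" using g_scale[of "inverse r"] r by auto
  ultimately show "GDERIV g (r *\<^sub>R a) :> gradient g a /\<^sub>R r"
    by (simp add: gderiv_def)
qed

text \<open>Along the ray through \<open>a\<close> the function is constant, so its derivative at 1
  is zero.\<close>

lemma euler:
  assumes a: "a \<in> K"
  shows "gradient g a \<bullet> a = 0"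
proof -
  have "((\<lambda>t::real. t *\<^sub>R a) has_derivative (\<lambda>h. h *\<^sub>R a)) (at 1)"
    by (auto intro!: derivative_eq_intros)
  moreover have "(g has_derivative (\<lambda>h. h \<bullet> gradient g a)) (at ((1::real) *\<^sub>R a))"
    using grad[OF a] by simp
  ultimately have d: "((\<lambda>t::real. g (t *\<^sub>R a)) has_derivative (\<lambda>h. (h *\<^sub>R a) \<bullet> gradient g a)) (at 1)"
    by (rule has_derivative_compose)
  have "((\<lambda>t::real. g (t *\<^sub>R a)) has_derivative (\<lambda>h. 0)) (at 1)"
  proof (rule has_derivative_transform_within_open[of "\<lambda>_. g a"])
    show "open {0::real<..}" "(1::real) \<in> {0<..}" by auto
    show "g a = g (t *\<^sub>R a)" if "t \<in> {0<..}" for t using g_scale[of t a] that by simp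
  qed auto
  from has_derivative_unique[OF d this] have "(1 *\<^sub>R a) \<bullet> gradient g a = 0" by (rule fun_cong)
  then show ?thesis by (simp add: inner_commute)
qed

text \<open>Convexity keeps the segment in \<open>K\<close>. The mean value theorem gives the
  increment as the gradient at an intermediate point, and the Lipschitz condition compares that
  gradient with the one at \<open>a\<close>.\<close>

lemma taylor:
  assumes a: "a \<in> K" and b: "b \<in> K"
  shows "\<bar>g b - g a - gradient g a \<bullet> (b - a)\<bar> \<le> L * norm (b - a) ^ 2"
proof -
  let ?p = "\<lambda>t::real. a + t *\<^sub>R (b - a)"
  have p: "?p t \<in> K" if "t \<in> {0..1}" for t
    using convexD_alt[OF K(1) a b, of t] that by (simp add: algebra_simps)
  have "((\<lambda>t. g (?p t)) has_derivative (\<lambda>h. (h *\<^sub>R (b - a)) \<bullet> gradient g (?p t))) (at t within {0..1})"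
    if "0 \<le> t" "t \<le> 1" for t
  proof (rule has_derivative_compose[where g = g])
    show "(?p has_derivative (\<lambda>h. h *\<^sub>R (b - a))) (at t within {0..1})"
      by (auto intro!: derivative_eq_intros)
    show "(g has_derivative (\<lambda>h. h \<bullet> gradient g (?p t))) (at (?p t))"
      using p that by (intro grad) auto
  qed
  then obtain t where t: "t \<in> {0<..<1}"
    and eq: "g (?p 1) - g (?p 0) = ((1 - 0) *\<^sub>R (b - a)) \<bullet> gradient g (?p t)"
    using mvt_simple[of 0 1 "\<lambda>t. g (?p t)" "\<lambda>t h. (h *\<^sub>R (b - a)) \<bullet> gradient g (?p t)"] by auto
  have "g b - g a - gradient g a \<bullet> (b - a) = (gradient g (?p t) - gradient g a) \<bullet> (b - a)"
    using eq by (simp add: inner_diff_left inner_diff_right inner_commute)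
  then have "\<bar>g b - g a - gradient g a \<bullet> (b - a)\<bar> \<le> norm (gradient g (?p t) - gradient g a) * norm (b - a)"
    using Cauchy_Schwarz_ineq2 by metis
  also have "\<dots> \<le> (L * norm (?p t - a)) * norm (b - a)"
    using p t by (intro mult_right_mono lip a) auto
  also have "\<dots> \<le> (L * norm (b - a)) * norm (b - a)"
    using t L by (intro mult_right_mono mult_left_mono) (auto simp: mult_left_le_one_le)
  finally show ?thesis by (simp add: power2_eq_square)
qed

lemma continuous_on_gradient: "continuous_on K (gradient g)"
proof (rule lipschitz_on_continuous_on)
  show "L-lipschitz_on K (gradient g)"
    using L lip by (intro lipschitz_onI) (auto simp: dist_norm norm_minus_commute)
qed

lemma continuous_on_g: "continuous_on K g"
  by (rule continuous_at_imp_continuous_on, rule ballI,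
      rule differentiable_imp_continuous_within, rule diff)

text \<open>The maps \<open>g\<close> and \<open>gradient g\<close> are controlled only on the cone over \<open>K\<close>, where they are
  recovered from their values on \<open>K\<close>; the point \<open>0\<close> needs a separate case.\<close>

definition cone_pair :: "'b \<Rightarrow> real \<Rightarrow> bool" where
  "cone_pair v W \<longleftrightarrow> (W = 0 \<and> v = 0) \<or> (0 < W \<and> v /\<^sub>R W \<in> K)"

lemma borel_measurable_g_cone:
  assumes v: "v \<in> borel_measurable M" and W: "W \<in> borel_measurable M"
    and c: "\<And>\<omega>. \<omega> \<in> space M \<Longrightarrow> cone_pair (v \<omega>) (W \<omega>)"
  shows "(\<lambda>\<omega>. g (v \<omega>)) \<in> borel_measurable M"
    and "(\<lambda>\<omega>. gradient g (v \<omega>)) \<in> borel_measurable M"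
proof -
  have Kb: "K \<in> sets borel" using K(2) by (simp add: compact_imp_closed)
  define gK where "gK a = (if a \<in> K then g a else 0)" for a
  define dK where "dK a = (if a \<in> K then gradient g a else 0)" for a
  have [measurable]: "gK \<in> borel_measurable borel" "dK \<in> borel_measurable borel"
    unfolding gK_def[abs_def] dK_def[abs_def]
    by (rule borel_measurable_continuous_on_if[OF Kb continuous_on_g continuous_on_const],
        rule borel_measurable_continuous_on_if[OF Kb continuous_on_gradient continuous_on_const])
  note [measurable] = v W
  have g: "(\<lambda>\<omega>. if W \<omega> = 0 then g 0 else gK (v \<omega> /\<^sub>R W \<omega>)) \<in> borel_measurable M"
    by measurable
  have d: "(\<lambda>\<omega>. if W \<omega> = 0 then gradient g 0 else dK (v \<omega> /\<^sub>R W \<omega>) /\<^sub>R W \<omega>) \<in> borel_measurable M"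
    by measurable
  \<comment> \<open>For \<open>W = 0\<close> the argument is 0 and the value constant; for positive
    \<open>W\<close> homogeneity moves the argument into \<open>K\<close>, where the extension by
    zero agrees with the original map.\<close>
  have "g (v \<omega>) = (if W \<omega> = 0 then g 0 else gK (v \<omega> /\<^sub>R W \<omega>))"
    "gradient g (v \<omega>) = (if W \<omega> = 0 then gradient g 0 else dK (v \<omega> /\<^sub>R W \<omega>) /\<^sub>R W \<omega>)"
    if "\<omega> \<in> space M" for \<omega>
    using c[OF that] g_scale[of "W \<omega>" "v \<omega> /\<^sub>R W \<omega>"] gradient_scale[of "v \<omega> /\<^sub>R W \<omega>" "W \<omega>"]
    by (auto simp: cone_pair_def gK_def dK_def)
  then show "(\<lambda>\<omega>. g (v \<omega>)) \<in> borel_measurable M" "(\<lambda>\<omega>. gradient g (v \<omega>)) \<in> borel_measurable M"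
    using g d by (simp_all cong: measurable_cong)
qed

context
  fixes \<kappa> A G r :: real and m :: 'b
  assumes A: "0 < A" and m: "m \<in> K" and \<kappa>: "1 \<le> \<kappa>"
    and G: "\<And>a. a \<in> K \<Longrightarrow> norm (gradient g a) \<le> G"
    and r: "\<And>a. a \<in> K \<Longrightarrow> norm a \<le> r"
begin

text \<open>All bounds are transported from the pair \<open>v /\<^sub>R W\<close>, \<open>m\<close>
  in \<open>K\<close>, whose distance is at most \<open>q * e\<close>, to the pair \<open>v\<close>,
  \<open>A *\<^sub>R m\<close> by homogeneity. The rescaling differs at the two points, which brings
  in the error of \<open>W\<close> and the terms with \<open>G\<close>.\<close>

lemma plugin_bounds:
  assumes W: "1 / \<kappa>\<^sup>2 \<le> W" and vK: "v /\<^sub>R W \<in> K"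
  defines "e \<equiv> norm (v - A *\<^sub>R m) + \<bar>W - A\<bar>" and "q \<equiv> \<kappa>\<^sup>2 * (1 + r)"
  shows "\<bar>g v - g (A *\<^sub>R m) - gradient g (A *\<^sub>R m) \<bullet> (v - A *\<^sub>R m)\<bar> \<le> (L * q\<^sup>2 + G * q / A) * e\<^sup>2"
    and "norm (gradient g v - gradient g (A *\<^sub>R m)) \<le> \<kappa>\<^sup>2 * (L * q + G / A) * e"
    and "norm (gradient g v) \<le> G * \<kappa>\<^sup>2" and "norm (gradient g (A *\<^sub>R m)) \<le> G / A"
proof -
  have W0: "0 < W" using W \<kappa> by (smt (verit) divide_pos_pos zero_less_power)
  have iW: "1 / W \<le> \<kappa>\<^sup>2"
    using W W0 \<kappa> by (simp add: field_simps)
  have G0: "0 \<le> G" using G[OF m] norm_ge_zero order_trans by blast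
  have r0: "0 \<le> r" using r[OF m] norm_ge_zero order_trans by blast
  have e0: "0 \<le> e" and q0: "0 \<le> q" using r0 by (auto simp: e_def q_def)
  let ?a = "v /\<^sub>R W"
  have v: "v = W *\<^sub>R ?a" using W0 by simp
  have gv: "gradient g v = gradient g ?a /\<^sub>R W" using gradient_scale[OF vK W0] v by simp
  have gm: "gradient g (A *\<^sub>R m) = gradient g m /\<^sub>R A" using gradient_scale[OF m A] .
  \<comment> \<open>The error of the ratio in terms of the errors of numerator and denominator;
    dividing by \<open>W\<close> costs at most \<open>\<kappa>\<^sup>2\<close>.\<close>
  have "W *\<^sub>R (?a - m) = (v - A *\<^sub>R m) - (W - A) *\<^sub>R m" using W0 by (simp add: algebra_simps)
  then have "W * norm (?a - m) = norm ((v - A *\<^sub>R m) - (W - A) *\<^sub>R m)" using W0 by (metis abs_of_pos norm_scaleR)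
  also have "\<dots> \<le> norm (v - A *\<^sub>R m) + \<bar>W - A\<bar> * norm m" by (rule order_trans[OF norm_triangle_ineq4]) simp
  also have "\<dots> \<le> norm (v - A *\<^sub>R m) + \<bar>W - A\<bar> * r" using r[OF m] by (intro add_left_mono mult_left_mono) auto
  also have "\<dots> \<le> (1 + r) * e" using r0 by (simp add: e_def algebra_simps)
  finally have le: "W * norm (?a - m) \<le> (1 + r) * e" .
  have "W * norm (?a - m) * (1 / W) \<le> (1 + r) * e * \<kappa>\<^sup>2"
    by (rule mult_mono[OF le iW]) (use r0 e0 W0 in simp_all)
  then have d: "norm (?a - m) \<le> q * e" using W0 by (simp add: q_def mult_ac)
  have We: "\<bar>W - A\<bar> \<le> e" by (simp add: e_def)
  show "norm (gradient g v) \<le> G * \<kappa>\<^sup>2"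
  proof -
    have "norm (gradient g v) = norm (gradient g ?a) * (1 / W)" using W0 by (simp add: gv divide_inverse mult.commute)
    also have "\<dots> \<le> G * \<kappa>\<^sup>2" using G[OF vK] iW W0 G0 by (intro mult_mono) auto
    finally show ?thesis .
  qed
  show "norm (gradient g (A *\<^sub>R m)) \<le> G / A"
    using G[OF m] A by (simp add: gm field_simps)
  show "norm (gradient g v - gradient g (A *\<^sub>R m)) \<le> \<kappa>\<^sup>2 * (L * q + G / A) * e"
  proof -
    \<comment> \<open>The gradients scale by 1/W and 1/A; pulling out 1/W leaves the Lipschitz
      difference and the relative error of \<open>W\<close>.\<close>
    have "gradient g v - gradient g (A *\<^sub>R m) = (1 / W) *\<^sub>R ((gradient g ?a - gradient g m) - ((W - A) / A) *\<^sub>R gradient g m)"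
      unfolding gv gm using W0 A by (simp add: algebra_simps divide_inverse diff_divide_distrib)
    then have "norm (gradient g v - gradient g (A *\<^sub>R m)) = (1 / W) * norm ((gradient g ?a - gradient g m) - ((W - A) / A) *\<^sub>R gradient g m)"
      using W0 by simp
    also have "\<dots> \<le> \<kappa>\<^sup>2 * (L * (q * e) + (e / A) * G)"
    proof (rule mult_mono[OF iW])
      have "norm (gradient g ?a - gradient g m) \<le> L * (q * e)"
        using lip[OF m vK] d L by (meson mult_left_mono order_trans less_imp_le)
      moreover have "norm (((W - A) / A) *\<^sub>R gradient g m) \<le> (e / A) * G"
      proof -
        have "norm (((W - A) / A) *\<^sub>R gradient g m) = (\<bar>W - A\<bar> / A) * norm (gradient g m)" using A by simp
        also have "\<dots> \<le> (e / A) * G" using We A G[OF m] e0 by (intro mult_mono divide_right_mono) auto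
        finally show ?thesis .
      qed
      ultimately show "norm ((gradient g ?a - gradient g m) - ((W - A) / A) *\<^sub>R gradient g m) \<le> L * (q * e) + (e / A) * G"
        using norm_triangle_ineq4[of "gradient g ?a - gradient g m" "((W - A) / A) *\<^sub>R gradient g m"] by linarith
    qed auto
    finally show ?thesis by (simp add: algebra_simps)
  qed
  show "\<bar>g v - g (A *\<^sub>R m) - gradient g (A *\<^sub>R m) \<bullet> (v - A *\<^sub>R m)\<bar> \<le> (L * q\<^sup>2 + G * q / A) * e\<^sup>2"
  proof -
    have g1: "g v = g ?a" using g_scale[OF W0, of ?a] v by simp
    have g2: "g (A *\<^sub>R m) = g m" by (rule g_scale[OF A])
    have i1: "gradient g m \<bullet> m = 0" by (rule euler[OF m])
    have "gradient g (A *\<^sub>R m) \<bullet> (v - A *\<^sub>R m) = (W / A) * (gradient g m \<bullet> ?a)"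
      unfolding gm using i1 W0 by (simp add: inner_diff_right divide_inverse)
    moreover have "gradient g m \<bullet> (?a - m) = gradient g m \<bullet> ?a" using i1 by (simp add: inner_diff_right)
    \<comment> \<open>As the gradient at \<open>m\<close> annihilates \<open>m\<close>, the linear
      terms on the two scales differ by the relative error of \<open>W\<close> times a term of first
      order in \<open>?a - m\<close>, hence again by a quadratic quantity.\<close>
    ultimately have eq: "g v - g (A *\<^sub>R m) - gradient g (A *\<^sub>R m) \<bullet> (v - A *\<^sub>R m)
      = (g ?a - g m - gradient g m \<bullet> (?a - m)) - ((W - A) / A) * (gradient g m \<bullet> (?a - m))"
      unfolding g1 g2 using A by (simp add: field_simps)
    have "\<bar>g ?a - g m - gradient g m \<bullet> (?a - m)\<bar> \<le> L * (q * e)\<^sup>2"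
    proof -
      have "\<bar>g ?a - g m - gradient g m \<bullet> (?a - m)\<bar> \<le> L * norm (?a - m) ^ 2" by (rule taylor[OF m vK])
      also have "\<dots> \<le> L * (q * e)\<^sup>2" using d L by (intro mult_left_mono power_mono) auto
      finally show ?thesis .
    qed
    moreover have "\<bar>((W - A) / A) * (gradient g m \<bullet> (?a - m))\<bar> \<le> (e / A) * (G * (q * e))"
    proof -
      have "\<bar>gradient g m \<bullet> (?a - m)\<bar> \<le> norm (gradient g m) * norm (?a - m)" by (rule Cauchy_Schwarz_ineq2)
      also have "\<dots> \<le> G * (q * e)" using G[OF m] d G0 by (intro mult_mono) auto
      finally have "\<bar>gradient g m \<bullet> (?a - m)\<bar> \<le> G * (q * e)" .
      moreover have "\<bar>(W - A) / A\<bar> \<le> e / A" using We A by (simp add: divide_right_mono)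
      ultimately show ?thesis unfolding abs_mult using e0 A by (intro mult_mono) auto
    qed
    ultimately have "\<bar>g v - g (A *\<^sub>R m) - gradient g (A *\<^sub>R m) \<bullet> (v - A *\<^sub>R m)\<bar> \<le> L * (q * e)\<^sup>2 + (e / A) * (G * (q * e))"
      unfolding eq by (rule order_trans[OF abs_triangle_ineq4 add_mono])
    also have "\<dots> = (L * q\<^sup>2 + G * q / A) * e\<^sup>2" by (simp add: power2_eq_square algebra_simps)
    finally show ?thesis .
  qed
qed

end

end

section \<open>Plug-in estimators under a two-stage design\<close>

locale plugin_survey = regular_survey F D \<kappa> + homogeneous_plugin g K L
  for F :: "'a::euclidean_space set" and D :: "('w, 'a) two_stage_design" and \<kappa> :: real
    and g :: "'b::euclidean_space \<Rightarrow> real" and K :: "'b set" and L :: real +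
  fixes \<rho> :: "'a \<Rightarrow> 'b" and G r :: real
  assumes \<rho>: "\<rho> \<in> borel_measurable (lebesgue_on F)" "\<rho> ` F \<subseteq> K"
    and A: "0 < measure lebesgue F"
    and mean: "total F \<rho> /\<^sub>R measure lebesgue F \<in> K"
    and G: "\<And>a. a \<in> K \<Longrightarrow> norm (gradient g a) \<le> G"
    and r: "\<And>a. a \<in> K \<Longrightarrow> norm a \<le> r"
begin

abbreviation "\<A> \<equiv> measure lebesgue F"
abbreviation "W \<equiv> HT D (\<lambda>_. 1 :: real)"

lemma G_nonneg: "0 \<le> G" and r_nonneg: "0 \<le> r"
  using G[OF mean] r[OF mean] norm_ge_zero order_trans by blast+

lemma norm_\<rho>: "z \<in> F \<Longrightarrow> norm (\<rho> z) \<le> r"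
  using \<rho>(2) r by blast

definition err :: "'w \<Rightarrow> real" where
  "err \<omega> = norm (HT D \<rho> \<omega> - total F \<rho>) + \<bar>W \<omega> - \<A>\<bar>"

text \<open>A majorant of the fourth power of \<open>err\<close>, up to a factor 8, made of scalar
  fourth powers to which \<open>HT_moment4\<close> applies.\<close>

definition err4 :: "'w \<Rightarrow> real" where
  "err4 \<omega> = DIM('b) * (\<Sum>e\<in>Basis. (HT D (\<lambda>z. \<rho> z \<bullet> e) \<omega> - total F (\<lambda>z. \<rho> z \<bullet> e)) ^ 4)
    + (W \<omega> - total F (\<lambda>_. 1)) ^ 4"

lemma total_one: "total F (\<lambda>_. 1 :: real) = \<A>"
  using F by (simp add: total_def set_lebesgue_integral_def fmeasurable_def)

lemma total_inner: "total F \<rho> \<bullet> e = total F (\<lambda>z. \<rho> z \<bullet> e)"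
proof -
  have "set_integrable lebesgue F \<rho>" by (rule set_integrable_bounded_lmeasurable[OF F \<rho>(1) norm_\<rho>])
  then have "(LINT z|lebesgue. (indicat_real F z *\<^sub>R \<rho> z) \<bullet> e) = (LINT z|lebesgue. indicat_real F z *\<^sub>R \<rho> z) \<bullet> e"
    unfolding set_integrable_def by (intro integral_inner_left) auto
  then show ?thesis by (simp add: total_def set_lebesgue_integral_def)
qed

lemma component:
  assumes "e \<in> Basis"
  shows "(\<lambda>z. \<rho> z \<bullet> e) \<in> borel_measurable (lebesgue_on F)" "\<And>z. z \<in> F \<Longrightarrow> \<bar>\<rho> z \<bullet> e\<bar> \<le> r"
  using \<rho>(1) norm_\<rho> Basis_le_norm[OF assms] by (auto intro: order_trans)

lemma err_power4_le: "err \<omega> ^ 4 \<le> 8 * err4 \<omega>"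
proof -
  let ?v = "HT D \<rho> \<omega> - total F \<rho>"
  have n4: "norm ?v ^ 4 \<le> DIM('b) * (\<Sum>e\<in>Basis. (?v \<bullet> e) ^ 4)"
  proof -
    have "(norm ?v)\<^sup>2 = (\<Sum>e\<in>Basis. (?v \<bullet> e)\<^sup>2)"
      unfolding power2_norm_eq_inner by (subst euclidean_inner) (simp add: power2_eq_square)
    moreover have "norm ?v ^ 4 = ((norm ?v)\<^sup>2)\<^sup>2" by (simp only: power_mult[symmetric]) simp
    ultimately have "norm ?v ^ 4 = (\<Sum>e\<in>Basis. (?v \<bullet> e)\<^sup>2)\<^sup>2" by simp
    \<comment> \<open>Cauchy-Schwarz over the coordinates; it is the source of the dimension factor
      in \<open>err4\<close>.\<close>
    also have "\<dots> \<le> (\<Sum>e\<in>Basis. ((?v \<bullet> e)\<^sup>2)\<^sup>2) * DIM('b)" by (rule sum_squared_le_sum_of_squares)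
    finally show ?thesis by (simp add: mult.commute)
  qed
  have "err \<omega> ^ 4 \<le> 8 * norm ?v ^ 4 + 8 * \<bar>W \<omega> - \<A>\<bar> ^ 4"
    unfolding err_def by (rule power4_add_le)
  also have "\<dots> \<le> 8 * (DIM('b) * (\<Sum>e\<in>Basis. (?v \<bullet> e) ^ 4)) + 8 * (W \<omega> - \<A>) ^ 4"
    using n4 by simp
  finally show ?thesis by (simp add: err4_def total_one inner_diff_left total_inner HT_inner)
qed

text \<open>The dimension enters once through the factor in \<open>err4\<close> and once through the
  number of coordinates; the 1 is the share of the estimated area.\<close>

definition Ce :: real where
  "Ce = 1344 * \<kappa>^10 * (real DIM('b) ^ 2 * r ^ 4 + 1)"

lemma err4_moment: "integrable M err4" "(LINT \<omega>|M. err4 \<omega>) \<le> Ce / (n_I D)\<^sup>2"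
proof -
  have one: "(\<lambda>_. 1 :: real) \<in> borel_measurable (lebesgue_on F)" by simp
  have i1: "integrable M (\<lambda>\<omega>. (W \<omega> - total F (\<lambda>_. 1)) ^ 4)"
    and e1: "(LINT \<omega>|M. (W \<omega> - total F (\<lambda>_. 1)) ^ 4) \<le> 1344 * \<kappa>^10 / (n_I D)\<^sup>2"
    using HT_moment4[OF one, of 1] by auto
  have i2: "integrable M (\<lambda>\<omega>. (HT D (\<lambda>z. \<rho> z \<bullet> e) \<omega> - total F (\<lambda>z. \<rho> z \<bullet> e)) ^ 4)"
    and e2: "(LINT \<omega>|M. (HT D (\<lambda>z. \<rho> z \<bullet> e) \<omega> - total F (\<lambda>z. \<rho> z \<bullet> e)) ^ 4) \<le> 1344 * \<kappa>^10 * r^4 / (n_I D)\<^sup>2"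
    if "e \<in> Basis" for e
    using HT_moment4[OF component(1)[OF that] r_nonneg component(2)[OF that]] by auto
  show "integrable M err4"
    unfolding err4_def[abs_def] using i1 i2
    by (intro Bochner_Integration.integrable_add integrable_mult_right Bochner_Integration.integrable_sum) auto
  have "(LINT \<omega>|M. err4 \<omega>) = DIM('b) * (\<Sum>e\<in>Basis. LINT \<omega>|M. (HT D (\<lambda>z. \<rho> z \<bullet> e) \<omega> - total F (\<lambda>z. \<rho> z \<bullet> e)) ^ 4)
      + (LINT \<omega>|M. (W \<omega> - total F (\<lambda>_. 1)) ^ 4)"
    unfolding err4_def using i1 i2
    by (subst Bochner_Integration.integral_add)
      (auto intro!: integrable_mult_right Bochner_Integration.integrable_sum simp: Bochner_Integration.integral_sum)
  also have "\<dots> \<le> DIM('b) * (\<Sum>e\<in>(Basis :: 'b set). 1344 * \<kappa>^10 * r^4 / (n_I D)\<^sup>2) + 1344 * \<kappa>^10 / (n_I D)\<^sup>2"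
    by (intro add_mono mult_left_mono sum_mono e1 e2) auto
  also have "\<dots> = Ce / (n_I D)\<^sup>2"
    by (simp add: Ce_def power2_eq_square algebra_simps add_divide_distrib)
  finally show "(LINT \<omega>|M. err4 \<omega>) \<le> Ce / (n_I D)\<^sup>2" .
qed

lemma W_measurable: "W \<in> borel_measurable M"
  by (rule HT_measurable[of _ 1]) auto

lemma HT_\<rho>_measurable: "HT D \<rho> \<in> borel_measurable M"
  by (rule HT_vector_measurable[OF \<rho>(1) norm_\<rho> r_nonneg])

lemma g_HT_measurable:
  shows "(\<lambda>\<omega>. g (HT D \<rho> \<omega>)) \<in> borel_measurable M"
    and "(\<lambda>\<omega>. gradient g (HT D \<rho> \<omega>)) \<in> borel_measurable M"
proof -
  have c: "cone_pair (HT D \<rho> \<omega>) (W \<omega>)" if "\<omega> \<in> space M" for \<omega>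
    using HT_in_cone[OF K(1) \<rho>(2) that] by (simp add: cone_pair_def)
  show "(\<lambda>\<omega>. g (HT D \<rho> \<omega>)) \<in> borel_measurable M" "(\<lambda>\<omega>. gradient g (HT D \<rho> \<omega>)) \<in> borel_measurable M"
    by (rule borel_measurable_g_cone[OF HT_\<rho>_measurable W_measurable c]; assumption)+
qed

definition q :: real where "q = \<kappa>\<^sup>2 * (1 + r)"
definition C1 :: real where "C1 = L * q\<^sup>2 + G * q / \<A>"
definition C2 :: real where "C2 = \<kappa>\<^sup>2 * (L * q + G / \<A>)"

text \<open>The exceptional set is that of \<open>AE_HT_one_ge\<close>; off it \<open>W\<close> is
  positive, so \<open>HT_in_cone\<close> puts the quotient into \<open>K\<close>.\<close>

lemma AE_plugin:
  "AE \<omega> in M. \<bar>lin_error F D \<rho> g \<omega>\<bar> \<le> C1 * (err \<omega>)\<^sup>2 \<and>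
    norm (gradient g (HT D \<rho> \<omega>) - gradient g (total F \<rho>)) \<le> C2 * err \<omega> \<and>
    norm (gradient g (HT D \<rho> \<omega>)) \<le> G * \<kappa>\<^sup>2"
  using AE_HT_one_ge
proof (rule AE_mp, intro AE_I2 impI)
  fix \<omega> assume \<omega>: "\<omega> \<in> space M" and W: "1 / \<kappa>\<^sup>2 \<le> W \<omega>"
  have "0 < 1 / \<kappa>\<^sup>2" using \<kappa> by simp
  then have "0 < W \<omega>" using W by linarith
  then have vK: "HT D \<rho> \<omega> /\<^sub>R W \<omega> \<in> K" using HT_in_cone[OF K(1) \<rho>(2) \<omega>] by auto
  have m: "\<A> *\<^sub>R (total F \<rho> /\<^sub>R \<A>) = total F \<rho>" using A by simp
  note pb = plugin_bounds[OF A mean \<kappa> G r W vK, unfolded m]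
  show "\<bar>lin_error F D \<rho> g \<omega>\<bar> \<le> C1 * (err \<omega>)\<^sup>2 \<and>
    norm (gradient g (HT D \<rho> \<omega>) - gradient g (total F \<rho>)) \<le> C2 * err \<omega> \<and>
    norm (gradient g (HT D \<rho> \<omega>)) \<le> G * \<kappa>\<^sup>2"
    unfolding lin_error_def theta_hat_def C1_def C2_def q_def err_def using pb by blast
qed

lemma norm_gradient_total: "norm (gradient g (total F \<rho>)) \<le> G / \<A>"
proof -
  have "gradient g (\<A> *\<^sub>R (total F \<rho> /\<^sub>R \<A>)) = gradient g (total F \<rho> /\<^sub>R \<A>) /\<^sub>R \<A>"
    by (rule gradient_scale[OF mean A])
  then have "norm (gradient g (total F \<rho>)) = norm (gradient g (total F \<rho> /\<^sub>R \<A>)) / \<A>"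
    using A by (simp add: divide_inverse mult.commute)
  then show ?thesis using G[OF mean] A by (simp add: divide_right_mono)
qed

text \<open>The linearization error is bounded by the square of \<open>err\<close>, so its second
  moment is controlled by the fourth moment of \<open>err\<close>.\<close>

lemma lin_error_moment:
  "integrable M (\<lambda>\<omega>. (lin_error F D \<rho> g \<omega>)\<^sup>2)"
  "(LINT \<omega>|M. (lin_error F D \<rho> g \<omega>)\<^sup>2) \<le> 8 * C1\<^sup>2 * Ce / (n_I D)\<^sup>2"
proof -
  have le: "AE \<omega> in M. (lin_error F D \<rho> g \<omega>)\<^sup>2 \<le> C1\<^sup>2 * (8 * err4 \<omega>)"
    using AE_plugin
  proof eventually_elim
    case (elim \<omega>)
    then have "(lin_error F D \<rho> g \<omega>)\<^sup>2 \<le> (C1 * (err \<omega>)\<^sup>2)\<^sup>2"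
      using power_mono[of "\<bar>lin_error F D \<rho> g \<omega>\<bar>" "C1 * (err \<omega>)\<^sup>2" 2] by simp
    also have "\<dots> = C1\<^sup>2 * err \<omega> ^ 4" by (simp add: power_mult_distrib flip: power_mult)
    also have "\<dots> \<le> C1\<^sup>2 * (8 * err4 \<omega>)" by (intro mult_left_mono err_power4_le) auto
    finally show ?case .
  qed
  have i: "integrable M (\<lambda>\<omega>. C1\<^sup>2 * (8 * err4 \<omega>))" using err4_moment(1) by simp
  have "(\<lambda>\<omega>. lin_error F D \<rho> g \<omega>) \<in> borel_measurable M"
    unfolding lin_error_def theta_hat_def
    by (intro borel_measurable_diff borel_measurable_inner borel_measurable_const g_HT_measurable(1) HT_\<rho>_measurable)
  then have meas: "(\<lambda>\<omega>. (lin_error F D \<rho> g \<omega>)\<^sup>2) \<in> borel_measurable M" by simp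
  show int: "integrable M (\<lambda>\<omega>. (lin_error F D \<rho> g \<omega>)\<^sup>2)"
    by (rule Bochner_Integration.integrable_bound[OF i meas]) (use le in eventually_elim, auto)
  have "(LINT \<omega>|M. (lin_error F D \<rho> g \<omega>)\<^sup>2) \<le> (LINT \<omega>|M. C1\<^sup>2 * (8 * err4 \<omega>))"
    by (rule integral_mono_AE[OF int i le])
  also have "\<dots> = 8 * C1\<^sup>2 * (LINT \<omega>|M. err4 \<omega>)" by simp
  also have "\<dots> \<le> 8 * C1\<^sup>2 * (Ce / (n_I D)\<^sup>2)" by (intro mult_left_mono err4_moment(2)) auto
  finally show "(LINT \<omega>|M. (lin_error F D \<rho> g \<omega>)\<^sup>2) \<le> 8 * C1\<^sup>2 * Ce / (n_I D)\<^sup>2" by simp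
qed

lemma lin_measurable: "(\<lambda>z. v \<bullet> \<rho> z) \<in> borel_measurable (lebesgue_on F)"
  using \<rho>(1) by simp

lemma lin_bound:
  assumes "z \<in> F" "norm v \<le> c"
  shows "\<bar>v \<bullet> \<rho> z\<bar> \<le> c * r"
proof -
  have "\<bar>v \<bullet> \<rho> z\<bar> \<le> norm v * norm (\<rho> z)" by (rule Cauchy_Schwarz_ineq2)
  also have "\<dots> \<le> c * r" using assms norm_\<rho> r_nonneg order_trans[OF norm_ge_zero assms(2)]
    by (intro mult_mono) auto
  finally show ?thesis .
qed

text \<open>The outcome enters both through the coefficient vector and through the point. Expansion
  in the basis separates the two into products of measurable functions.\<close>

lemma wr_lin_measurable:
  assumes v: "v \<in> borel_measurable M" and i: "i < N_I D" "k < n_II D i"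
  shows "(\<lambda>\<omega>. wr (\<lambda>z. v \<omega> \<bullet> \<rho> z) i (pt \<omega> (i, k))) \<in> borel_measurable M"
proof -
  have "wr (\<lambda>z. v \<omega> \<bullet> \<rho> z) i (pt \<omega> (i, k)) = (\<Sum>e\<in>Basis. (v \<omega> \<bullet> e) * wr (\<lambda>z. \<rho> z \<bullet> e) i (pt \<omega> (i, k)))" for \<omega>
    unfolding wr_def by (subst euclidean_inner) (simp add: sum_divide_distrib)
  moreover have "(\<lambda>\<omega>. wr (\<lambda>z. \<rho> z \<bullet> e) i (pt \<omega> (i, k))) \<in> borel_measurable M" if "e \<in> Basis" for e
    using measurable_compose[OF point_measurable wr_measurable[OF component(1)[OF that] i(1)], of "(i, k)"] i
    by (simp add: S.idx_def)
  ultimately show ?thesis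
    using v by (simp add: borel_measurable_sum borel_measurable_times borel_measurable_inner)
qed

text \<open>Unlike in \<open>statistic_measurable\<close>, \<open>h s\<close> may depend on the
  whole outcome, as the plug-in gradient does, and not only on the points of the PSUs in
  \<open>s\<close>.\<close>

lemma sample_measurable:
  assumes "\<And>s. s \<subseteq> {..<N_I D} \<Longrightarrow> card s = n_I D \<Longrightarrow> (\<lambda>\<omega>. h s \<omega>) \<in> borel_measurable M"
  shows "(\<lambda>\<omega>. h (fst_sample D \<omega>) \<omega> :: real) \<in> borel_measurable M"
proof -
  have "(\<lambda>\<omega>. \<Sum>s | s \<subseteq> {..<N_I D} \<and> card s = n_I D. indicat_real (fst_event D s) \<omega> * h s \<omega>) \<in> borel_measurable M"
    using assms by (intro borel_measurable_sum borel_measurable_times borel_measurable_indicator fst_event_sets) auto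
  moreover have "h (fst_sample D \<omega>) \<omega> = (\<Sum>s | s \<subseteq> {..<N_I D} \<and> card s = n_I D. indicat_real (fst_event D s) \<omega> * h s \<omega>)"
    if "\<omega> \<in> space M" for \<omega>
    by (rule sample_decomp[OF that, of "\<lambda>s. h s \<omega>"])
  ultimately show ?thesis by (simp cong: measurable_cong)
qed

lemma V_plugin_measurable:
  "V_HT_plugin D \<rho> g \<in> borel_measurable M" "V_YG_plugin D \<rho> g \<in> borel_measurable M"
proof -
  let ?w = "\<lambda>\<omega>. wr (\<lambda>z. gradient g (HT D \<rho> \<omega>) \<bullet> \<rho> z)"
  have w: "(\<lambda>\<omega>. ?w \<omega> i (pt \<omega> (i, k))) \<in> borel_measurable M" if "i < N_I D" "k < n_II D i" for i k
    by (rule wr_lin_measurable[OF g_HT_measurable(2) that])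
  have T: "(\<lambda>\<omega>. S.T (?w \<omega>) i (pt \<omega>)) \<in> borel_measurable M" if "i < N_I D" for i
    unfolding S.T_def using that by (intro borel_measurable_sum w) auto
  have y: "(\<lambda>\<omega>. S.y (?w \<omega>) i (pt \<omega>)) \<in> borel_measurable M" if "i < N_I D" for i
    unfolding S.y_def by (intro borel_measurable_divide T that borel_measurable_const)
  have vh: "(\<lambda>\<omega>. S.vh (?w \<omega>) i (pt \<omega>)) \<in> borel_measurable M" if "i < N_I D" for i
    unfolding S.vh_def using that
    by (intro borel_measurable_times borel_measurable_sum borel_measurable_power borel_measurable_diff
        borel_measurable_divide w T borel_measurable_const) auto
  have "(\<lambda>\<omega>. S.ZHT (?w \<omega>) s (pt \<omega>)) \<in> borel_measurable M" if "s \<subseteq> {..<N_I D}" for s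
    unfolding S.ZHT_def using that
    by (intro borel_measurable_add borel_measurable_times borel_measurable_sum borel_measurable_divide y vh borel_measurable_const) auto
  from sample_measurable[of "\<lambda>s \<omega>. S.ZHT (?w \<omega>) s (pt \<omega>)", OF this]
  show "V_HT_plugin D \<rho> g \<in> borel_measurable M"
    by (simp add: V_HT_plugin_def[abs_def] l_hat_def[abs_def] V_HT_eq)
  have "(\<lambda>\<omega>. S.ZYG (?w \<omega>) s (pt \<omega>)) \<in> borel_measurable M" if "s \<subseteq> {..<N_I D}" for s
    unfolding S.ZYG_def using that
    by (intro borel_measurable_add borel_measurable_times borel_measurable_sum borel_measurable_divide
        borel_measurable_power borel_measurable_diff y vh borel_measurable_const) auto
  from sample_measurable[of "\<lambda>s \<omega>. S.ZYG (?w \<omega>) s (pt \<omega>)", OF this]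
  show "V_YG_plugin D \<rho> g \<in> borel_measurable M"
    by (simp add: V_YG_plugin_def[abs_def] l_hat_def[abs_def] V_YG_eq)
qed

text \<open>The constant of \<open>V_diff_le\<close> for variables bounded by
  \<open>G * \<kappa>\<^sup>2 * r\<close> and \<open>G / \<A> * r\<close> whose difference is at
  most \<open>C2 * err \<omega> * r\<close>, with \<open>err \<omega>\<close> taken out.\<close>

definition C3 :: real where
  "C3 = 8 * \<kappa>^6 * (C2 * r) * (G * \<kappa>\<^sup>2 * r + G / \<A> * r)"

definition Cv :: real where
  "Cv = C3 * (1 + 8 * Ce) + (1 + 5000 * \<kappa>^15 * (G / \<A> * r) ^ 4)"

lemma C2_nonneg: "0 \<le> C2"
  using L G_nonneg r_nonneg A by (auto simp: C2_def q_def intro!: mult_nonneg_nonneg add_nonneg_nonneg)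

lemma C3_nonneg: "0 \<le> C3"
  using \<kappa> C2_nonneg G_nonneg r_nonneg A by (auto simp: C3_def intro!: mult_nonneg_nonneg add_nonneg_nonneg)

text \<open>A fourth moment bounds a first moment through this inequality. With \<open>c\<close>
  equal to n^(-1/2) and \<open>err4\<close> of order n^-2 in the mean, both terms are of order
  n^(-1/2).\<close>

lemma err_le:
  assumes "0 < c" shows "err \<omega> \<le> c + 8 * err4 \<omega> / c ^ 3"
proof -
  have e0: "0 \<le> err \<omega>" by (simp add: err_def)
  have "err \<omega> \<le> c + err \<omega> ^ 4 / c ^ 3"
  proof (cases "err \<omega> \<le> c")
    case True then show ?thesis using assms e0 by (simp add: add_increasing2)
  next
    case False
    then have "err \<omega> * c ^ 3 \<le> err \<omega> * err \<omega> ^ 3"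
      using assms e0 by (intro mult_left_mono power_mono) auto
    then have "err \<omega> \<le> err \<omega> ^ 4 / c ^ 3"
      using assms by (simp add: pos_le_divide_eq eval_nat_numeral)
    then show ?thesis using assms by linarith
  qed
  also have "\<dots> \<le> c + 8 * err4 \<omega> / c ^ 3"
    using assms err_power4_le by (intro add_left_mono divide_right_mono) auto
  finally show ?thesis .
qed

text \<open>The triangle inequality through the estimator \<open>Vl\<close> for the linearized
  variable. After multiplication by n the first part is at most a multiple of \<open>err\<close>,
  and the second is n * n^(-3/2).\<close>

lemma V_plugin_moment_aux:
  fixes V :: "'w \<Rightarrow> real" and Vl :: "'w \<Rightarrow> real" and v :: real
  assumes meas: "V \<in> borel_measurable M"
    and diff: "AE \<omega> in M. \<bar>V \<omega> - Vl \<omega>\<bar> \<le> C3 * err \<omega> / n_I D"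
    and int: "integrable M (\<lambda>\<omega>. \<bar>Vl \<omega> - v\<bar>)"
    and E: "(LINT \<omega>|M. \<bar>Vl \<omega> - v\<bar>) \<le> (1 + 5000 * \<kappa>^15 * (G / \<A> * r) ^ 4) * n_I D powr (- 3 / 2)"
  shows "integrable M (\<lambda>\<omega>. n_I D * \<bar>V \<omega> - v\<bar>)"
    and "(LINT \<omega>|M. n_I D * \<bar>V \<omega> - v\<bar>) \<le> Cv * n_I D powr (- 1 / 2)"
proof -
  let ?n = "real (n_I D)"
  let ?c = "?n powr (- 1 / 2)"
  let ?X = "\<lambda>\<omega>. C3 * (?c + 8 * err4 \<omega> / ?c ^ 3) + ?n * \<bar>Vl \<omega> - v\<bar>"
  have n0: "0 < ?n" using n by simp
  have c: "0 < ?c" using n by simp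
  have le: "AE \<omega> in M. ?n * \<bar>V \<omega> - v\<bar> \<le> ?X \<omega>"
    using diff
  proof eventually_elim
    case (elim \<omega>)
    have "?n * \<bar>V \<omega> - v\<bar> \<le> ?n * (\<bar>V \<omega> - Vl \<omega>\<bar> + \<bar>Vl \<omega> - v\<bar>)"
      by (intro mult_left_mono) auto
    also have "\<dots> \<le> ?n * (C3 * err \<omega> / ?n + \<bar>Vl \<omega> - v\<bar>)"
      using elim by (intro mult_left_mono add_right_mono) auto
    also have "\<dots> = C3 * err \<omega> + ?n * \<bar>Vl \<omega> - v\<bar>"
      using n0 by (simp add: distrib_left)
    also have "\<dots> \<le> ?X \<omega>"
      by (intro add_right_mono mult_left_mono err_le c C3_nonneg)
    finally show ?case .
  qed
  have i4: "integrable M (\<lambda>\<omega>. ?c + 8 * err4 \<omega> / ?c ^ 3)"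
    using err4_moment(1) by simp
  have iX: "integrable M ?X" using i4 int by simp
  show iV: "integrable M (\<lambda>\<omega>. n_I D * \<bar>V \<omega> - v\<bar>)"
  proof (rule Bochner_Integration.integrable_bound[OF iX])
    show "(\<lambda>\<omega>. n_I D * \<bar>V \<omega> - v\<bar>) \<in> borel_measurable M" using meas by simp
    show "AE \<omega> in M. norm (n_I D * \<bar>V \<omega> - v\<bar>) \<le> norm (?X \<omega>)"
      using le by eventually_elim auto
  qed
  have "(LINT \<omega>|M. n_I D * \<bar>V \<omega> - v\<bar>) \<le> (LINT \<omega>|M. ?X \<omega>)"
    by (rule integral_mono_AE[OF iV iX le])
  also have "\<dots> = (LINT \<omega>|M. C3 * (?c + 8 * err4 \<omega> / ?c ^ 3)) + (LINT \<omega>|M. ?n * \<bar>Vl \<omega> - v\<bar>)"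
    using i4 int by (intro Bochner_Integration.integral_add) simp_all
  also have "(LINT \<omega>|M. C3 * (?c + 8 * err4 \<omega> / ?c ^ 3)) = C3 * (?c + 8 * (LINT \<omega>|M. err4 \<omega>) / ?c ^ 3)"
    using err4_moment(1) by (simp add: M.prob_space)
  also have "(LINT \<omega>|M. ?n * \<bar>Vl \<omega> - v\<bar>) = ?n * (LINT \<omega>|M. \<bar>Vl \<omega> - v\<bar>)" by simp
  also have "C3 * (?c + 8 * (LINT \<omega>|M. err4 \<omega>) / ?c ^ 3) + ?n * (LINT \<omega>|M. \<bar>Vl \<omega> - v\<bar>)
    \<le> C3 * (?c + 8 * (Ce / (n_I D)\<^sup>2) / ?c ^ 3) + ?n * ((1 + 5000 * \<kappa>^15 * (G / \<A> * r) ^ 4) * ?n powr (- 3 / 2))"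
    using c n0 C3_nonneg err4_moment(2) E
    by (intro add_mono mult_left_mono divide_right_mono order_refl) auto
  \<comment> \<open>The choice of \<open>?c\<close> makes its fourth power equal to n^-2, so
    division by the cube leaves one factor \<open>?c\<close>.\<close>
  also have "8 * (Ce / (n_I D)\<^sup>2) / ?c ^ 3 = 8 * Ce * ?c"
  proof -
    have "?c * ?c = ?n powr (- 1)" using powr_add[of ?n "- 1 / 2" "- 1 / 2"] by simp
    moreover have "?n powr (- 1) * ?n powr (- 1) = ?n powr (- 2)" using powr_add[of ?n "- 1" "- 1"] by simp
    ultimately have "?c ^ 4 = ?n powr (- 2)" by (simp only: power4_eq_xxxx mult.assoc)
    also have "\<dots> = 1 / ?n\<^sup>2" using n0 by (simp add: powr_minus_divide)
    finally have "?c * ?c ^ 3 = 1 / ?n\<^sup>2" by (simp add: eval_nat_numeral)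
    then show ?thesis using c by (simp add: field_simps)
  qed
  also have "?n * ((1 + 5000 * \<kappa>^15 * (G / \<A> * r) ^ 4) * ?n powr (- 3 / 2)) = (1 + 5000 * \<kappa>^15 * (G / \<A> * r) ^ 4) * ?c"
  proof -
    have "?n * ?n powr (- 3 / 2) = ?c" using n0 powr_mult_base[of ?n "- 3 / 2"] by simp
    then show ?thesis by (metis mult.left_commute)
  qed
  finally show "(LINT \<omega>|M. n_I D * \<bar>V \<omega> - v\<bar>) \<le> Cv * ?c"
    by (simp add: Cv_def algebra_simps)
qed

lemma AE_V_plugin_diff:
  shows "AE \<omega> in M. \<bar>V_HT_plugin D \<rho> g \<omega> - V_HT D (lin_var F \<rho> g) \<omega>\<bar> \<le> C3 * err \<omega> / n_I D"
    and "AE \<omega> in M. \<bar>V_YG_plugin D \<rho> g \<omega> - V_YG D (lin_var F \<rho> g) \<omega>\<bar> \<le> C3 * err \<omega> / n_I D"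
proof -
  have *: "\<bar>V_HT_plugin D \<rho> g \<omega> - V_HT D (lin_var F \<rho> g) \<omega>\<bar> \<le> C3 * err \<omega> / n_I D \<and>
      \<bar>V_YG_plugin D \<rho> g \<omega> - V_YG D (lin_var F \<rho> g) \<omega>\<bar> \<le> C3 * err \<omega> / n_I D"
    if \<omega>: "\<omega> \<in> space M" and b1: "norm (gradient g (HT D \<rho> \<omega>) - gradient g (total F \<rho>)) \<le> C2 * err \<omega>"
      and b2: "norm (gradient g (HT D \<rho> \<omega>)) \<le> G * \<kappa>\<^sup>2" for \<omega>
  proof -
    let ?v = "gradient g (HT D \<rho> \<omega>)" and ?u = "gradient g (total F \<rho>)"
    have e0: "0 \<le> err \<omega>" by (simp add: err_def)
    have n1: "0 \<le> G * \<kappa>\<^sup>2 * r" "0 \<le> G / \<A> * r" "0 \<le> C2 * err \<omega> * r"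
      using G_nonneg r_nonneg A C2_nonneg e0 by auto
    have d: "\<bar>?v \<bullet> \<rho> z - ?u \<bullet> \<rho> z\<bar> \<le> C2 * err \<omega> * r" if "z \<in> F" for z
      using lin_bound[OF that b1] by (simp add: inner_diff_left)
    have eq: "8 * \<kappa>^6 * (C2 * err \<omega> * r) * (G * \<kappa>\<^sup>2 * r + G / \<A> * r) / n_I D = C3 * err \<omega> / n_I D"
      by (simp add: C3_def mult_ac)
    note V = V_diff_le[OF lin_measurable n1(1) lin_bound[OF _ b2] lin_measurable n1(2) lin_bound[OF _ norm_gradient_total] n1(3) d \<omega>]
    show ?thesis
      unfolding V_HT_plugin_def V_YG_plugin_def l_hat_def[abs_def] lin_var_def[abs_def] eq[symmetric]
      using V by blast
  qed
  show "AE \<omega> in M. \<bar>V_HT_plugin D \<rho> g \<omega> - V_HT D (lin_var F \<rho> g) \<omega>\<bar> \<le> C3 * err \<omega> / n_I D"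
    by (rule AE_mp[OF AE_plugin]) (use * in \<open>auto intro!: AE_I2\<close>)
  show "AE \<omega> in M. \<bar>V_YG_plugin D \<rho> g \<omega> - V_YG D (lin_var F \<rho> g) \<omega>\<bar> \<le> C3 * err \<omega> / n_I D"
    by (rule AE_mp[OF AE_plugin]) (use * in \<open>auto intro!: AE_I2\<close>)
qed

lemma V_plugin_moment:
  shows "integrable M (\<lambda>\<omega>. n_I D * \<bar>V_HT_plugin D \<rho> g \<omega> - V_lin F D \<rho> g\<bar>)"
    and "(LINT \<omega>|M. n_I D * \<bar>V_HT_plugin D \<rho> g \<omega> - V_lin F D \<rho> g\<bar>) \<le> Cv * n_I D powr (- 1 / 2)"
    and "integrable M (\<lambda>\<omega>. n_I D * \<bar>V_YG_plugin D \<rho> g \<omega> - V_lin F D \<rho> g\<bar>)"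
    and "(LINT \<omega>|M. n_I D * \<bar>V_YG_plugin D \<rho> g \<omega> - V_lin F D \<rho> g\<bar>) \<le> Cv * n_I D powr (- 1 / 2)"
proof -
  have l: "lin_var F \<rho> g \<in> borel_measurable (lebesgue_on F)"
    unfolding lin_var_def[abs_def] by (rule lin_measurable)
  have b: "0 \<le> G / \<A> * r" "\<And>z. z \<in> F \<Longrightarrow> \<bar>lin_var F \<rho> g z\<bar> \<le> G / \<A> * r"
    using G_nonneg r_nonneg A lin_bound[OF _ norm_gradient_total] by (simp_all add: lin_var_def)
  note HT = V_HT_moment[OF l b] and YG = V_YG_moment[OF l b]
  show "integrable M (\<lambda>\<omega>. n_I D * \<bar>V_HT_plugin D \<rho> g \<omega> - V_lin F D \<rho> g\<bar>)"
    and "(LINT \<omega>|M. n_I D * \<bar>V_HT_plugin D \<rho> g \<omega> - V_lin F D \<rho> g\<bar>) \<le> Cv * n_I D powr (- 1 / 2)"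
    and "integrable M (\<lambda>\<omega>. n_I D * \<bar>V_YG_plugin D \<rho> g \<omega> - V_lin F D \<rho> g\<bar>)"
    and "(LINT \<omega>|M. n_I D * \<bar>V_YG_plugin D \<rho> g \<omega> - V_lin F D \<rho> g\<bar>) \<le> Cv * n_I D powr (- 1 / 2)"
    unfolding V_lin_def
    by (rule V_plugin_moment_aux[OF V_plugin_measurable(1) AE_V_plugin_diff(1) HT]; assumption)+
      (rule V_plugin_moment_aux[OF V_plugin_measurable(2) AE_V_plugin_diff(2) YG]; assumption)+
qed

end

section \<open>From the assumptions on the sequence to the theorem\<close>

lemma regular_survey_of_assumptions:
  fixes F :: "'a::euclidean_space set" and D :: "nat \<Rightarrow> ('w, 'a) two_stage_design"
  assumes F: "F \<in> lmeasurable" "0 < measure lebesgue F"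
    and sampling: "\<And>t. two_stage_sampling F (D t)"
    and fs1: "FS1 D" and fs2: "FS2 D" and fs3: "FS3 D" and ss1: "SS1 F D"
  obtains \<kappa> where "\<And>t. regular_survey F (D t) \<kappa>"
proof -
  let ?A = "measure lebesgue F"
  obtain c C where c: "0 < c" "c \<le> C"
    and pi: "\<And>t i. i < N_I (D t) \<Longrightarrow> c \<le> real (N_I (D t)) / real (n_I (D t)) * pi_I (D t) i"
      "\<And>t i. i < N_I (D t) \<Longrightarrow> real (N_I (D t)) / real (n_I (D t)) * pi_I (D t) i \<le> C"
  proof -
    show thesis using fs1 unfolding FS1_def by - (elim exE conjE, rule that; (assumption | blast))
  qed
  obtain C2 C3 C4 where C: "0 < C2" "0 < C3" "0 < C4"
    and cm: "\<And>t J. J \<subseteq> {..<N_I (D t)} \<Longrightarrow> card J = 2 \<Longrightarrow>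
          \<bar>central_moment (D t) J\<bar> \<le> C2 * real (n_I (D t)) / real (N_I (D t)) ^ 2"
      "\<And>t J. J \<subseteq> {..<N_I (D t)} \<Longrightarrow> card J = 3 \<Longrightarrow>
          \<bar>central_moment (D t) J\<bar> \<le> C3 * real (n_I (D t)) ^ 2 / real (N_I (D t)) ^ 3"
      "\<And>t J. J \<subseteq> {..<N_I (D t)} \<Longrightarrow> card J = 4 \<Longrightarrow>
          \<bar>central_moment (D t) J\<bar> \<le> C4 * real (n_I (D t)) ^ 2 / real (N_I (D t)) ^ 4"
  proof -
    show thesis using fs2 unfolding FS2_def by - (elim exE conjE, rule that; (assumption | blast))
  qed
  obtain c3 where c3: "0 < c3" and pi2: "\<And>t i j. i < N_I (D t) \<Longrightarrow> j < N_I (D t) \<Longrightarrow> i \<noteq> j \<Longrightarrow>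
      c3 * real (n_I (D t)) ^ 2 / real (N_I (D t)) ^ 2 \<le> pi_I2 (D t) i j"
  proof -
    show thesis using fs3 unfolding FS3_def by - (elim exE conjE, rule that; (assumption | blast))
  qed
  obtain p1 P1 c1 C1 where p1: "0 < p1" "p1 \<le> P1" "0 < c1" "c1 \<le> C1"
    and area: "\<And>t i. i < N_I (D t) \<Longrightarrow> p1 * ?A / real (N_I (D t)) \<le> measure lebesgue (psu (D t) i)"
      "\<And>t i. i < N_I (D t) \<Longrightarrow> measure lebesgue (psu (D t) i) \<le> P1 * ?A / real (N_I (D t))"
    and dens: "\<And>t i x. i < N_I (D t) \<Longrightarrow> x \<in> psu (D t) i \<Longrightarrow> c1 / measure lebesgue (psu (D t) i) \<le> dens (D t) i x"
      "\<And>t i x. i < N_I (D t) \<Longrightarrow> x \<in> psu (D t) i \<Longrightarrow> dens (D t) i x \<le> C1 / measure lebesgue (psu (D t) i)"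
    and n_II: "\<And>t i. i < N_I (D t) \<Longrightarrow> 2 \<le> n_II (D t) i"
  proof -
    show thesis using ss1 unfolding SS1_def by - (elim exE conjE, rule that; (assumption | blast))
  qed
  \<comment> \<open>A sum of positive terms dominates each of them. The last two combine area and
    density bounds into the lower and the upper bound of the density by multiples of the number of
    PSUs.\<close>
  define \<kappa> where "\<kappa> = 1 + C + 1 / c + C2 + C3 + C4 + 1 / c3 + P1 * ?A / c1 + C1 / (p1 * ?A)"
  have pos: "0 < C" "0 < 1 / c" "0 < 1 / c3" "0 < P1 * ?A / c1" "0 < C1 / (p1 * ?A)"
    using c c3 p1 F by auto
  have \<kappa>: "1 \<le> \<kappa>" "C \<le> \<kappa>" "1 / c \<le> \<kappa>" "C2 \<le> \<kappa>" "C3 \<le> \<kappa>" "C4 \<le> \<kappa>" "1 / c3 \<le> \<kappa>"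
      "P1 * ?A / c1 \<le> \<kappa>" "C1 / (p1 * ?A) \<le> \<kappa>"
    using pos C unfolding \<kappa>_def by linarith+
  have "regular_survey F (D t) \<kappa>" for t
  proof
    let ?N = "N_I (D t)" and ?n = "n_I (D t)"
    show "two_stage_sampling F (D t)" "F \<in> lmeasurable" "1 \<le> \<kappa>" by (rule sampling, rule F, rule \<kappa>)
    \<comment> \<open>Without PSUs the union would be empty, whereas \<open>F\<close> has positive
      measure.\<close>
    have "(\<Union>i<?N. psu (D t) i) = F" using sampling[of t] by (simp add: two_stage_sampling_def partition_of_def)
    then show N: "0 < ?N" using F(2) by (cases "?N = 0") auto
    \<comment> \<open>For \<open>?n = 0\<close> the quotient in the first-stage assumption is 0 by
      the convention on division, against its positive lower bound.\<close>
    show n: "0 < ?n" using pi(1)[OF N] c by (cases "?n = 0") auto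
    show "2 \<le> n_II (D t) i" if "i < ?N" for i by (rule n_II[OF that])
    show "pi_I (D t) i \<le> \<kappa> * ?n / ?N" if i: "i < ?N" for i
    proof -
      have "pi_I (D t) i \<le> C * ?n / ?N" using pi(2)[OF i] n N by (simp add: field_simps)
      also have "\<dots> \<le> \<kappa> * ?n / ?N" using \<kappa> by (intro divide_right_mono mult_right_mono) auto
      finally show ?thesis .
    qed
    show "?n / ?N \<le> \<kappa> * pi_I (D t) i" if i: "i < ?N" for i
    proof -
      have le: "?n / ?N \<le> (1 / c) * pi_I (D t) i" using pi(1)[OF i] n N c by (simp add: field_simps)
      have "0 < ?n / ?N" using n N by simp
      then have "0 < (1 / c) * pi_I (D t) i" using le by linarith
      then have "0 < pi_I (D t) i" using c by (simp add: zero_less_divide_iff)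
      then have "(1 / c) * pi_I (D t) i \<le> \<kappa> * pi_I (D t) i" using \<kappa> by (intro mult_right_mono) auto
      then show ?thesis using le by linarith
    qed
    show "?n\<^sup>2 / ?N\<^sup>2 \<le> \<kappa> * pi_I2 (D t) i j" if ij: "i < ?N" "j < ?N" "i \<noteq> j" for i j
    proof -
      have le: "real ?n ^ 2 / real ?N ^ 2 \<le> (1 / c3) * pi_I2 (D t) i j"
        using pi2[OF ij] N c3 by (simp add: field_simps)
      have "0 \<le> c3 * real ?n ^ 2 / real ?N ^ 2" using c3 by simp
      then have "0 \<le> pi_I2 (D t) i j" using pi2[OF ij] by linarith
      then have "(1 / c3) * pi_I2 (D t) i j \<le> \<kappa> * pi_I2 (D t) i j" using \<kappa> by (intro mult_right_mono) auto
      then show ?thesis using le by simp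
    qed
    show "\<bar>central_moment (D t) J\<bar> \<le> \<kappa> * ?n / ?N ^ 2" if "J \<subseteq> {..<?N}" "card J = 2" for J
      by (rule order_trans[OF cm(1)[OF that]]) (auto intro!: divide_right_mono mult_right_mono \<kappa>)
    show "\<bar>central_moment (D t) J\<bar> \<le> \<kappa> * ?n ^ 2 / ?N ^ 3" if "J \<subseteq> {..<?N}" "card J = 3" for J
      by (rule order_trans[OF cm(2)[OF that]]) (auto intro!: divide_right_mono mult_right_mono \<kappa>)
    show "\<bar>central_moment (D t) J\<bar> \<le> \<kappa> * ?n ^ 2 / ?N ^ 4" if "J \<subseteq> {..<?N}" "card J = 4" for J
      by (rule order_trans[OF cm(3)[OF that]]) (auto intro!: divide_right_mono mult_right_mono \<kappa>)
    fix i x assume i: "i < ?N" and x: "x \<in> psu (D t) i"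
    let ?a = "measure lebesgue (psu (D t) i)"
    have "0 < p1 * ?A / ?N" using p1 F N by simp
    then have a: "0 < ?a" using area(1)[OF i] by linarith
    have d0: "0 < dens (D t) i x" using dens(1)[OF i x] a p1 by (smt (verit) divide_pos_pos)
    have "real ?N \<le> (P1 * ?A / c1) * (c1 / ?a)"
      using area(2)[OF i] a p1 N by (simp add: field_simps)
    also have "\<dots> \<le> \<kappa> * dens (D t) i x"
      using dens(1)[OF i x] \<kappa> a p1 by (intro mult_mono) auto
    finally show "?N \<le> \<kappa> * dens (D t) i x" .
    have "dens (D t) i x \<le> C1 / ?a" by (rule dens(2)[OF i x])
    also have "\<dots> \<le> C1 / (p1 * ?A / ?N)"
      using area(1)[OF i] p1 F N a by (intro divide_left_mono) auto
    also have "\<dots> = (C1 / (p1 * ?A)) * ?N" by simp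
    also have "\<dots> \<le> \<kappa> * ?N" using \<kappa> by (intro mult_right_mono) auto
    finally show "dens (D t) i x \<le> \<kappa> * ?N" .
  qed
  then show ?thesis by (rule that)
qed

theorem proposition5:
  fixes F :: "(real ^ 'd) set"
    and D :: "nat \<Rightarrow> ('w, real ^ 'd) two_stage_design"
    and \<rho> :: "real ^ 'd \<Rightarrow> real ^ 'q"
    and g :: "real ^ 'q \<Rightarrow> real"
  assumes "bounded F" and "F \<in> sets lebesgue" and "0 < measure lebesgue F"
    and "\<rho> \<in> borel_measurable (lebesgue_on F)"
    and "\<And>t. two_stage_sampling F (D t)"
    and "filterlim (\<lambda>t. N_I (D t)) at_top sequentially"
    and "filterlim (\<lambda>t. n_I (D t)) at_top sequentially"
    and "(\<lambda>t. Max ((\<lambda>i. diameter (psu (D t) i)) ` {..<N_I (D t)})) \<longlonglongrightarrow> 0"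
    and "FS1 D" and "FS2 D" and "FS3 D" and "SS1 F D" and "PI1 g" and "PI2 F \<rho> g"
  shows "(\<forall>t. integrable (pspace (D t))
            (\<lambda>\<omega>. (lin_error F (D t) \<rho> g \<omega>)\<^sup>2)) \<and>
         (\<lambda>t. LINT \<omega>|pspace (D t). (lin_error F (D t) \<rho> g \<omega>)\<^sup>2)
            \<in> O(\<lambda>t. real (n_I (D t)) powr (- 2)) \<and>
         (\<forall>t. integrable (pspace (D t))
            (\<lambda>\<omega>. real (n_I (D t)) * \<bar>V_HT_plugin (D t) \<rho> g \<omega> - V_lin F (D t) \<rho> g\<bar>)) \<and>
         (\<lambda>t. LINT \<omega>|pspace (D t). real (n_I (D t)) * \<bar>V_HT_plugin (D t) \<rho> g \<omega> - V_lin F (D t) \<rho> g\<bar>)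
            \<in> O(\<lambda>t. real (n_I (D t)) powr (- 1 / 2)) \<and>
         (\<forall>t. integrable (pspace (D t))
            (\<lambda>\<omega>. real (n_I (D t)) * \<bar>V_YG_plugin (D t) \<rho> g \<omega> - V_lin F (D t) \<rho> g\<bar>)) \<and>
         (\<lambda>t. LINT \<omega>|pspace (D t). real (n_I (D t)) * \<bar>V_YG_plugin (D t) \<rho> g \<omega> - V_lin F (D t) \<rho> g\<bar>)
            \<in> O(\<lambda>t. real (n_I (D t)) powr (- 1 / 2))"
proof -
  let ?A = "measure lebesgue F"
  have Fm: "F \<in> lmeasurable" using assms(1,2) by (rule bounded_set_imp_lmeasurable)
  obtain \<kappa> where survey: "\<And>t. regular_survey F (D t) \<kappa>"
    using regular_survey_of_assumptions[OF Fm assms(3,5,9-12)] by blast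
  obtain K L where K: "convex K" "compact K" and \<rho>K: "\<rho> ` F \<subseteq> K"
    and mean: "total F \<rho> /\<^sub>R ?A \<in> interior K" and diff: "\<forall>a\<in>K. g differentiable (at a)"
    and L: "0 < L" "\<forall>a\<in>K. \<forall>b\<in>K. norm (gradient g b - gradient g a) \<le> L * norm (b - a)"
    using assms(14) unfolding PI2_def by blast
  have hom: "homogeneous_plugin g K L"
    by (intro homogeneous_plugin.intro assms(13) K L(1)) (use diff L(2) in blast)+
  have mean': "total F \<rho> /\<^sub>R ?A \<in> K" by (rule subsetD[OF interior_subset mean])
  obtain r where r: "\<And>a. a \<in> K \<Longrightarrow> norm a \<le> r"
    using compact_imp_bounded[OF K(2)] unfolding bounded_iff by blast
  \<comment> \<open>The Lipschitz condition makes the gradient continuous, hence bounded, on the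
    compact set.\<close>
  have grad_K: "compact (gradient g ` K)"
    by (intro compact_continuous_image homogeneous_plugin.continuous_on_gradient[OF hom] K(2))
  obtain G where G: "\<And>a. a \<in> K \<Longrightarrow> norm (gradient g a) \<le> G"
    using compact_imp_bounded[OF grad_K] unfolding bounded_iff by blast
  have ps: "plugin_survey F (D t) \<kappa> g K L \<rho> G r" for t
    by (intro plugin_survey.intro survey hom plugin_survey_axioms.intro assms(3,4) \<rho>K mean' G r)
  note lin = plugin_survey.lin_error_moment[OF ps]
  note plug = plugin_survey.V_plugin_moment[OF ps]
  \<comment> \<open>The constants depend on \<open>\<kappa>\<close>, \<open>F\<close>,
    \<open>L\<close>, \<open>G\<close>, \<open>r\<close> and the dimension, but not on the design,
    so one of them serves all \<open>t\<close>.\<close>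
  obtain C where C: "\<And>t. (LINT \<omega>|pspace (D t). (lin_error F (D t) \<rho> g \<omega>)\<^sup>2) \<le> C / (n_I (D t))\<^sup>2"
    using lin(2) by blast
  obtain C' where C': "\<And>t. (LINT \<omega>|pspace (D t). n_I (D t) * \<bar>V_HT_plugin (D t) \<rho> g \<omega> - V_lin F (D t) \<rho> g\<bar>)
      \<le> C' * n_I (D t) powr (- 1 / 2)"
    "\<And>t. (LINT \<omega>|pspace (D t). n_I (D t) * \<bar>V_YG_plugin (D t) \<rho> g \<omega> - V_lin F (D t) \<rho> g\<bar>)
      \<le> C' * n_I (D t) powr (- 1 / 2)"
    using plug(2,4) by blast
  show ?thesis
  proof (intro conjI allI lin(1) plug(1) plug(3))
    show "(\<lambda>t. LINT \<omega>|pspace (D t). (lin_error F (D t) \<rho> g \<omega>)\<^sup>2) \<in> O(\<lambda>t. real (n_I (D t)) powr (- 2))"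
    proof (rule bigoI[of _ C], rule always_eventually, rule allI)
      fix t
      have "real (n_I (D t)) powr (- 2) = 1 / real ((n_I (D t))\<^sup>2)"
        using regular_survey.n[OF survey[of t]] by (simp add: powr_minus_divide)
      then show "norm (LINT \<omega>|pspace (D t). (lin_error F (D t) \<rho> g \<omega>)\<^sup>2) \<le> C * norm (real (n_I (D t)) powr (- 2))"
        using C[of t] by simp
    qed
    show "(\<lambda>t. LINT \<omega>|pspace (D t). real (n_I (D t)) * \<bar>V_HT_plugin (D t) \<rho> g \<omega> - V_lin F (D t) \<rho> g\<bar>)
        \<in> O(\<lambda>t. real (n_I (D t)) powr (- 1 / 2))"
      by (rule bigoI[of _ C'], rule always_eventually, rule allI)
        (use C'(1) in \<open>simp add: integral_nonneg_AE\<close>)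
    show "(\<lambda>t. LINT \<omega>|pspace (D t). real (n_I (D t)) * \<bar>V_YG_plugin (D t) \<rho> g \<omega> - V_lin F (D t) \<rho> g\<bar>)
        \<in> O(\<lambda>t. real (n_I (D t)) powr (- 1 / 2))"
      by (rule bigoI[of _ C'], rule always_eventually, rule allI)
        (use C'(2) in \<open>simp add: integral_nonneg_AE\<close>)
  qed
qed

end
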